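(* Suppose that, for all sufficiently small $\gamma>0$, $(\varphi^\gamma,\mu^\gamma,\mathbf u^\gamma,p^\gamma)$ solves, in the thin domain $Q_{\gamma,T}=\bigcup_{t\in[0,T]}\Omega_\gamma(t)\times\{t\}$, $$\rho\Big(\frac{\partial \mathbf u^\gamma}{\partial t}+(\mathbf u^\gamma\cdot\nabla)\mathbf u^\gamma\Big)=-\nabla p^\gamma+\nabla\cdot(2\eta(\varphi^\gamma)\mathbb E_\Omega(\mathbf u^\gamma))-\varepsilon\nabla\cdot(\nabla\varphi^\gamma\otimes\nabla\varphi^\gamma),\qquad \nabla\cdot\mathbf u^\gamma=0,$$ $$\frac{\partial\varphi^\gamma}{\partial t}-\nabla\cdot(M(\varphi^\gamma)\nabla\mu^\gamma)+\mathbf u^\gamma\cdot\nabla\varphi^\gamma=0,\qquad \mu^\gamma=-\varepsilon\Delta\varphi^\gamma+\frac1\varepsilon F'(\varphi^\gamma),$$ with, on the lateral boundary $\bigcup_{t\in[0,T]}\partial\Omega_\gamma(t)\times\{t\}$, the conditions $$\mathbf u^\gamma\cdot\boldsymbol\nu^\gamma=V_N^\gamma,\qquad [\mathbb E_\Omega(\mathbf u^\gamma)\boldsymbol\nu^\gamma]_{\rm tan}=0,\qquad \nabla\varphi^\gamma\cdot\boldsymbol\nu^\gamma=0,\qquad \nabla\mu^\gamma\cdot\boldsymbol\nu^\gamma=0,$$ and that each $g^\gamma\in\{\varphi^\gamma,\mu^\gamma,\mathbf u^\gamma,p^\gamma\}$ has the expansion in the signed distance $$g^\gamma(x,t)=g^0(\pi(x,t),t)+d(x,t)\,g^1(\pi(x,t),t)+d(x,t)^2g^2(\pi(x,t),t)+\mathcal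 O(d(x,t)^3).$$ Then $(\varphi^0,\mu^0,\mathbf u^0,p^0,p^1)$ solve $$\rho\,\partial^\bullet\mathbf u^0=-\nabla_\Gamma p^0+p^1\boldsymbol\nu+\nabla_\Gamma\cdot(2\eta(\varphi^0)\mathbb E(\mathbf u^0))-\varepsilon\nabla_\Gamma\cdot(\nabla_\Gamma\varphi^0\otimes\nabla_\Gamma\varphi^0),\qquad \nabla_\Gamma\cdot\mathbf u^0=0,$$ $$\partial^\bullet\varphi^0=\nabla_\Gamma\cdot(M(\varphi^0)\nabla_\Gamma\mu^0),\qquad \mu^0=-\varepsilon\Delta_\Gamma\varphi^0+\frac1\varepsilon F'(\varphi^0)$$ on $\mathcal G_T=\bigcup_{t\in[0,T]}\Gamma(t)\times\{t\}$, and $\mathbf u^0\cdot\boldsymbol\nu=V_N$.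
   Context: $(\Gamma(t))_{t\in[0,T]}\subset\mathbb R^3$ is a sufficiently smooth closed oriented evolving surface that does not change topology, with unit normal $\boldsymbol\nu$ and normal velocity $V_N\boldsymbol\nu$. $d(\cdot,t)$ is the signed distance to $\Gamma(t)$, $\pi(x,t)$ the closest point of $\Gamma(t)$ to $x$, and $\Omega_\gamma(t)=\{x:|d(x,t)|<\gamma\}$; one has $\nabla d(x,t)=\boldsymbol\nu(\pi(x,t),t)$ and $\partial_t d(x,t)=-V_N(\pi(x,t),t)$, and $\gamma$ is small enough that $\pi$ is well defined. $V_N^\gamma(x,t)=V_N(\pi(x,t),t)$; on $\partial\Omega_\gamma(t)$ (both components $d=\pm\gamma$) the normal is taken as $\boldsymbol\nu^\gamma(x,t)=\boldsymbol\nu(\pi(x,t),t)$, and $[\cdot]_{\rm tan}$ is the component tangential to $\partial\Omega_\gamma(t)$. $\rho,\varepsilon>0$ are constants; $\eta$ and $M$ are sufficiently smooth and $F\in C^2$. $\mathbb E_\Omega(\mathbf u)=\frac12(\nabla\mathbf u+(\nabla\mathbf u)^T)$. The coefficient functions $g^0,g^1,g^2$ are smooth functions on $\mathcal G_T$ that do not depend on $\gamma$ or $d$; the remainders are smooth and may be differentiated (each derivative lowering the order in $d$ by one). Surface operators: $\mathbb P=\mathbb I-\boldsymbol\nu\otimes\boldsymbol\nu$; with $(\cdot)^e$ an arbitrary extension, $\nabla_\Gamma\phi=\mathbb P\nabla\phi^e=(\underline D_1\phi,\underline D_2\phi,\underline D_3\phi)$; for vector fields $\nabla_\Gamma\mathbf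 v=\mathbb P\nabla\mathbf v^e\mathbb P$, $\nabla_\Gamma\cdot\mathbf v=\mathrm{tr}(\nabla_\Gamma\mathbf v)$, $\mathbb E(\mathbf v)=\frac12(\nabla_\Gamma\mathbf v+(\nabla_\Gamma\mathbf v)^T)$; the surface divergence of a matrix field is taken using the $\underline D_j$ componentwise; $\Delta_\Gamma=\nabla_\Gamma\cdot\nabla_\Gamma$. Normal time derivative: $\partial^\circ\phi=\partial_t\phi^e+V_N\nabla\phi^e\cdot\boldsymbol\nu$, componentwise for vectors. $\partial^\bullet$ is the material derivative along $\mathbf u^0$: with $\mathbf u^0_T=\mathbb P\mathbf u^0$, $\partial^\bullet\phi=\partial^\circ\phi+\mathbf u^0_T\cdot\nabla_\Gamma\phi$ and $(\partial^\bullet\mathbf v)_i=\partial^\circ v_i+\sum_j(\mathbf u^0_T)_j\underline D_jv_i$.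
   Formalization: The term +p¹ν in the limit momentum equation is corrected to −p¹ν: with ∇d=ν and −∇p^γ in the bulk the plus sign is false (rigid rotation u=ω×x, p=(ρ/2)|ω×x|² around the static unit sphere gives p¹=ρ|ω×ν|² but normal acceleration −ρ|ω×ν|²). *)

theory Defs
  imports "HOL-Analysis.Analysis"
begin

section \<open>Derivatives and smoothness relative to a set\<close>

text \<open>
  All fields are functions of a space-time point \<open>(x, t)\<close>. Derivatives are taken within a set \<open>S\<close>
  (a closed thin domain, or the slab over \<open>[0,T]\<close>), so that they are one-sided at \<open>t = 0\<close>, at \<open>t = T\<close>
  and on the lateral boundary. The sets used here have enough interior near each of their points for
  the derivative within \<open>S\<close> to be unique.
\<close>

type_synonym spacetime = "(real^3) \<times> real"

definition dderiv :: "'a::euclidean_space set \<Rightarrow> 'a \<Rightarrow> ('a \<Rightarrow> 'b::real_normed_vector) \<Rightarrow> 'a \<Rightarrow> 'b" where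
  "dderiv S h f z = frechet_derivative f (at z within S) h"

primrec iter_dderiv ::
    "'a::euclidean_space set \<Rightarrow> 'a list \<Rightarrow> ('a \<Rightarrow> 'b::real_normed_vector) \<Rightarrow> 'a \<Rightarrow> 'b" where
  "iter_dderiv S [] f = f"
| "iter_dderiv S (h # hs) f = iter_dderiv S hs (dderiv S h f)"

primrec Ck_on :: "nat \<Rightarrow> ('a::euclidean_space \<Rightarrow> 'b::real_normed_vector) \<Rightarrow> 'a set \<Rightarrow> bool" where
  "Ck_on 0 f S \<longleftrightarrow> continuous_on S f"
| "Ck_on (Suc k) f S \<longleftrightarrow> f differentiable_on S \<and> (\<forall>h\<in>Basis. Ck_on k (dderiv S h f) S)"

definition slab :: "real \<Rightarrow> spacetime set" where
  "slab T = UNIV \<times> {0..T}"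

text \<open>Smoothness on a thin subset of the slab (such as the space-time surface) means that there is a
  smooth extension to a relatively open neighbourhood in the slab.\<close>

definition Ck_ext :: "nat \<Rightarrow> real \<Rightarrow> (spacetime \<Rightarrow> 'b::real_normed_vector) \<Rightarrow> spacetime set \<Rightarrow> bool" where
  "Ck_ext k T f A \<longleftrightarrow> (\<exists>N g. open N \<and> A \<subseteq> N \<and> Ck_on k g (N \<inter> slab T) \<and> (\<forall>z\<in>A. g z = f z))"


section \<open>Differential operators in space and time\<close>

definition dx :: "spacetime set \<Rightarrow> 3 \<Rightarrow> (spacetime \<Rightarrow> real) \<Rightarrow> spacetime \<Rightarrow> real" where
  "dx S j f = dderiv S (axis j 1, 0) f"

definition dt :: "spacetime set \<Rightarrow> (spacetime \<Rightarrow> 'b::real_normed_vector) \<Rightarrow> spacetime \<Rightarrow> 'b" where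
  "dt S f = dderiv S (0, 1) f"

definition grad :: "spacetime set \<Rightarrow> (spacetime \<Rightarrow> real) \<Rightarrow> spacetime \<Rightarrow> real^3" where
  "grad S f z = (\<chi> j. dx S j f z)"

definition vgrad :: "spacetime set \<Rightarrow> (spacetime \<Rightarrow> real^3) \<Rightarrow> spacetime \<Rightarrow> real^3^3" where
  "vgrad S v z = (\<chi> i j. dx S j (\<lambda>w. v w $ i) z)"

definition divg :: "spacetime set \<Rightarrow> (spacetime \<Rightarrow> real^3) \<Rightarrow> spacetime \<Rightarrow> real" where
  "divg S v z = (\<Sum>j\<in>UNIV. dx S j (\<lambda>w. v w $ j) z)"

definition mdivg :: "spacetime set \<Rightarrow> (spacetime \<Rightarrow> real^3^3) \<Rightarrow> spacetime \<Rightarrow> real^3" where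
  "mdivg S A z = (\<chi> i. \<Sum>j\<in>UNIV. dx S j (\<lambda>w. A w $ i $ j) z)"

definition laplace :: "spacetime set \<Rightarrow> (spacetime \<Rightarrow> real) \<Rightarrow> spacetime \<Rightarrow> real" where
  "laplace S f = divg S (grad S f)"

definition convect :: "spacetime set \<Rightarrow> (spacetime \<Rightarrow> real^3) \<Rightarrow> (spacetime \<Rightarrow> real^3) \<Rightarrow> spacetime \<Rightarrow> real^3" where
  "convect S u v z = (\<chi> i. \<Sum>j\<in>UNIV. u z $ j * dx S j (\<lambda>w. v w $ i) z)"

definition sym_part :: "real^3^3 \<Rightarrow> real^3^3" where
  "sym_part A = (1/2) *\<^sub>R (A + transpose A)"

definition strain :: "spacetime set \<Rightarrow> (spacetime \<Rightarrow> real^3) \<Rightarrow> spacetime \<Rightarrow> real^3^3" where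
  "strain S v z = sym_part (vgrad S v z)"

definition outer_prod :: "real^3 \<Rightarrow> real^3 \<Rightarrow> real^3^3" (infixl "\<otimes>\<^sub>o" 75) where
  "a \<otimes>\<^sub>o b = (\<chi> i j. a $ i * b $ j)"

definition tan_part :: "real^3 \<Rightarrow> real^3 \<Rightarrow> real^3" where
  "tan_part n a = a - (a \<bullet> n) *\<^sub>R n"


section \<open>Evolving closed surfaces\<close>

definition closed_hypersurface :: "nat \<Rightarrow> (real^3) set \<Rightarrow> bool" where
  "closed_hypersurface k M \<longleftrightarrow> compact M \<and> M \<noteq> {} \<and>
     (\<forall>x\<in>M. \<exists>U f. open U \<and> x \<in> U \<and> Ck_on k (f :: real^3 \<Rightarrow> real) U \<and>
        M \<inter> U = {y\<in>U. f y = 0} \<and> (\<forall>y\<in>U. frechet_derivative f (at y) \<noteq> (\<lambda>_. 0)))"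

definition st_surface :: "real \<Rightarrow> (real \<Rightarrow> (real^3) set) \<Rightarrow> spacetime set" where
  "st_surface T \<Gamma> = {(x, t). t \<in> {0..T} \<and> x \<in> \<Gamma> t}"

text \<open>The topology does not change: \<open>\<Phi>(\<cdot>, t)\<close> is a diffeomorphism of \<open>\<Gamma>(0)\<close> onto \<open>\<Gamma>(t)\<close> with inverse
  \<open>\<Psi>(\<cdot>, t)\<close>, and both are smooth in space-time.\<close>

definition evolving_surface :: "nat \<Rightarrow> real \<Rightarrow> (real \<Rightarrow> (real^3) set) \<Rightarrow> bool" where
  "evolving_surface k T \<Gamma> \<longleftrightarrow> closed_hypersurface k (\<Gamma> 0) \<and>
     (\<exists>\<Phi> \<Psi> :: spacetime \<Rightarrow> real^3.
        Ck_ext k T \<Phi> (\<Gamma> 0 \<times> {0..T}) \<and> Ck_ext k T \<Psi> (st_surface T \<Gamma>) \<and>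
        (\<forall>x\<in>\<Gamma> 0. \<Phi> (x, 0) = x) \<and>
        (\<forall>t\<in>{0..T}. (\<lambda>x. \<Phi> (x, t)) ` \<Gamma> 0 = \<Gamma> t \<and> (\<forall>x\<in>\<Gamma> 0. \<Psi> (\<Phi> (x, t), t) = x)))"

text \<open>Tangent vectors are the velocities of curves in \<open>\<Gamma>(t)\<close>; the normal velocity is the normal
  component of the velocity of any trajectory \<open>c\<close> with \<open>c(s) \<in> \<Gamma>(s)\<close>.\<close>

definition unit_normal :: "real \<Rightarrow> (real \<Rightarrow> (real^3) set) \<Rightarrow> (spacetime \<Rightarrow> real^3) \<Rightarrow> bool" where
  "unit_normal T \<Gamma> \<nu> \<longleftrightarrow> continuous_on (st_surface T \<Gamma>) \<nu> \<and>
     (\<forall>t\<in>{0..T}. \<forall>y\<in>\<Gamma> t. norm (\<nu> (y, t)) = 1 \<and>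
        (\<forall>c v. c (0::real) = y \<and> (\<forall>s. c s \<in> \<Gamma> t) \<and> (c has_vector_derivative v) (at 0)
           \<longrightarrow> v \<bullet> \<nu> (y, t) = 0))"

definition normal_velocity ::
    "real \<Rightarrow> (real \<Rightarrow> (real^3) set) \<Rightarrow> (spacetime \<Rightarrow> real^3) \<Rightarrow> (spacetime \<Rightarrow> real) \<Rightarrow> bool" where
  "normal_velocity T \<Gamma> \<nu> V \<longleftrightarrow>
     (\<forall>t\<in>{0..T}. \<forall>y\<in>\<Gamma> t. \<forall>c v. c t = y \<and> (\<forall>s\<in>{0..T}. c s \<in> \<Gamma> s) \<and>
        (c has_vector_derivative v) (at t within {0..T}) \<longrightarrow> v \<bullet> \<nu> (y, t) = V (y, t))"

text \<open>The value \<open>g(\<pi>(x,t), t)\<close> at the closest point.\<close>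

definition lift :: "(real \<Rightarrow> (real^3) set) \<Rightarrow> (spacetime \<Rightarrow> 'b) \<Rightarrow> spacetime \<Rightarrow> 'b" where
  "lift \<Gamma> g = (\<lambda>(x, t). g (closest_point (\<Gamma> t) x, t))"

definition thin :: "(spacetime \<Rightarrow> real) \<Rightarrow> real \<Rightarrow> real \<Rightarrow> (real^3) set" where
  "thin d \<gamma> t = {x. \<bar>d (x, t)\<bar> < \<gamma>}"

definition thin_domain :: "real \<Rightarrow> (spacetime \<Rightarrow> real) \<Rightarrow> real \<Rightarrow> spacetime set" where
  "thin_domain T d \<gamma> = {(x, t). t \<in> {0..T} \<and> x \<in> thin d \<gamma> t}"

definition thin_lateral :: "real \<Rightarrow> (spacetime \<Rightarrow> real) \<Rightarrow> real \<Rightarrow> spacetime set" where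
  "thin_lateral T d \<gamma> = {(x, t). t \<in> {0..T} \<and> x \<in> frontier (thin d \<gamma> t)}"

definition thin_closed :: "real \<Rightarrow> (spacetime \<Rightarrow> real) \<Rightarrow> real \<Rightarrow> spacetime set" where
  "thin_closed T d \<gamma> = {(x, t). t \<in> {0..T} \<and> x \<in> closure (thin d \<gamma> t)}"

text \<open>The sign of the distance is the one for which it increases in the direction of the normal.\<close>

definition signed_distance :: "(real^3) set \<Rightarrow> (real^3 \<Rightarrow> real^3) \<Rightarrow> (real^3 \<Rightarrow> real) \<Rightarrow> bool" where
  "signed_distance M n \<delta> \<longleftrightarrow> continuous_on UNIV \<delta> \<and> (\<forall>x. \<bar>\<delta> x\<bar> = infdist x M) \<and>
     (\<forall>y\<in>M. (\<delta> has_derivative (\<lambda>h. n y \<bullet> h)) (at y))"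

text \<open>Standing facts about the tube of width \<open>\<gamma>\<^sub>0\<close>; for a \<open>C\<^sup>3\<close> evolving closed surface they hold for all
  small \<open>\<gamma>\<^sub>0\<close>.\<close>

definition tubular_nbhd ::
    "real \<Rightarrow> (real \<Rightarrow> (real^3) set) \<Rightarrow> (spacetime \<Rightarrow> real^3) \<Rightarrow> (spacetime \<Rightarrow> real) \<Rightarrow> (spacetime \<Rightarrow> real)
       \<Rightarrow> real \<Rightarrow> bool" where
  "tubular_nbhd T \<Gamma> \<nu> V d \<gamma>\<^sub>0 \<longleftrightarrow>
     (\<forall>(x, t)\<in>thin_domain T d \<gamma>\<^sub>0. \<exists>!y. y \<in> \<Gamma> t \<and> dist x y = infdist x (\<Gamma> t)) \<and>
     Ck_on 3 d (thin_domain T d \<gamma>\<^sub>0) \<and>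
     (\<forall>z\<in>thin_domain T d \<gamma>\<^sub>0. grad (thin_domain T d \<gamma>\<^sub>0) d z = lift \<Gamma> \<nu> z \<and>
                          dt (thin_domain T d \<gamma>\<^sub>0) d z = - lift \<Gamma> V z)"


section \<open>Operators on the space-time surface\<close>

text \<open>The choice of the extension is arbitrary: the operators below do not depend on it.\<close>

definition extension :: "real \<Rightarrow> (real \<Rightarrow> (real^3) set) \<Rightarrow> (spacetime \<Rightarrow> 'b::real_normed_vector) \<Rightarrow> spacetime \<Rightarrow> 'b" where
  "extension T \<Gamma> f = (SOME g. \<forall>z\<in>st_surface T \<Gamma>. g z = f z \<and> g differentiable (at z within slab T))"

definition proj :: "real^3 \<Rightarrow> real^3^3" where
  "proj n = mat 1 - n \<otimes>\<^sub>o n"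

definition sgrad ::
    "real \<Rightarrow> (real \<Rightarrow> (real^3) set) \<Rightarrow> (spacetime \<Rightarrow> real^3) \<Rightarrow> (spacetime \<Rightarrow> real) \<Rightarrow> spacetime \<Rightarrow> real^3" where
  "sgrad T \<Gamma> \<nu> f z = proj (\<nu> z) *v grad (slab T) (extension T \<Gamma> f) z"

definition svgrad ::
    "real \<Rightarrow> (real \<Rightarrow> (real^3) set) \<Rightarrow> (spacetime \<Rightarrow> real^3) \<Rightarrow> (spacetime \<Rightarrow> real^3) \<Rightarrow> spacetime \<Rightarrow> real^3^3" where
  "svgrad T \<Gamma> \<nu> v z = proj (\<nu> z) ** vgrad (slab T) (extension T \<Gamma> v) z ** proj (\<nu> z)"

definition sdiv ::
    "real \<Rightarrow> (real \<Rightarrow> (real^3) set) \<Rightarrow> (spacetime \<Rightarrow> real^3) \<Rightarrow> (spacetime \<Rightarrow> real^3) \<Rightarrow> spacetime \<Rightarrow> real" where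
  "sdiv T \<Gamma> \<nu> v z = trace (svgrad T \<Gamma> \<nu> v z)"

definition smdiv ::
    "real \<Rightarrow> (real \<Rightarrow> (real^3) set) \<Rightarrow> (spacetime \<Rightarrow> real^3) \<Rightarrow> (spacetime \<Rightarrow> real^3^3) \<Rightarrow> spacetime \<Rightarrow> real^3" where
  "smdiv T \<Gamma> \<nu> A z = (\<chi> i. \<Sum>j\<in>UNIV. sgrad T \<Gamma> \<nu> (\<lambda>w. A w $ i $ j) z $ j)"

definition sstrain ::
    "real \<Rightarrow> (real \<Rightarrow> (real^3) set) \<Rightarrow> (spacetime \<Rightarrow> real^3) \<Rightarrow> (spacetime \<Rightarrow> real^3) \<Rightarrow> spacetime \<Rightarrow> real^3^3" where
  "sstrain T \<Gamma> \<nu> v z = sym_part (svgrad T \<Gamma> \<nu> v z)"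

definition slaplace ::
    "real \<Rightarrow> (real \<Rightarrow> (real^3) set) \<Rightarrow> (spacetime \<Rightarrow> real^3) \<Rightarrow> (spacetime \<Rightarrow> real) \<Rightarrow> spacetime \<Rightarrow> real" where
  "slaplace T \<Gamma> \<nu> f = sdiv T \<Gamma> \<nu> (sgrad T \<Gamma> \<nu> f)"

definition normal_dt ::
    "real \<Rightarrow> (real \<Rightarrow> (real^3) set) \<Rightarrow> (spacetime \<Rightarrow> real^3) \<Rightarrow> (spacetime \<Rightarrow> real)
       \<Rightarrow> (spacetime \<Rightarrow> real) \<Rightarrow> spacetime \<Rightarrow> real" where
  "normal_dt T \<Gamma> \<nu> V f z = dt (slab T) (extension T \<Gamma> f) z
     + V z * (grad (slab T) (extension T \<Gamma> f) z \<bullet> \<nu> z)"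

definition material_dt ::
    "real \<Rightarrow> (real \<Rightarrow> (real^3) set) \<Rightarrow> (spacetime \<Rightarrow> real^3) \<Rightarrow> (spacetime \<Rightarrow> real) \<Rightarrow> (spacetime \<Rightarrow> real^3)
       \<Rightarrow> (spacetime \<Rightarrow> real) \<Rightarrow> spacetime \<Rightarrow> real" where
  "material_dt T \<Gamma> \<nu> V u f z = normal_dt T \<Gamma> \<nu> V f z + (proj (\<nu> z) *v u z) \<bullet> sgrad T \<Gamma> \<nu> f z"

definition vmaterial_dt ::
    "real \<Rightarrow> (real \<Rightarrow> (real^3) set) \<Rightarrow> (spacetime \<Rightarrow> real^3) \<Rightarrow> (spacetime \<Rightarrow> real) \<Rightarrow> (spacetime \<Rightarrow> real^3)
       \<Rightarrow> (spacetime \<Rightarrow> real^3) \<Rightarrow> spacetime \<Rightarrow> real^3" where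
  "vmaterial_dt T \<Gamma> \<nu> V u v z = (\<chi> i. material_dt T \<Gamma> \<nu> V u (\<lambda>w. v w $ i) z)"


section \<open>Expansion in the signed distance\<close>

text \<open>The constant in the remainder estimate is uniform in \<open>\<gamma>\<close>. Each derivative of the remainder, in
  space or in time, lowers the order in \<open>d\<close> by one; derivatives up to order two are controlled, which
  is the order of the differential equations.\<close>

definition distance_expansion ::
    "real \<Rightarrow> (real \<Rightarrow> (real^3) set) \<Rightarrow> (spacetime \<Rightarrow> real) \<Rightarrow> real \<Rightarrow> (real \<Rightarrow> spacetime \<Rightarrow> 'b::real_normed_vector)
       \<Rightarrow> (spacetime \<Rightarrow> 'b) \<Rightarrow> (spacetime \<Rightarrow> 'b) \<Rightarrow> (spacetime \<Rightarrow> 'b) \<Rightarrow> bool" where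
  "distance_expansion T \<Gamma> d \<gamma>\<^sub>0 g g0 g1 g2 \<longleftrightarrow>
     Ck_ext 2 T g0 (st_surface T \<Gamma>) \<and> Ck_ext 2 T g1 (st_surface T \<Gamma>) \<and> Ck_ext 2 T g2 (st_surface T \<Gamma>) \<and>
     (\<exists>C. \<forall>\<gamma>. 0 < \<gamma> \<and> \<gamma> < \<gamma>\<^sub>0 \<longrightarrow>
        (\<exists>r. (\<forall>z\<in>thin_closed T d \<gamma>.
                g \<gamma> z = lift \<Gamma> g0 z + d z *\<^sub>R lift \<Gamma> g1 z + (d z)\<^sup>2 *\<^sub>R lift \<Gamma> g2 z + r z) \<and>
             Ck_on 2 r (thin_closed T d \<gamma>) \<and>
             (\<forall>hs z. set hs \<subseteq> Basis \<and> length hs \<le> 2 \<and> z \<in> thin_closed T d \<gamma> \<longrightarrow>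
                norm (iter_dderiv (thin_closed T d \<gamma>) hs r z) \<le> C * \<bar>d z\<bar> ^ (3 - length hs))))"

end

theory Submission
  imports Defs
begin

text \<open>
  All four equations are read off on the surface itself, where \<open>d = 0\<close>, and the limit
  \<open>\<gamma> \<rightarrow> 0\<close> enters only through the boundary conditions. Write \<open>W\<close> for the largest tube, \<open>\<Sigma>\<close> for the
  space-time surface, and \<open>n\<close>, \<open>v\<close> for the values of \<open>\<nu>\<close>, \<open>V\<close> at the closest point, so that
  \<open>\<nabla>d = n\<close> and \<open>\<partial>\<^sub>td = -v\<close> in \<open>W\<close>.

  \<^bold>\<open>Geometry.\<close> The closest point of \<open>x\<close> is \<open>x - d n\<close>, and it is the same for all points of the segment
  from \<open>x\<close> to its closest point. Hence \<open>g(\<pi>(x,t), t)\<close> has zero derivative along \<open>n\<close> throughout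
  \<open>W\<close> (\<open>normal_derivative_lift\<close>). On \<open>\<Sigma>\<close> the derivative of the closest-point map is the projection
  onto the space-time directions tangential to \<open>\<Sigma>\<close>, so the tangential and normal-time derivatives of
  an extension depend on its surface values only (\<open>dderiv_extension_foot\<close>), and every surface
  operator may be computed from any convenient extension.

  \<^bold>\<open>Expansion.\<close> The quadratic polynomial \<open>G\<close> in \<open>d\<close> does not depend on \<open>\<gamma>\<close>, and the remainder vanishes
  on \<open>\<Sigma>\<close> together with its first and second derivatives. So the equations for the fields of width
  \<open>\<gamma>\<close>, evaluated on \<open>\<Sigma>\<close>, are equations for the polynomials (\<open>expansion\<close>, \<open>agree\<close>).

  \<^bold>\<open>Boundary conditions.\<close> As \<open>\<gamma>\<close> varies, the lateral boundaries \<open>|d| = \<gamma>\<close> sweep out all of \<open>W\<close> except \<open>\<Sigma>\<close>. The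
  quantities \<open>U \<cdot> n - v\<close> and \<open>\<partial>\<^sub>n\<Phi>\<close> are polynomials in \<open>d\<close> whose coefficients are lifts from \<open>\<Sigma>\<close>, of
  degree two and one, and the boundary conditions make them \<open>O(d\<^sup>3)\<close> and \<open>O(d\<^sup>2)\<close>; therefore
  they vanish identically in \<open>W\<close> (\<open>normal_trace_expansion\<close>, \<open>no_flux_expansion\<close>). From \<open>U \<cdot> n = v\<close> it
  follows that \<open>n \<cdot> E(U) n = \<partial>\<^sub>n(U \<cdot> n) = \<partial>\<^sub>nv = 0\<close>, so the tangential condition controls the whole vector
  \<open>E(U) n\<close>. It is \<open>O(d\<^sup>2)\<close>, and thus vanishes on \<open>\<Sigma>\<close> together with its normal derivative
  (\<open>normal_strain_flat\<close>).

  \<^bold>\<open>Divergences.\<close> As \<open>n\<close> is constant in the normal direction, the surface divergence of \<open>Y\<close> and the full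
  divergence differ by \<open>n \<cdot> \<partial>\<^sub>nY = \<partial>\<^sub>n(Y \<cdot> n)\<close> (\<open>sdiv_eq_divg\<close>). This is zero for the velocity, for the
  diffusive fluxes and for both stress tensors, by the previous paragraph. The pressure
  gradient on \<open>\<Sigma>\<close> has the tangential part \<open>\<nabla>\<^sub>\<Gamma>p\<^sup>0\<close> and the normal part \<open>p\<^sup>1\<nu>\<close>, and the latter gives the term
  \<open>-p\<^sup>1\<nu>\<close> of the limit momentum equation.
\<close>

section \<open>Derivatives within sets that contain a cone of directions\<close>

text \<open>At a lateral boundary point of a closed thin domain a coordinate direction may leave the domain to
  both sides, so uniqueness of the derivative cannot be tested along the basis vectors. What
  survives is an open set of directions that point into the domain for a short while.\<close>

definition fat_at :: "'a::real_normed_vector set \<Rightarrow> 'a \<Rightarrow> bool" where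
  "fat_at S z \<longleftrightarrow> (\<exists>h0 e. 0 < e \<and>
     (\<forall>h\<in>ball h0 e. \<exists>s0>0. \<forall>s. 0 < s \<and> s < s0 \<longrightarrow> z + s *\<^sub>R h \<in> S))"

lemma derivative_of_zero_along_ray:
  fixes z h :: "'a::real_normed_vector"
  assumes L: "((\<lambda>_. 0 :: 'b::real_normed_vector) has_derivative L) (at z within S)"
    and s0: "0 < s0" "\<And>s. 0 < s \<Longrightarrow> s < s0 \<Longrightarrow> z + s *\<^sub>R h \<in> S"
  shows "L h = 0"
proof -
  have c: "((\<lambda>s::real. z + s *\<^sub>R h) has_derivative (\<lambda>s. s *\<^sub>R h)) (at 0 within {0<..<s0})"
    by (auto intro!: derivative_eq_intros)
  have "(\<lambda>s::real. z + s *\<^sub>R h) ` {0<..<s0} \<subseteq> S" using s0 by auto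
  then have "((\<lambda>_. 0) has_derivative L) (at (z + 0 *\<^sub>R h) within (\<lambda>s::real. z + s *\<^sub>R h) ` {0<..<s0})"
    using L has_derivative_subset by force
  from has_derivative_in_compose[OF c this]
  have d: "((\<lambda>_. 0) has_derivative (\<lambda>s. L (s *\<^sub>R h))) (at 0 within {0<..<s0})" .
  then have d2: "((\<lambda>_. 0::'b) has_vector_derivative L h) (at 0 within {0<..<s0})"
    using has_derivative_linear[OF L] by (simp add: has_vector_derivative_def linear_simps linear_scale)
  have "((\<lambda>_. 0::'b) has_vector_derivative 0) (at 0 within {0<..<s0})" by simp
  moreover have "at 0 within {0<..<s0} \<noteq> bot"
    using s0(1) by (simp add: at_within_eq_bot_iff)
  ultimately show ?thesis using d2 vector_derivative_unique_within by blast
qed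

text \<open>Two derivatives agree on the admissible directions, and an open set of vectors spans the space.\<close>

lemma fat_at_derivative_unique:
  fixes f :: "'a::real_normed_vector \<Rightarrow> 'b::real_normed_vector"
  assumes "fat_at S z" "(f has_derivative D) (at z within S)" "(f has_derivative D') (at z within S)"
  shows "D = D'"
proof -
  define L where "L h = D h - D' h" for h
  have L: "((\<lambda>_. 0 :: 'b) has_derivative L) (at z within S)"
    using has_derivative_diff[OF assms(2,3)] by (simp add: L_def[abs_def])
  obtain h0 e where e: "0 < e" and
    c: "\<And>h. h \<in> ball h0 e \<Longrightarrow> \<exists>s0>0. \<forall>s. 0 < s \<and> s < s0 \<longrightarrow> z + s *\<^sub>R h \<in> S"
    using assms(1) unfolding fat_at_def by blast
  have z: "L h = 0" if "h \<in> ball h0 e" for h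
    using c[OF that] derivative_of_zero_along_ray[OF L] by blast
  have "L v = 0" for v
  proof -
    \<comment> \<open>small enough for \<open>h0 + s v\<close> to stay in the ball of admissible directions\<close>
    define s where "s = e / (2 * (norm v + 1))"
    have s: "s > 0" using e by (simp add: s_def add_nonneg_pos)
    have "s * norm v < e"
    proof -
      have "s * norm v \<le> s * (norm v + 1)" using s by simp
      also have "\<dots> = e / 2" by (simp add: s_def field_simps add_nonneg_eq_0_iff)
      finally show ?thesis using e by simp
    qed
    then have "h0 + s *\<^sub>R v \<in> ball h0 e" using s by (simp add: dist_norm)
    then have "L (h0 + s *\<^sub>R v) = 0" "L h0 = 0" using z e by auto
    then have "s *\<^sub>R L v = 0"
      using has_derivative_linear[OF L] by (simp add: linear_add linear_scale)
    then show ?thesis using s by simp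
  qed
  then show ?thesis by (auto simp: L_def)
qed

lemma fat_at_frechet:
  assumes "fat_at S z" "(f has_derivative D) (at z within S)"
  shows "frechet_derivative f (at z within S) = D"
  by (meson assms differentiable_def fat_at_derivative_unique frechet_derivative_works)

lemma fat_at_mono: "fat_at S z \<Longrightarrow> S \<subseteq> S' \<Longrightarrow> fat_at S' z"
  unfolding fat_at_def by (meson subsetD)

lemma ray_in_slab:
  assumes "z \<in> slab T" and h: "snd h = 0 \<or> snd z < T \<and> 0 < snd h \<or> 0 < snd z \<and> snd h < 0"
  shows "\<exists>s0>0. \<forall>s. 0 < s \<and> s < s0 \<longrightarrow> z + s *\<^sub>R h \<in> slab T"
proof -
  have t: "0 \<le> snd z" "snd z \<le> T" using assms by (auto simp: slab_def)
  define s0 where "s0 = (if snd h = 0 then 1 else if 0 < snd h then (T - snd z) / snd h else snd z / - snd h)"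
  have "s0 > 0" using h by (auto simp: s0_def divide_pos_neg)
  moreover have "z + s *\<^sub>R h \<in> slab T" if s: "0 < s" "s < s0" for s
  proof -
    have "0 \<le> snd z + s * snd h \<and> snd z + s * snd h \<le> T"
    proof (cases "snd h" "0::real" rule: linorder_cases)
      case less
      then have "s * - snd h < snd z" using s by (simp add: s0_def field_simps)
      moreover have "s * snd h \<le> 0" using s less by (simp add: mult_nonneg_nonpos)
      ultimately show ?thesis using t by simp
    next
      case greater
      then have "s * snd h < T - snd z" using s by (simp add: s0_def pos_less_divide_eq)
      moreover have "s * snd h \<ge> 0" using s greater by simp
      ultimately show ?thesis using t by linarith
    qed (use t in auto)
    then show ?thesis by (cases z, cases h) (auto simp: slab_def)
  qed
  ultimately show ?thesis by blast
qed

lemma fat_at_slab: assumes "0 < T" "z \<in> slab T" shows "fat_at (slab T) z"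
proof -
  define \<sigma> :: real where "\<sigma> = (if snd z < T then 1 else -1)"
  have "\<exists>s0>0. \<forall>s. 0 < s \<and> s < s0 \<longrightarrow> z + s *\<^sub>R h \<in> slab T" if h: "h \<in> ball (0, \<sigma>) 1" for h
  proof (rule ray_in_slab[OF assms(2)])
    have "\<bar>\<sigma> - snd h\<bar> < 1" using h dist_snd_le[of "(0,\<sigma>)" h] by (auto simp: dist_real_def)
    then show "snd h = 0 \<or> snd z < T \<and> 0 < snd h \<or> 0 < snd z \<and> snd h < 0"
      using assms by (auto simp: \<sigma>_def slab_def split: if_splits)
  qed
  then show ?thesis unfolding fat_at_def
    by - (rule exI[of _ "(0, \<sigma>)"], rule exI[of _ "1::real"], use zero_less_one in blast)
qed

lemma dderiv_eqI:
  "fat_at S z \<Longrightarrow> (f has_derivative D) (at z within S) \<Longrightarrow> dderiv S h f z = D h"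
  by (simp add: dderiv_def fat_at_frechet)

lemma has_derivative_dderiv:
  "f differentiable (at z within S) \<Longrightarrow> (f has_derivative (\<lambda>h. dderiv S h f z)) (at z within S)"
  by (simp add: dderiv_def[abs_def] frechet_derivative_works[symmetric] eta_contract_eq)

lemma linear_dderiv:
  "f differentiable (at z within S) \<Longrightarrow> linear (\<lambda>h. dderiv S h f z)"
  using has_derivative_dderiv has_derivative_linear by blast

lemma dderiv_basis_sum:
  assumes "f differentiable (at z within S)"
  shows "dderiv S h f z = (\<Sum>b\<in>Basis. (h \<bullet> b) *\<^sub>R dderiv S b f z)"
proof -
  have "dderiv S (\<Sum>b\<in>Basis. (h \<bullet> b) *\<^sub>R b) f z = (\<Sum>b\<in>Basis. (h \<bullet> b) *\<^sub>R dderiv S b f z)"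
    unfolding linear_sum[OF linear_dderiv[OF assms], of "\<lambda>b. (h \<bullet> b) *\<^sub>R b" Basis]
    by (simp only: linear_scale[OF linear_dderiv[OF assms]])
  then show ?thesis by (simp add: euclidean_representation)
qed

lemma differentiable_cong_on:
  assumes "f differentiable (at z within S)" "z \<in> S" "\<And>w. w \<in> S \<Longrightarrow> f w = g w"
  shows "g differentiable (at z within S)"
  using assms differentiable_transform_within[of f z S 1 g] by auto

lemma dderiv_cong_on:
  assumes "fat_at S z" "f differentiable (at z within S)" "z \<in> S" "\<And>w. w \<in> S \<Longrightarrow> f w = g w"
  shows "dderiv S h g z = dderiv S h f z"
  using has_derivative_transform[OF assms(3) _ has_derivative_dderiv[OF assms(2)], of g] assms(4)
  by (auto intro!: dderiv_eqI[OF assms(1)])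

lemma dderiv_const: "fat_at S z \<Longrightarrow> dderiv S h (\<lambda>_. c) z = 0"
  by (rule dderiv_eqI) auto

lemma dderiv_add:
  assumes "fat_at S z" "f differentiable (at z within S)" "g differentiable (at z within S)"
  shows "dderiv S h (\<lambda>w. f w + g w) z = dderiv S h f z + dderiv S h g z"
  using assms by (intro dderiv_eqI has_derivative_add has_derivative_dderiv)

lemma dderiv_minus:
  assumes "fat_at S z" "f differentiable (at z within S)"
  shows "dderiv S h (\<lambda>w. - f w) z = - dderiv S h f z"
  using assms by (intro dderiv_eqI has_derivative_minus has_derivative_dderiv)

lemma dderiv_sum:
  assumes "fat_at S z" "\<And>i. i \<in> I \<Longrightarrow> f i differentiable (at z within S)"
  shows "dderiv S h (\<lambda>w. \<Sum>i\<in>I. f i w) z = (\<Sum>i\<in>I. dderiv S h (f i) z)"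
  using assms by (intro dderiv_eqI has_derivative_sum has_derivative_dderiv)

lemma dderiv_scaleR:
  fixes a :: "_ \<Rightarrow> real"
  assumes "fat_at S z" "a differentiable (at z within S)" "f differentiable (at z within S)"
  shows "dderiv S h (\<lambda>w. a w *\<^sub>R f w) z = a z *\<^sub>R dderiv S h f z + dderiv S h a z *\<^sub>R f z"
  using assms by (intro dderiv_eqI has_derivative_scaleR has_derivative_dderiv)

lemma dderiv_mult:
  fixes a f :: "_ \<Rightarrow> real"
  assumes "fat_at S z" "a differentiable (at z within S)" "f differentiable (at z within S)"
  shows "dderiv S h (\<lambda>w. a w * f w) z = a z * dderiv S h f z + dderiv S h a z * f z"
  using dderiv_scaleR[OF assms] by simp

lemma dderiv_linear:
  assumes "fat_at S z" "bounded_linear L" "f differentiable (at z within S)"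
  shows "dderiv S h (\<lambda>w. L (f w)) z = L (dderiv S h f z)"
  by (rule dderiv_eqI[OF assms(1) bounded_linear.has_derivative[OF assms(2)
        has_derivative_dderiv[OF assms(3)]]])

lemma differentiable_linear:
  assumes "bounded_linear L" "f differentiable F"
  shows "(\<lambda>w. L (f w)) differentiable F"
  using bounded_linear.has_derivative[OF assms(1)] assms(2) unfolding differentiable_def by blast

lemmas dderiv_nth = dderiv_linear[OF _ bounded_linear_vec_nth]
lemmas differentiable_nth = differentiable_linear[OF bounded_linear_vec_nth]

lemma dderiv_compose:
  assumes "fat_at S z" "f differentiable (at z within S)" "f ` S \<subseteq> R"
    and "g differentiable (at (f z) within R)"
  shows "dderiv S h (\<lambda>w. g (f w)) z = dderiv R (dderiv S h f z) g (f z)"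
    and "(\<lambda>w. g (f w)) differentiable (at z within S)"
proof -
  have "(g has_derivative (\<lambda>h. dderiv R h g (f z))) (at (f z) within f ` S)"
    using has_derivative_dderiv[OF assms(4)] has_derivative_subset assms(3) by blast
  from has_derivative_in_compose[OF has_derivative_dderiv[OF assms(2)] this]
  have c: "((\<lambda>w. g (f w)) has_derivative (\<lambda>h. dderiv R (dderiv S h f z) g (f z))) (at z within S)" .
  then show "dderiv S h (\<lambda>w. g (f w)) z = dderiv R (dderiv S h f z) g (f z)"
    by (intro dderiv_eqI assms(1))
  show "(\<lambda>w. g (f w)) differentiable (at z within S)"
    using c differentiable_def by blast
qed

text \<open>The regularity in which a second-order operator makes sense at a point. It is preserved by
  products, linear maps and composition through the product and chain rules alone.\<close>

definition twice_differentiable_on ::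
    "('a::euclidean_space \<Rightarrow> 'b::real_normed_vector) \<Rightarrow> 'a set \<Rightarrow> bool"
    (infix "twice'_differentiable'_on" 50) where
  "f twice_differentiable_on S \<longleftrightarrow>
     f differentiable_on S \<and> (\<forall>h\<in>Basis. dderiv S h f differentiable_on S)"

lemma twice_differentiableD:
  assumes "f twice_differentiable_on S" "z \<in> S"
  shows "f differentiable (at z within S)"
    and "h \<in> Basis \<Longrightarrow> dderiv S h f differentiable (at z within S)"
  using assms by (auto simp: twice_differentiable_on_def differentiable_on_def)

lemma Ck_on_2_twice_differentiable: "Ck_on 2 f S \<Longrightarrow> f twice_differentiable_on S"
  by (auto simp: twice_differentiable_on_def numeral_2_eq_2)

lemma twice_differentiable_onI:
  assumes f: "\<And>z. z \<in> S \<Longrightarrow> f differentiable (at z within S)"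
    and D: "\<And>h z. h \<in> Basis \<Longrightarrow> z \<in> S \<Longrightarrow> dderiv S h f z = D h z"
    and D': "\<And>h z. h \<in> Basis \<Longrightarrow> z \<in> S \<Longrightarrow> D h differentiable (at z within S)"
  shows "f twice_differentiable_on S"
  unfolding twice_differentiable_on_def differentiable_on_def
proof (intro conjI ballI)
  fix h z assume "h \<in> (Basis :: 'a set)" "z \<in> S"
  then show "dderiv S h f differentiable (at z within S)"
    by (intro differentiable_cong_on[OF D', of h z]) (simp_all add: D)
qed (rule f)

lemma twice_differentiable_add:
  fixes f :: "'a::euclidean_space \<Rightarrow> 'b::real_normed_vector"
  assumes fat: "\<And>z. z \<in> S \<Longrightarrow> fat_at S z"
    and f: "f twice_differentiable_on S" and g: "g twice_differentiable_on S"
  shows "(\<lambda>w. f w + g w) twice_differentiable_on S"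
proof (rule twice_differentiable_onI[where D = "\<lambda>h w. dderiv S h f w + dderiv S h g w"])
  fix z assume z: "z \<in> S"
  note f' = twice_differentiableD[OF f z] and g' = twice_differentiableD[OF g z]
  show "(\<lambda>w. f w + g w) differentiable (at z within S)"
    by (rule differentiable_add[OF f'(1) g'(1)])
  fix h :: 'a assume h: "h \<in> Basis"
  show "dderiv S h (\<lambda>w. f w + g w) z = dderiv S h f z + dderiv S h g z"
    by (rule dderiv_add[OF fat[OF z] f'(1) g'(1)])
  show "(\<lambda>w. dderiv S h f w + dderiv S h g w) differentiable (at z within S)"
    by (rule differentiable_add[OF f'(2)[OF h] g'(2)[OF h]])
qed

lemma twice_differentiable_scaleR:
  fixes f :: "'a::euclidean_space \<Rightarrow> real"
  assumes fat: "\<And>z. z \<in> S \<Longrightarrow> fat_at S z"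
    and f: "f twice_differentiable_on S" and g: "g twice_differentiable_on S"
  shows "(\<lambda>w. f w *\<^sub>R g w) twice_differentiable_on S"
proof (rule twice_differentiable_onI[where D = "\<lambda>h w. f w *\<^sub>R dderiv S h g w + dderiv S h f w *\<^sub>R g w"])
  fix z assume z: "z \<in> S"
  note f' = twice_differentiableD[OF f z] and g' = twice_differentiableD[OF g z]
  show "(\<lambda>w. f w *\<^sub>R g w) differentiable (at z within S)"
    by (rule differentiable_scaleR[OF f'(1) g'(1)])
  fix h :: 'a assume h: "h \<in> Basis"
  show "dderiv S h (\<lambda>w. f w *\<^sub>R g w) z = f z *\<^sub>R dderiv S h g z + dderiv S h f z *\<^sub>R g z"
    by (rule dderiv_scaleR[OF fat[OF z] f'(1) g'(1)])
  show "(\<lambda>w. f w *\<^sub>R dderiv S h g w + dderiv S h f w *\<^sub>R g w) differentiable (at z within S)"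
    by (rule differentiable_add[OF differentiable_scaleR[OF f'(1) g'(2)[OF h]]
          differentiable_scaleR[OF f'(2)[OF h] g'(1)]])
qed

lemma twice_differentiable_linear:
  fixes f :: "'a::euclidean_space \<Rightarrow> 'b::real_normed_vector"
  assumes fat: "\<And>z. z \<in> S \<Longrightarrow> fat_at S z"
    and L: "bounded_linear L" and f: "f twice_differentiable_on S"
  shows "(\<lambda>w. L (f w)) twice_differentiable_on S"
proof (rule twice_differentiable_onI[where D = "\<lambda>h w. L (dderiv S h f w)"])
  fix z assume z: "z \<in> S"
  note f' = twice_differentiableD[OF f z]
  show "(\<lambda>w. L (f w)) differentiable (at z within S)"
    by (rule differentiable_linear[OF L f'(1)])
  fix h :: 'a assume h: "h \<in> Basis"
  show "dderiv S h (\<lambda>w. L (f w)) z = L (dderiv S h f z)"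
    by (rule dderiv_linear[OF fat[OF z] L f'(1)])
  show "(\<lambda>w. L (dderiv S h f w)) differentiable (at z within S)"
    by (rule differentiable_linear[OF L f'(2)[OF h]])
qed

text \<open>The first derivatives of \<open>g \<circ> f\<close> are sums of products \<open>\<partial>f\<^sub>b \<cdot> (\<partial>\<^sub>bg \<circ> f)\<close>, which can be
  differentiated once more.\<close>

lemma twice_differentiable_compose:
  fixes f :: "'a::euclidean_space \<Rightarrow> 'b::euclidean_space"
  assumes fat: "\<And>z. z \<in> S \<Longrightarrow> fat_at S z"
    and f: "f twice_differentiable_on S" "f ` S \<subseteq> R" and g: "g twice_differentiable_on R"
  shows "(\<lambda>w. g (f w)) twice_differentiable_on S"
proof (rule twice_differentiable_onI[where
      D = "\<lambda>h w. \<Sum>b\<in>Basis. (dderiv S h f w \<bullet> b) *\<^sub>R dderiv R b g (f w)"])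
  fix z assume z: "z \<in> S"
  have fz: "f z \<in> R" using z f by auto
  note fd = twice_differentiableD[OF f(1) z] and gd = twice_differentiableD[OF g fz]
  note c = dderiv_compose[OF fat[OF z] fd(1) f(2) ]
  show "(\<lambda>w. g (f w)) differentiable (at z within S)" by (rule c(2)[OF gd(1)])
  fix h :: 'a assume h: "h \<in> Basis"
  show "dderiv S h (\<lambda>w. g (f w)) z = (\<Sum>b\<in>Basis. (dderiv S h f z \<bullet> b) *\<^sub>R dderiv R b g (f z))"
    unfolding c(1)[OF gd(1)] by (rule dderiv_basis_sum[OF gd(1)])
  show "(\<lambda>w. \<Sum>b\<in>Basis. (dderiv S h f w \<bullet> b) *\<^sub>R dderiv R b g (f w)) differentiable (at z within S)"
    by (rule differentiable_sum[OF finite_Basis ballI]) (rule differentiable_scaleR[OF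
        differentiable_inner[OF fd(2)[OF h] differentiable_const] c(2)[OF gd(2)]])
qed

lemma twice_differentiable_cong:
  fixes f :: "'a::euclidean_space \<Rightarrow> 'b::real_normed_vector"
  assumes fat: "\<And>z. z \<in> S \<Longrightarrow> fat_at S z"
    and f: "f twice_differentiable_on S" and eq: "\<And>w. w \<in> S \<Longrightarrow> f w = g w"
  shows "g twice_differentiable_on S"
proof (rule twice_differentiable_onI[where D = "\<lambda>h. dderiv S h f"])
  fix z and h :: 'a assume z: "z \<in> S"
  note D = twice_differentiableD[OF f z]
  show "g differentiable (at z within S)" by (rule differentiable_cong_on[OF D(1) z eq])
  show "dderiv S h g z = dderiv S h f z" by (rule dderiv_cong_on[OF fat[OF z] D(1) z eq])
next
  fix h :: 'a and z assume "h \<in> Basis" "z \<in> S"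
  then show "dderiv S h f differentiable (at z within S)" using twice_differentiableD(2)[OF f] by blast
qed

lemma twice_differentiable_ident:
  assumes fat: "\<And>z. z \<in> S \<Longrightarrow> fat_at S z"
  shows "(\<lambda>w. w) twice_differentiable_on S"
proof (rule twice_differentiable_onI[where D = "\<lambda>h w. h"])
  fix h z assume "z \<in> S"
  then show "dderiv S h (\<lambda>w. w) z = h" by (rule dderiv_eqI[OF fat has_derivative_ident])
qed auto

lemma dderiv_space_time:
  fixes f :: "spacetime \<Rightarrow> 'b::real_normed_vector"
  assumes "f differentiable (at z within S)"
  shows "dderiv S (a, \<tau>) f z =
    (\<Sum>j\<in>UNIV. a $ j *\<^sub>R dderiv S (axis j 1, 0) f z) + \<tau> *\<^sub>R dderiv S (0, 1) f z"
proof -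
  note l = linear_dderiv[OF assms]
  have "(a, \<tau>) = (\<Sum>j\<in>UNIV. a $ j *\<^sub>R (axis j 1, 0)) + \<tau> *\<^sub>R ((0, 1) :: spacetime)"
    by (simp add: prod_eq_iff fst_sum snd_sum)
       (simp add: vec_eq_iff axis_def if_distrib if_distribR cong: if_cong)
  then show ?thesis
    by (simp only: linear_add[OF l] linear_sum[OF l] linear_scale[OF l])
qed

lemma grad_inner: "f differentiable (at z within S) \<Longrightarrow> grad S f z \<bullet> a = dderiv S (a, 0) f z"
  by (simp add: dderiv_space_time[of f z S a 0] grad_def dx_def inner_vec_def mult.commute)

lemma Ck_on_1_differentiable: "Ck_on 1 f UNIV \<Longrightarrow> f differentiable (at x)"
  by (auto simp: One_nat_def differentiable_on_def)

lemma axis_Basis_spacetime: "(axis j 1, 0) \<in> (Basis :: spacetime set)"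
  by (auto simp: Basis_prod_def Basis_vec_def)

lemma strain_nth:
  "strain S u w $ i $ j = (1/2) * (dx S j (\<lambda>w. u w $ i) w + dx S i (\<lambda>w. u w $ j) w)"
  by (simp add: strain_def sym_part_def vgrad_def transpose_def)

lemma differentiable_cart:
  fixes f :: "'a::euclidean_space \<Rightarrow> real^'n"
  assumes "\<And>j. (\<lambda>w. f w $ j) differentiable (at z within S)"
  shows "f differentiable (at z within S)"
  using assms by (subst differentiable_componentwise_within) (auto simp: Basis_vec_def inner_axis)

text \<open>The error of a strain entry is at most the larger error of the two derivatives that it averages.\<close>

lemma half_sum_close:
  fixes a :: real
  assumes "\<bar>a - a'\<bar> \<le> e" "\<bar>b - b'\<bar> \<le> e"
  shows "\<bar>(1/2) * (a + b) - (1/2) * (a' + b')\<bar> \<le> e"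
proof -
  have "(1/2) * (a + b) - (1/2) * (a' + b') = ((a - a') + (b - b')) / 2" by (simp add: field_simps)
  also have "\<bar>\<dots>\<bar> \<le> (\<bar>a - a'\<bar> + \<bar>b - b'\<bar>) / 2"
    using abs_triangle_ineq[of "a - a'" "b - b'"] by simp
  finally show ?thesis using assms by simp
qed

section \<open>Matrix algebra of the tangential projection\<close>

lemma proj_mult: "proj n *v a = a - (a \<bullet> n) *\<^sub>R n"
  by (simp add: proj_def outer_prod_def vec_eq_iff matrix_vector_mult_def inner_vec_def mat_def
      sum_3 forall_3 algebra_simps)

lemma mult_proj: "(A ** proj n) $ i = proj n *v (A $ i)"
  by (simp add: proj_def outer_prod_def vec_eq_iff matrix_vector_mult_def matrix_matrix_mult_def mat_def
      sum_3 forall_3 algebra_simps)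

text \<open>As the projection is idempotent and the trace is cyclic, only one of the two factors counts.\<close>

lemma trace_sandwich:
  assumes "norm n = 1"
  shows "trace (proj n ** A ** proj n) = trace A - n \<bullet> (A *v n)"
proof -
  have "n \<bullet> n = 1" using assms by (simp add: norm_eq_1)
  then have n: "n $ 1 * n $ 1 = 1 - n $ 2 * n $ 2 - n $ 3 * n $ 3"
    by (simp add: inner_vec_def sum_3)
  have "proj n ** proj n = proj n"
    by (simp add: proj_def outer_prod_def vec_eq_iff matrix_matrix_mult_def mat_def
      sum_3 forall_3) (use n in algebra)
  then have "trace (proj n ** A ** proj n) = trace (A ** proj n)"
    by (metis matrix_mul_assoc trace_mul_sym)
  also have "\<dots> = trace A - n \<bullet> (A *v n)"
    by (simp add: proj_def outer_prod_def trace_def vec_eq_iff matrix_matrix_mult_def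
      matrix_vector_mult_def inner_vec_def mat_def sum_3 algebra_simps)
  finally show ?thesis .
qed

lemma transpose_proj: "transpose (proj m) = proj m"
  by (simp add: proj_def outer_prod_def transpose_def vec_eq_iff mat_def mult.commute)

lemma sym_part_sandwich:
  assumes "transpose P = P"
  shows "sym_part (P ** A ** P) = P ** sym_part A ** P"
proof -
  have s: "P $ i $ j = P $ j $ i" for i j
    using assms by (simp add: transpose_def vec_eq_iff)
  show ?thesis
    by (simp add: sym_part_def transpose_def vec_eq_iff matrix_matrix_mult_def sum_3 forall_3
        s[of 2 1] s[of 3 1] s[of 3 2] algebra_simps)
qed

section \<open>The tube around an evolving surface\<close>

locale thin_tube =
  fixes T :: real and \<Gamma> :: "real \<Rightarrow> (real^3) set" and \<nu> :: "spacetime \<Rightarrow> real^3"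
    and V d :: "spacetime \<Rightarrow> real" and \<gamma>\<^sub>0 :: real
  assumes T_pos: "0 < T" and \<gamma>\<^sub>0_pos: "0 < \<gamma>\<^sub>0"
    and evolving: "evolving_surface 3 T \<Gamma>"
    and normal: "unit_normal T \<Gamma> \<nu>"
    and signed: "\<And>t. t \<in> {0..T} \<Longrightarrow> signed_distance (\<Gamma> t) (\<lambda>y. \<nu> (y, t)) (\<lambda>x. d (x, t))"
    and tubular: "tubular_nbhd T \<Gamma> \<nu> V d \<gamma>\<^sub>0"
begin

abbreviation W :: "spacetime set" where "W \<equiv> thin_domain T d \<gamma>\<^sub>0"
abbreviation \<Sigma> :: "spacetime set" where "\<Sigma> \<equiv> st_surface T \<Gamma>"

definition foot :: "spacetime \<Rightarrow> spacetime" where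
  "foot z = (closest_point (\<Gamma> (snd z)) (fst z), snd z)"

lemma lift_eq_foot: "lift \<Gamma> g z = g (foot z)"
  by (simp add: lift_def foot_def case_prod_beta)

lemma continuous_motion:
  "\<exists>A (\<Phi> :: spacetime \<Rightarrow> real^3). compact A \<and> A \<noteq> {} \<and> continuous_on (A \<times> {0..T}) \<Phi> \<and>
     (\<forall>t\<in>{0..T}. (\<lambda>x. \<Phi> (x, t)) ` A = \<Gamma> t)"
proof -
  obtain \<Phi> \<Psi> :: "spacetime \<Rightarrow> real^3" where c: "closed_hypersurface 3 (\<Gamma> 0)" and
    p: "Ck_ext 3 T \<Phi> (\<Gamma> 0 \<times> {0..T})" and
    i: "\<forall>t\<in>{0..T}. (\<lambda>x. \<Phi> (x, t)) ` \<Gamma> 0 = \<Gamma> t \<and> (\<forall>x\<in>\<Gamma> 0. \<Psi> (\<Phi> (x, t), t) = x)"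
    using evolving unfolding evolving_surface_def by blast
  obtain N g where g: "\<Gamma> 0 \<times> {0..T} \<subseteq> N" "Ck_on 3 g (N \<inter> slab T)" "\<forall>z\<in>\<Gamma> 0 \<times> {0..T}. g z = \<Phi> z"
    using p unfolding Ck_ext_def by blast
  have "continuous_on (N \<inter> slab T) g"
    using g(2) by (auto simp: numeral_3_eq_3 intro: differentiable_imp_continuous_on)
  then have "continuous_on (\<Gamma> 0 \<times> {0..T}) g"
    by (rule continuous_on_subset) (use g(1) in \<open>auto simp: slab_def\<close>)
  then have "continuous_on (\<Gamma> 0 \<times> {0..T}) \<Phi>"
    by (rule continuous_on_eq) (use g(3) in auto)
  moreover have "compact (\<Gamma> 0)" "\<Gamma> 0 \<noteq> {}" using c by (simp_all add: closed_hypersurface_def)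
  ultimately show ?thesis using i by blast
qed

lemma surface_closed: assumes "t \<in> {0..T}" shows "closed (\<Gamma> t)" "\<Gamma> t \<noteq> {}"
proof -
  obtain A and \<Phi> :: "spacetime \<Rightarrow> real^3" where A: "compact A" "A \<noteq> {}"
    "continuous_on (A \<times> {0..T}) \<Phi>" "\<forall>t\<in>{0..T}. (\<lambda>x. \<Phi> (x, t)) ` A = \<Gamma> t"
    using continuous_motion by blast
  have "continuous_on A (\<lambda>x. \<Phi> (x, t))"
    by (rule continuous_on_compose2[OF A(3)]) (use assms in \<open>auto intro!: continuous_intros\<close>)
  then have "compact ((\<lambda>x. \<Phi> (x, t)) ` A)" using A(1) compact_continuous_image by blast
  moreover have "(\<lambda>x. \<Phi> (x, t)) ` A = \<Gamma> t" using A(4) assms by blast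
  ultimately show "closed (\<Gamma> t)" "\<Gamma> t \<noteq> {}" using A(2) by (auto simp: compact_imp_closed)
qed

lemma abs_d: "t \<in> {0..T} \<Longrightarrow> \<bar>d (x, t)\<bar> = infdist x (\<Gamma> t)"
  using signed by (simp add: signed_distance_def)

lemma closest_point_infdist:
  assumes "t \<in> {0..T}"
  shows "closest_point (\<Gamma> t) x \<in> \<Gamma> t" "dist x (closest_point (\<Gamma> t) x) = infdist x (\<Gamma> t)"
proof -
  note c = surface_closed[OF assms]
  show m: "closest_point (\<Gamma> t) x \<in> \<Gamma> t" by (rule closest_point_in_set[OF c])
  obtain y where y: "y \<in> \<Gamma> t" "infdist x (\<Gamma> t) = dist x y" using infdist_attains_inf[OF c] by blast
  show "dist x (closest_point (\<Gamma> t) x) = infdist x (\<Gamma> t)"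
    using closest_point_le[OF c(1) y(1), of x] infdist_le[OF m, of x] y(2) by linarith
qed

lemma dist_foot: "snd z \<in> {0..T} \<Longrightarrow> dist (fst z) (fst (foot z)) = \<bar>d z\<bar>"
  using closest_point_infdist(2)[of "snd z" "fst z"] abs_d[of "snd z" "fst z"] by (simp add: foot_def)

lemma foot_in_surface: "z \<in> slab T \<Longrightarrow> foot z \<in> \<Sigma>"
  using closest_point_infdist(1) by (auto simp: foot_def st_surface_def slab_def)

lemma thin_subset_slab: "thin_domain T d \<gamma> \<subseteq> slab T"
  by (auto simp: thin_domain_def slab_def)

lemma on_surface:
  assumes "z \<in> \<Sigma>"
  shows "z \<in> slab T" "d z = 0" "foot z = z" "0 < \<gamma> \<Longrightarrow> z \<in> thin_domain T d \<gamma>"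
proof -
  obtain x t where z: "z = (x, t)" "t \<in> {0..T}" "x \<in> \<Gamma> t" using assms by (auto simp: st_surface_def)
  show "z \<in> slab T" using z by (simp add: slab_def)
  show "d z = 0" using abs_d[OF z(2), of x] z by simp
  then show "0 < \<gamma> \<Longrightarrow> z \<in> thin_domain T d \<gamma>" using z by (simp add: thin_domain_def thin_def)
  show "foot z = z" using z by (simp add: foot_def closest_point_self)
qed

text \<open>A point lies in the thin domain iff some trajectory \<open>s \<mapsto> \<Phi>(a, s)\<close> of a surface point comes closer than
  \<open>\<gamma>\<close>, and for fixed \<open>a\<close> this is an open condition. Hence derivatives within a thin domain, within its
  closure and within the slab are the same at interior points.\<close>

lemma thin_domain_open: "\<exists>N. open N \<and> thin_domain T d \<gamma> = slab T \<inter> N"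
proof -
  obtain A and \<Phi> :: "spacetime \<Rightarrow> real^3" where A: "compact A" "A \<noteq> {}"
    "continuous_on (A \<times> {0..T}) \<Phi>" "\<forall>t\<in>{0..T}. (\<lambda>x. \<Phi> (x, t)) ` A = \<Gamma> t"
    using continuous_motion by blast
  have "thin_domain T d \<gamma> = (\<Union>a\<in>A. {w \<in> slab T. dist (fst w) (\<Phi> (a, snd w)) < \<gamma>})" (is "_ = ?U")
  proof (intro equalityI subsetI)
    fix w assume "w \<in> thin_domain T d \<gamma>"
    then obtain x t where w: "w = (x, t)" "t \<in> {0..T}" "\<bar>d (x, t)\<bar> < \<gamma>"
      by (auto simp: thin_domain_def thin_def)
    obtain y where y: "y \<in> \<Gamma> t" "infdist x (\<Gamma> t) = dist x y"
      using infdist_attains_inf[OF surface_closed[OF w(2)]] by blast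
    have "y \<in> (\<lambda>x. \<Phi> (x, t)) ` A" using A(4) w(2) y(1) by auto
    then obtain a where "a \<in> A" "\<Phi> (a, t) = y" by blast
    then show "w \<in> ?U" using w y abs_d[OF w(2), of x] by (auto simp: slab_def)
  next
    fix w assume "w \<in> ?U"
    then obtain a where a: "a \<in> A" "w \<in> slab T" "dist (fst w) (\<Phi> (a, snd w)) < \<gamma>" by auto
    then have t: "snd w \<in> {0..T}" by (auto simp: slab_def)
    then have "\<Phi> (a, snd w) \<in> \<Gamma> (snd w)" using A(4) a(1) t by blast
    then have "infdist (fst w) (\<Gamma> (snd w)) < \<gamma>" using infdist_le a(3) by (meson le_less_trans)
    then show "w \<in> thin_domain T d \<gamma>" using t abs_d[OF t, of "fst w"]
      by (auto simp: thin_domain_def thin_def case_prod_beta)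
  qed
  moreover have "openin (top_of_set (slab T)) {w \<in> slab T. dist (fst w) (\<Phi> (a, snd w)) < \<gamma>}" if "a \<in> A" for a
  proof -
    have "continuous_on (slab T) (\<lambda>w. \<Phi> (a, snd w))"
      by (rule continuous_on_compose2[OF A(3)]) (use that in \<open>auto intro!: continuous_intros simp: slab_def\<close>)
    then have "continuous_on (slab T) (\<lambda>w. dist (fst w) (\<Phi> (a, snd w)))"
      by (intro continuous_intros)
    from continuous_openin_preimage_gen[OF this, of "{..<\<gamma>}"]
    have "openin (top_of_set (slab T)) (slab T \<inter> (\<lambda>w. dist (fst w) (\<Phi> (a, snd w))) -` {..<\<gamma>})"
      by simp
    also have "slab T \<inter> (\<lambda>w. dist (fst w) (\<Phi> (a, snd w))) -` {..<\<gamma>} =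
        {w \<in> slab T. dist (fst w) (\<Phi> (a, snd w)) < \<gamma>}" by auto
    finally show ?thesis .
  qed
  ultimately have "openin (top_of_set (slab T)) (thin_domain T d \<gamma>)" by auto
  then show ?thesis by (simp add: openin_open)
qed

lemma at_within_thin:
  assumes "z \<in> thin_domain T d \<gamma>" "thin_domain T d \<gamma> \<subseteq> S" "S \<subseteq> slab T"
  shows "at z within S = at z within slab T"
proof -
  obtain N where "open N" "thin_domain T d \<gamma> = slab T \<inter> N" using thin_domain_open by blast
  then show ?thesis using assms by (intro at_within_nhd[of z N]) auto
qed

lemma at_within_W: "z \<in> W \<Longrightarrow> at z within W = at z within slab T"
  using at_within_thin thin_subset_slab by blast

lemma ray_in_thin:
  assumes z: "z \<in> thin_domain T d \<gamma>"
    and h: "\<exists>s0>0. \<forall>s. 0 < s \<and> s < s0 \<longrightarrow> z + s *\<^sub>R h \<in> slab T"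
  shows "\<exists>s0>0. \<forall>s. 0 < s \<and> s < s0 \<longrightarrow> z + s *\<^sub>R h \<in> thin_domain T d \<gamma>"
proof -
  obtain N where N: "open N" "thin_domain T d \<gamma> = slab T \<inter> N" using thin_domain_open by blast
  obtain r where r: "r > 0" "ball z r \<subseteq> N" using N z openE by blast
  obtain s0 where s0: "s0 > 0" "\<forall>s. 0 < s \<and> s < s0 \<longrightarrow> z + s *\<^sub>R h \<in> slab T" using h by blast
  have "z + s *\<^sub>R h \<in> thin_domain T d \<gamma>" if "0 < s" "s < min s0 (r / (norm h + 1))" for s
  proof -
    have "s * (norm h + 1) < r" using that by (simp add: pos_less_divide_eq add_nonneg_pos)
    then have "s * norm h < r" using that by (simp add: algebra_simps)
    then have "z + s *\<^sub>R h \<in> ball z r" using that by (simp add: dist_norm)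
    then show ?thesis using s0 r N that by auto
  qed
  moreover have "min s0 (r / (norm h + 1)) > 0" using s0 r by (simp add: add_nonneg_pos)
  ultimately show ?thesis by blast
qed

lemma fat_thin: assumes "z \<in> thin_domain T d \<gamma>" shows "fat_at (thin_domain T d \<gamma>) z"
proof -
  have "z \<in> slab T" using assms thin_subset_slab by blast
  then obtain h0 e where e: "0 < e" and
    c: "\<forall>h\<in>ball h0 e. \<exists>s0>0. \<forall>s. 0 < s \<and> s < s0 \<longrightarrow> z + s *\<^sub>R h \<in> slab T"
    using fat_at_slab[OF T_pos, of z] unfolding fat_at_def by blast
  show ?thesis unfolding fat_at_def
    by (rule exI[of _ h0], rule exI[of _ e]) (use e c ray_in_thin[OF assms] in blast)
qed

lemmas fat_W = fat_thin[of _ \<gamma>\<^sub>0]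

lemma norm_\<nu>: "z \<in> \<Sigma> \<Longrightarrow> norm (\<nu> z) = 1"
  using normal by (auto simp: unit_normal_def st_surface_def)

lemma unique_closest_point:
  assumes "(x, t) \<in> W" "y \<in> \<Gamma> t" "dist x y = infdist x (\<Gamma> t)"
  shows "closest_point (\<Gamma> t) x = y"
proof -
  have "\<exists>!y. y \<in> \<Gamma> t \<and> dist x y = infdist x (\<Gamma> t)"
    using tubular assms(1) unfolding tubular_nbhd_def by blast
  moreover have "t \<in> {0..T}" using assms by (auto simp: thin_domain_def)
  ultimately show ?thesis using assms closest_point_infdist by blast
qed

text \<open>Moving from \<open>x\<close> towards its closest point \<open>q\<close> reduces the distance to the surface at the maximal
  rate, by the triangle inequality; so \<open>q\<close> remains a closest point, and it is the only one.\<close>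

lemma normal_segment:
  assumes z: "z \<in> W" and \<sigma>: "0 \<le> \<sigma>" "\<sigma> \<le> 1"
  defines "w \<equiv> (fst (foot z) + \<sigma> *\<^sub>R (fst z - fst (foot z)), snd z)"
  shows "w \<in> W" "foot w = foot z" "\<bar>d w\<bar> = \<sigma> * \<bar>d z\<bar>"
proof -
  obtain x t where xt: "z = (x, t)" "t \<in> {0..T}" "\<bar>d (x, t)\<bar> < \<gamma>\<^sub>0"
    using z by (auto simp: thin_domain_def thin_def)
  define q where "q = closest_point (\<Gamma> t) x"
  have q: "q \<in> \<Gamma> t" "dist x q = infdist x (\<Gamma> t)" using closest_point_infdist[OF xt(2)] by (auto simp: q_def)
  define y where "y = q + \<sigma> *\<^sub>R (x - q)"
  have w: "w = (y, t)" by (simp add: w_def y_def q_def xt foot_def)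
  have yq: "dist y q = \<sigma> * dist x q" using \<sigma> by (simp add: y_def dist_norm)
  have "x - y = (1 - \<sigma>) *\<^sub>R (x - q)" by (simp add: y_def algebra_simps)
  then have xy: "dist x y = (1 - \<sigma>) * dist x q" using \<sigma> by (simp add: dist_norm)
  have yi: "dist y q = infdist y (\<Gamma> t)"
  proof (rule antisym)
    have "infdist x (\<Gamma> t) \<le> infdist y (\<Gamma> t) + dist x y" by (rule infdist_triangle)
    then show "dist y q \<le> infdist y (\<Gamma> t)" using yq xy q by (simp add: algebra_simps)
  qed (rule infdist_le[OF q(1)])
  show dw: "\<bar>d w\<bar> = \<sigma> * \<bar>d z\<bar>" using yi yq q abs_d[OF xt(2)] by (simp add: w xt)
  have "\<sigma> * \<bar>d z\<bar> \<le> 1 * \<bar>d z\<bar>" using \<sigma> by (intro mult_right_mono) auto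
  then show wW: "w \<in> W" using dw xt by (simp add: w thin_domain_def thin_def)
  have "closest_point (\<Gamma> t) y = q" by (rule unique_closest_point[OF wW[unfolded w] q(1) yi])
  then show "foot w = foot z" by (simp add: w foot_def xt q_def)
qed

text \<open>The modulus of \<open>d\<close> is linear on the segment, and \<open>d\<close> cannot change sign without a zero.\<close>

lemma d_normal_segment:
  assumes z: "z \<in> W" and \<sigma>: "0 \<le> \<sigma>" "\<sigma> \<le> 1"
  shows "d (fst (foot z) + \<sigma> *\<^sub>R (fst z - fst (foot z)), snd z) = \<sigma> * d z"
proof (cases "\<sigma> = 0 \<or> d z = 0")
  case True
  then show ?thesis using normal_segment(3)[OF assms] by auto
next
  case False
  define f where "f s = d (fst (foot z) + s *\<^sub>R (fst z - fst (foot z)), snd z)" for s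
  have t: "snd z \<in> {0..T}" using z by (auto simp: thin_domain_def)
  have ab: "\<bar>f s\<bar> = s * \<bar>d z\<bar>" if "0 \<le> s" "s \<le> 1" for s
    using normal_segment(3)[OF z that] by (simp add: f_def)
  have "continuous_on UNIV (\<lambda>x. d (x, snd z))" using signed[OF t] by (simp add: signed_distance_def)
  then have cont: "continuous_on {\<sigma>..1} f" unfolding f_def
    by (rule continuous_on_compose2) (auto intro!: continuous_intros)
  have nz: "f s \<noteq> 0" if "\<sigma> \<le> s" "s \<le> 1" for s using ab[of s] that \<sigma> False by auto
  have f1: "f 1 = d z" by (simp add: f_def)
  have "\<not> (f \<sigma> < 0 \<and> 0 < f 1)" using IVT'[of f \<sigma> 0 1, OF _ _ \<sigma>(2) cont] nz by force
  moreover have "\<not> (f 1 < 0 \<and> 0 < f \<sigma>)" using IVT2'[of f 1 0 \<sigma>, OF _ _ \<sigma>(2) cont] nz by force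
  ultimately have "f \<sigma> = \<sigma> * d z" using ab[OF \<sigma>] nz[of \<sigma>] nz[of 1] \<sigma> f1
    by (auto simp: abs_if split: if_splits)
  then show ?thesis by (simp add: f_def)
qed

text \<open>Differentiating \<open>d\<close> along the segment at its foot shows \<open>\<nu> \<cdot> (x - q) = d = \<plusminus>|x - q|\<close>, the case of
  equality in the Cauchy-Schwarz inequality.\<close>

lemma displacement_from_foot:
  assumes z: "z \<in> W"
  shows "fst z - fst (foot z) = d z *\<^sub>R \<nu> (foot z)"
proof -
  have t: "snd z \<in> {0..T}" using z by (auto simp: thin_domain_def)
  have zs: "z \<in> slab T" using z thin_subset_slab by blast
  define a where "a = fst z - fst (foot z)"
  have fS: "foot z \<in> \<Sigma>" by (rule foot_in_surface[OF zs])
  then have q: "fst (foot z) \<in> \<Gamma> (snd z)" and fz: "foot z = (fst (foot z), snd z)"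
    by (auto simp: st_surface_def foot_def)
  have D: "((\<lambda>x. d (x, snd z)) has_derivative (\<lambda>h. \<nu> (foot z) \<bullet> h)) (at (fst (foot z)))"
    using signed[OF t] q fz unfolding signed_distance_def by metis
  have "((\<lambda>s. fst (foot z) + s *\<^sub>R a) has_derivative (\<lambda>s. s *\<^sub>R a)) (at 0 within {0..1::real})"
    by (auto intro!: derivative_eq_intros)
  from has_derivative_compose[OF this, of "\<lambda>x. d (x, snd z)" "\<lambda>h. \<nu> (foot z) \<bullet> h"] D
  have "((\<lambda>s. d (fst (foot z) + s *\<^sub>R a, snd z)) has_derivative (\<lambda>s. \<nu> (foot z) \<bullet> (s *\<^sub>R a)))
      (at 0 within {0..1})" by simp
  then have "((\<lambda>s. s * d z) has_derivative (\<lambda>s. \<nu> (foot z) \<bullet> (s *\<^sub>R a))) (at 0 within {0..1})"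
    by (rule has_derivative_transform[rotated 2])
       (auto simp: a_def d_normal_segment[OF z])
  then have 1: "((\<lambda>s. s * d z) has_vector_derivative (\<nu> (foot z) \<bullet> a)) (at 0 within {0..1})"
    by (simp add: has_vector_derivative_def)
  have 2: "((\<lambda>s. s * d z) has_vector_derivative d z) (at 0 within {0..1})"
    by (auto intro!: derivative_eq_intros simp: has_vector_derivative_def)
  have "at (0::real) within {0..1} \<noteq> bot" by (simp add: at_within_Icc_at_right)
  from vector_derivative_unique_within[OF this 1 2] have m: "\<nu> (foot z) \<bullet> a = d z" .
  have na: "norm a = \<bar>d z\<bar>" using dist_foot[OF t] by (simp add: a_def dist_norm)
  have "(norm (a - d z *\<^sub>R \<nu> (foot z)))\<^sup>2 = (norm a)\<^sup>2 - 2 * d z * (\<nu> (foot z) \<bullet> a) + (d z)\<^sup>2 * (norm (\<nu> (foot z)))\<^sup>2"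
    unfolding power2_norm_eq_inner
    by (simp add: inner_diff inner_commute power2_eq_square algebra_simps)
  also have "\<dots> = 0" using m na norm_\<nu>[OF fS] by (simp add: power2_eq_square)
  finally show ?thesis by (simp add: a_def)
qed

abbreviation n :: "spacetime \<Rightarrow> real^3" where "n \<equiv> lift \<Gamma> \<nu>"
abbreviation v :: "spacetime \<Rightarrow> real" where "v \<equiv> lift \<Gamma> V"

lemma lift_on_surface: "z \<in> \<Sigma> \<Longrightarrow> lift \<Gamma> g z = g z"
  by (simp add: lift_eq_foot on_surface)

lemma lift_foot: "z \<in> W \<Longrightarrow> lift \<Gamma> g (foot z) = lift \<Gamma> g z"
  using on_surface(3)[OF foot_in_surface] thin_subset_slab[of \<gamma>\<^sub>0]
  unfolding lift_eq_foot by (metis subsetD)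

lemma W_slab: "z \<in> W \<Longrightarrow> z \<in> slab T" using thin_subset_slab by blast

lemma \<Sigma>_W: "z \<in> \<Sigma> \<Longrightarrow> z \<in> W" using on_surface(4) \<gamma>\<^sub>0_pos by blast

lemma norm_n: "z \<in> W \<Longrightarrow> norm (n z) = 1"
  by (simp add: lift_eq_foot norm_\<nu> foot_in_surface W_slab)

lemma foot_W: "z \<in> W \<Longrightarrow> foot z \<in> W"
  using foot_in_surface W_slab \<Sigma>_W by blast

text \<open>This formula makes the closest-point map as regular as \<open>\<nabla>d\<close>.\<close>

lemma foot_eq: "z \<in> W \<Longrightarrow> foot z = z + (- d z) *\<^sub>R (n z, 0)"
  using displacement_from_foot[of z] by (simp add: prod_eq_iff lift_eq_foot) (simp add: foot_def algebra_simps)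

lemma d_C3: "Ck_on 3 d W"
  and grad_d: "z \<in> W \<Longrightarrow> grad W d z = n z"
  and dt_d: "z \<in> W \<Longrightarrow> dt W d z = - v z"
  using tubular by (auto simp: tubular_nbhd_def)

lemma d_twice: "d twice_differentiable_on W"
  using d_C3 by (auto simp: numeral_3_eq_3 twice_differentiable_on_def)

lemma dderiv_d_twice: "h \<in> Basis \<Longrightarrow> dderiv W h d twice_differentiable_on W"
  using d_C3 by (intro Ck_on_2_twice_differentiable) (auto simp: numeral_3_eq_3 numeral_2_eq_2)

lemmas d_differentiable = twice_differentiableD(1)[OF d_twice]

lemma dderiv_d: "z \<in> W \<Longrightarrow> dderiv W (a, \<tau>) d z = a \<bullet> n z - \<tau> * v z"
  using dderiv_space_time[OF d_differentiable, of z a \<tau>] grad_d[of z] dt_d[of z]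
  by (simp add: dt_def grad_def dx_def vec_eq_iff inner_vec_def)

lemma n_nth_twice: "(\<lambda>z. n z $ j) twice_differentiable_on W"
proof (rule twice_differentiable_cong[OF fat_W])
  show "dderiv W (axis j 1, 0) d twice_differentiable_on W"
    by (rule dderiv_d_twice) (auto simp: Basis_prod_def Basis_vec_def)
qed (use dderiv_d in \<open>auto simp: inner_axis'\<close>)

lemma n_twice: "n twice_differentiable_on W"
proof (rule twice_differentiable_cong[OF fat_W])
  show "(\<lambda>z. n z $ 1 *\<^sub>R axis 1 1 + (n z $ 2 *\<^sub>R axis 2 1 + n z $ 3 *\<^sub>R axis 3 1)) twice_differentiable_on W"
    by (intro twice_differentiable_add[OF fat_W] n_nth_twice
        twice_differentiable_linear[OF fat_W bounded_linear_scaleR_left])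
qed (auto simp: vec_eq_iff forall_3 axis_def)

lemma v_twice: "v twice_differentiable_on W"
proof (rule twice_differentiable_cong[OF fat_W])
  show "(\<lambda>z. - dderiv W (0, 1) d z) twice_differentiable_on W"
    by (intro twice_differentiable_linear[OF fat_W bounded_linear_minus[OF bounded_linear_ident]]
        dderiv_d_twice) (auto simp: Basis_prod_def)
qed (use dderiv_d in auto)

lemma neg_d_twice: "(\<lambda>z. - d z) twice_differentiable_on W"
  by (intro twice_differentiable_linear[OF fat_W bounded_linear_minus[OF bounded_linear_ident]] d_twice)

lemma n0_twice: "(\<lambda>z. (n z, 0::real)) twice_differentiable_on W"
  by (intro twice_differentiable_linear[OF fat_W _ n_twice] bounded_linear_Pair
      bounded_linear_ident bounded_linear_zero)

lemma foot_twice: "foot twice_differentiable_on W"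
proof -
  have 1: "(\<lambda>z. z + (- d z) *\<^sub>R (n z, 0)) twice_differentiable_on W"
    by (intro twice_differentiable_add[OF fat_W] twice_differentiable_ident[OF fat_W]
        twice_differentiable_scaleR[OF fat_W] neg_d_twice n0_twice)
  show ?thesis by (rule twice_differentiable_cong[OF fat_W 1]) (simp_all add: foot_eq)
qed

text \<open>With \<open>d = 0\<close> only the derivative of the factor \<open>d\<close> in \<open>(x - d n, t)\<close> contributes. The result is the
  projection onto the tangent space of \<open>\<Sigma>\<close>: for \<open>\<tau> = 0\<close> the spatial tangential projection, and
  the time direction \<open>(0, 1)\<close> is mapped to the normal motion \<open>(v n, 1)\<close>.\<close>

lemma dderiv_foot:
  assumes z: "z \<in> \<Sigma>"
  shows "dderiv W (a, \<tau>) foot z = (a - (a \<bullet> n z - \<tau> * v z) *\<^sub>R n z, \<tau>)"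
proof -
  have zW: "z \<in> W" by (rule \<Sigma>_W[OF z])
  note fat = fat_W[OF zW]
  note D = twice_differentiableD(1)[OF _ zW]
  have p: "(\<lambda>z. (- d z) *\<^sub>R (n z, 0::real)) differentiable (at z within W)"
    by (rule differentiable_scaleR[OF D[OF neg_d_twice] D[OF n0_twice]])
  have "dderiv W (a, \<tau>) foot z = dderiv W (a, \<tau>) (\<lambda>z. z + (- d z) *\<^sub>R (n z, 0)) z"
    by (rule dderiv_cong_on[OF fat differentiable_add[OF differentiable_ident p] zW])
       (simp add: foot_eq)
  also have "\<dots> = (a, \<tau>) + dderiv W (a, \<tau>) (\<lambda>z. (- d z) *\<^sub>R (n z, 0)) z"
    using dderiv_add[OF fat differentiable_ident p] dderiv_eqI[OF fat has_derivative_ident] by simp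
  also have "dderiv W (a, \<tau>) (\<lambda>z. (- d z) *\<^sub>R (n z, 0::real)) z = - (a \<bullet> n z - \<tau> * v z) *\<^sub>R (n z, 0)"
    using dderiv_scaleR[OF fat D[OF neg_d_twice] D[OF n0_twice], of "(a, \<tau>)"]
      dderiv_minus[OF fat d_differentiable[OF zW], of "(a, \<tau>)"]
      dderiv_d[OF zW, of a \<tau>] on_surface(2)[OF z] by simp
  finally show ?thesis by (simp add: scaleR_diff_left)
qed

lemma lift_twice:
  assumes "Ck_ext 2 T g \<Sigma>"
  shows "lift \<Gamma> g twice_differentiable_on W"
proof -
  obtain N e where e: "open N" "\<Sigma> \<subseteq> N" "Ck_on 2 e (N \<inter> slab T)" "\<forall>z\<in>\<Sigma>. e z = g z"
    using assms unfolding Ck_ext_def by blast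
  have im: "foot ` W \<subseteq> N \<inter> slab T"
    using foot_in_surface W_slab e(2) on_surface(1) by blast
  have "(\<lambda>w. e (foot w)) twice_differentiable_on W"
    by (rule twice_differentiable_compose[OF fat_W foot_twice im Ck_on_2_twice_differentiable[OF e(3)]])
  then show ?thesis
    by (rule twice_differentiable_cong[OF fat_W, rotated])
       (simp_all add: lift_eq_foot e(4) foot_in_surface W_slab)
qed

text \<open>Off the surface the closest point is constant on the segment towards the foot, which is a ray
  in direction \<open>\<plusminus>n\<close>. On the surface the derivative factors through the projection \<open>D foot\<close>, which
  annihilates \<open>n\<close>.\<close>

lemma normal_derivative_lift:
  fixes g :: "spacetime \<Rightarrow> 'b::real_normed_vector"
  assumes z: "z \<in> W" and g: "lift \<Gamma> g differentiable (at z within W)"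
  shows "dderiv W (n z, 0) (lift \<Gamma> g) z = 0"
proof (cases "d z = 0")
  case True
  then have f: "foot z = z" using foot_eq[OF z] by (simp add: zero_prod_def[symmetric])
  then have zS: "z \<in> \<Sigma>" using foot_in_surface[OF W_slab[OF z]] by simp
  have im: "foot ` W \<subseteq> W" using foot_W by blast
  have g': "lift \<Gamma> g differentiable (at (foot z) within W)" using g f by simp
  note c = dderiv_compose[OF fat_W[OF z] twice_differentiableD(1)[OF foot_twice z] im g']
  have "dderiv W (n z, 0) (lift \<Gamma> g) z = dderiv W (n z, 0) (\<lambda>w. lift \<Gamma> g (foot w)) z"
    by (rule dderiv_cong_on[OF fat_W[OF z] c(2) z lift_foot])
  also have "\<dots> = dderiv W (0, 0) (lift \<Gamma> g) z"
    using norm_n[OF z] by (simp add: c(1) f dderiv_foot[OF zS] norm_eq_1)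
  also have "\<dots> = 0" using linear_0[OF linear_dderiv[OF g]] by (simp add: zero_prod_def)
  finally show ?thesis .
next
  case False
  define L where "L h = dderiv W h (lift \<Gamma> g) z" for h
  have L: "linear L" unfolding L_def[abs_def] by (rule linear_dderiv[OF g])
  have a: "fst z - fst (foot z) = d z *\<^sub>R n z" "snd (foot z) = snd z"
    using displacement_from_foot[OF z] by (simp_all add: lift_eq_foot foot_def)
  have "((\<lambda>w. lift \<Gamma> g w - lift \<Gamma> g z) has_derivative L) (at z within W)"
    unfolding L_def[abs_def] using has_derivative_diff[OF has_derivative_dderiv[OF g] has_derivative_const]
    by simp
  then have "((\<lambda>w. lift \<Gamma> g w - lift \<Gamma> g z) has_derivative L)
      (at z within {w \<in> W. foot w = foot z})"
    by (rule has_derivative_subset) auto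
  then have c: "((\<lambda>w. 0) has_derivative L) (at z within {w \<in> W. foot w = foot z})"
    by (rule has_derivative_transform[rotated 2]) (use z in \<open>auto simp: lift_eq_foot\<close>)
  have "L (- (d z *\<^sub>R n z), 0) = 0"
  proof (rule derivative_of_zero_along_ray[OF c, of 1])
    fix s :: real assume s: "0 < s" "s < 1"
    have "z + s *\<^sub>R (- (d z *\<^sub>R n z), 0) =
        (fst (foot z) + (1 - s) *\<^sub>R (fst z - fst (foot z)), snd z)"
      unfolding a(1)[symmetric] by (simp add: prod_eq_iff algebra_simps)
    then show "z + s *\<^sub>R (- (d z *\<^sub>R n z), 0) \<in> {w \<in> W. foot w = foot z}"
      using normal_segment[OF z, of "1 - s"] s by simp
  qed simp
  moreover have "(- (d z *\<^sub>R n z), 0) = (- d z) *\<^sub>R (n z, 0::real)" by simp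
  ultimately have "d z *\<^sub>R L (n z, 0) = 0" by (simp only: linear_scale[OF L]) simp
  then show ?thesis using False by (simp add: L_def)
qed

section \<open>Surface operators computed from any extension\<close>

text \<open>Differentiability is required exactly at the points of \<open>\<Sigma>\<close>, as in the choice of the extension that
  underlies the surface operators.\<close>

definition extends :: "(spacetime \<Rightarrow> 'b::real_normed_vector) \<Rightarrow> (spacetime \<Rightarrow> 'b) \<Rightarrow> bool" where
  "extends F f \<longleftrightarrow> (\<forall>z\<in>\<Sigma>. F z = f z \<and> F differentiable (at z within W))"

lemma dderiv_slab: "z \<in> W \<Longrightarrow> dderiv (slab T) h f z = dderiv W h f z"
  by (simp add: dderiv_def at_within_W)

lemma extension_extends:
  assumes "extends F f" shows "extends (extension T \<Gamma> f) f"
proof -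
  have *: "extends g f \<longleftrightarrow> (\<forall>z\<in>\<Sigma>. g z = f z \<and> g differentiable (at z within slab T))" for g
    by (auto simp: extends_def at_within_W \<Sigma>_W)
  have "\<exists>g. \<forall>z\<in>\<Sigma>. g z = f z \<and> g differentiable (at z within slab T)"
    using assms * by blast
  from someI_ex[OF this] show ?thesis
    by (simp only: * extension_def)
qed

text \<open>Both sides are derivatives of the composition with the closest-point map, which depends on
  the values on \<open>\<Sigma>\<close> only. By the formula for \<open>D foot\<close>, the directions obtained are the tangential ones
  and that of the normal motion.\<close>

lemma dderiv_extension_foot:
  assumes F: "extends F f" and G: "extends G f" and z: "z \<in> \<Sigma>"
  shows "dderiv W (dderiv W h foot z) F z = dderiv W (dderiv W h foot z) G z"
proof -
  have zW: "z \<in> W" by (rule \<Sigma>_W[OF z])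
  have f: "foot z = z" by (rule on_surface(3)[OF z])
  have im: "foot ` W \<subseteq> W" using foot_W by blast
  have Fd: "F differentiable (at (foot z) within W)" and Gd: "G differentiable (at (foot z) within W)"
    using F G z f by (auto simp: extends_def)
  note cF = dderiv_compose[OF fat_W[OF zW] twice_differentiableD(1)[OF foot_twice zW] im Fd]
  note cG = dderiv_compose[OF fat_W[OF zW] twice_differentiableD(1)[OF foot_twice zW] im Gd]
  have eq: "F (foot w) = G (foot w)" if "w \<in> W" for w
    using F G foot_in_surface[OF W_slab[OF that]] by (simp add: extends_def)
  have "dderiv W h (\<lambda>w. G (foot w)) z = dderiv W h (\<lambda>w. F (foot w)) z"
    by (rule dderiv_cong_on[OF fat_W[OF zW] cF(2) zW eq])
  then show ?thesis by (simp add: cF(1) cG(1) f)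
qed

lemma extension_tangential:
  assumes F: "extends F f" and z: "z \<in> \<Sigma>"
  shows "dderiv W (a - (a \<bullet> \<nu> z) *\<^sub>R \<nu> z, 0) (extension T \<Gamma> f) z
    = dderiv W (a - (a \<bullet> \<nu> z) *\<^sub>R \<nu> z, 0) F z"
  using dderiv_extension_foot[OF extension_extends[OF F] F z, of "(a, 0)"]
  by (simp add: dderiv_foot[OF z] lift_on_surface[OF z])

lemma extension_normal_motion:
  assumes F: "extends F f" and z: "z \<in> \<Sigma>"
  shows "dderiv W (V z *\<^sub>R \<nu> z, 1) (extension T \<Gamma> f) z = dderiv W (V z *\<^sub>R \<nu> z, 1) F z"
  using dderiv_extension_foot[OF extension_extends[OF F] F z, of "(0, 1)"]
  by (simp add: dderiv_foot[OF z] lift_on_surface[OF z])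

lemma grad_slab: "z \<in> W \<Longrightarrow> grad (slab T) f z = grad W f z"
  by (simp add: grad_def dx_def dderiv_slab)

lemma sgrad_eq:
  assumes F: "extends F f" and z: "z \<in> \<Sigma>"
  shows "sgrad T \<Gamma> \<nu> f z = proj (\<nu> z) *v grad W F z"
proof -
  have zW: "z \<in> W" by (rule \<Sigma>_W[OF z])
  let ?E = "extension T \<Gamma> f"
  have Ed: "?E differentiable (at z within W)" and Fd: "F differentiable (at z within W)"
    using extension_extends[OF F] F z by (auto simp: extends_def)
  have *: "(proj (\<nu> z) *v grad W ?E z) \<bullet> a = (proj (\<nu> z) *v grad W F z) \<bullet> a" for a
  proof -
    have "(proj (\<nu> z) *v b) \<bullet> a = b \<bullet> (a - (a \<bullet> \<nu> z) *\<^sub>R \<nu> z)" for b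
      by (simp add: proj_mult inner_diff inner_commute)
    then show ?thesis by (simp add: grad_inner Ed Fd extension_tangential[OF F z])
  qed
  have "proj (\<nu> z) *v grad W ?E z = proj (\<nu> z) *v grad W F z"
    using vector_eq_rdot * by blast
  then show ?thesis by (simp add: sgrad_def grad_slab[OF zW])
qed

lemma normal_dt_eq:
  assumes F: "extends F f" and z: "z \<in> \<Sigma>"
  shows "normal_dt T \<Gamma> \<nu> V f z = dt W F z + V z * (grad W F z \<bullet> \<nu> z)"
proof -
  have zW: "z \<in> W" by (rule \<Sigma>_W[OF z])
  let ?E = "extension T \<Gamma> f"
  have Ed: "?E differentiable (at z within W)" and Fd: "F differentiable (at z within W)"
    using extension_extends[OF F] F z by (auto simp: extends_def)
  have *: "dt W G z + V z * (grad W G z \<bullet> \<nu> z) = dderiv W (V z *\<^sub>R \<nu> z, 1) G z"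
    if "G differentiable (at z within W)" for G :: "spacetime \<Rightarrow> real"
    using linear_add[OF linear_dderiv[OF that], of "(V z *\<^sub>R \<nu> z, 0)" "(0,1)"]
    by (simp add: dt_def grad_inner[OF that, symmetric])
  show ?thesis
    using *[OF Ed] *[OF Fd] extension_normal_motion[OF F z]
    by (simp add: normal_dt_def grad_slab[OF zW] dt_def dderiv_slab[OF zW])
qed

text \<open>If \<open>u\<close> moves with the surface, the normal transport \<open>V \<partial>\<^sub>\<nu>f\<close> is just the normal part of \<open>u \<cdot> \<nabla>f\<close>.\<close>

lemma material_dt_eq:
  assumes F: "extends F f" and z: "z \<in> \<Sigma>" and u: "u z \<bullet> \<nu> z = V z"
  shows "material_dt T \<Gamma> \<nu> V u f z = dt W F z + u z \<bullet> grad W F z"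
  using norm_\<nu>[OF z] u
  by (simp add: material_dt_def normal_dt_eq[OF F z] sgrad_eq[OF F z] proj_mult inner_diff norm_eq_1
      inner_commute algebra_simps)

lemma extends_nth: "extends F f \<Longrightarrow> extends (\<lambda>w. F w $ i) (\<lambda>w. f w $ i)"
  by (auto simp: extends_def intro!: differentiable_nth)

lemma svgrad_eq:
  assumes F: "extends F f" and z: "z \<in> \<Sigma>"
  shows "svgrad T \<Gamma> \<nu> f z = proj (\<nu> z) ** vgrad W F z ** proj (\<nu> z)"
proof -
  have zW: "z \<in> W" by (rule \<Sigma>_W[OF z])
  let ?E = "extension T \<Gamma> f"
  have Ed: "?E differentiable (at z within W)" and Fd: "F differentiable (at z within W)"
    using extension_extends[OF F] F z by (auto simp: extends_def)
  have "vgrad W ?E z ** proj (\<nu> z) = vgrad W F z ** proj (\<nu> z)"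
  proof (simp only: vec_eq_iff[of "_ ** _"] mult_proj, intro allI)
    fix i
    have row: "vgrad W G z $ i = grad W (\<lambda>w. G w $ i) z" for G :: "spacetime \<Rightarrow> real^3"
      by (simp add: vgrad_def grad_def)
    have e: "extends (\<lambda>w. ?E w $ i) (\<lambda>w. f w $ i)" by (rule extends_nth[OF extension_extends[OF F]])
    show "proj (\<nu> z) *v vgrad W ?E z $ i = proj (\<nu> z) *v vgrad W F z $ i"
      using sgrad_eq[OF e z] sgrad_eq[OF extends_nth[OF F] z, of i] by (simp add: row)
  qed
  moreover have "vgrad (slab T) ?E z = vgrad W ?E z"
    by (simp add: vgrad_def dx_def dderiv_slab[OF zW])
  ultimately show ?thesis by (simp add: svgrad_def matrix_mul_assoc[symmetric])
qed

text \<open>The subtracted sum is \<open>\<nu> \<cdot> \<partial>\<^sub>\<nu>F\<close>, the normal contribution to the full divergence.\<close>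

lemma sdiv_eq:
  assumes F: "extends F f" and z: "z \<in> \<Sigma>"
  shows "sdiv T \<Gamma> \<nu> f z = divg W F z - (\<Sum>i\<in>UNIV. \<nu> z $ i * (grad W (\<lambda>w. F w $ i) z \<bullet> \<nu> z))"
proof -
  have "trace (vgrad W F z) = divg W F z" by (simp add: trace_def vgrad_def divg_def)
  moreover have "\<nu> z \<bullet> (vgrad W F z *v \<nu> z) = (\<Sum>i\<in>UNIV. \<nu> z $ i * (grad W (\<lambda>w. F w $ i) z \<bullet> \<nu> z))"
    by (simp add: vgrad_def grad_def matrix_vector_mult_def inner_vec_def)
  ultimately show ?thesis
    by (simp add: sdiv_def svgrad_eq[OF F z] trace_sandwich[OF norm_\<nu>[OF z]])
qed

lemma smdiv_eq:
  assumes F: "\<And>i j. extends (\<lambda>w. B w $ i $ j) (\<lambda>w. A w $ i $ j)" and z: "z \<in> \<Sigma>"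
  shows "smdiv T \<Gamma> \<nu> A z $ i =
    mdivg W B z $ i - (\<Sum>j\<in>UNIV. \<nu> z $ j * (grad W (\<lambda>w. B w $ i $ j) z \<bullet> \<nu> z))"
proof -
  have "sgrad T \<Gamma> \<nu> (\<lambda>w. A w $ i $ j) z $ j =
      dx W j (\<lambda>w. B w $ i $ j) z - \<nu> z $ j * (grad W (\<lambda>w. B w $ i $ j) z \<bullet> \<nu> z)" for j
    by (simp add: sgrad_eq[OF F z] proj_mult grad_def mult.commute)
  then show ?thesis by (simp add: smdiv_def mdivg_def sum_subtractf)
qed

section \<open>Lateral boundary points and limits at the surface\<close>

lemma d_continuous_space: "t \<in> {0..T} \<Longrightarrow> continuous_on UNIV (\<lambda>x. d (x, t))"
  using signed by (simp add: signed_distance_def)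

lemma thin_closed_bound: assumes "z \<in> thin_closed T d \<gamma>" shows "\<bar>d z\<bar> \<le> \<gamma>" "z \<in> slab T"
proof -
  obtain x t where z: "z = (x, t)" "t \<in> {0..T}" "x \<in> closure (thin d \<gamma> t)"
    using assms by (auto simp: thin_closed_def)
  have "closed {x. \<bar>d (x, t)\<bar> \<le> \<gamma>}"
    by (intro closed_Collect_le continuous_intros d_continuous_space z)
  moreover have "thin d \<gamma> t \<subseteq> {x. \<bar>d (x, t)\<bar> \<le> \<gamma>}" by (auto simp: thin_def)
  ultimately show "\<bar>d z\<bar> \<le> \<gamma>" using closure_minimal z by blast
  show "z \<in> slab T" using z by (simp add: slab_def)
qed

lemma thin_closed_subset_slab: "thin_closed T d \<gamma> \<subseteq> slab T"
  using thin_closed_bound by blast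

lemma thin_closed_subset_W: "\<gamma> < \<gamma>\<^sub>0 \<Longrightarrow> thin_closed T d \<gamma> \<subseteq> W"
  using thin_closed_bound by (fastforce simp: thin_domain_def thin_def slab_def)

lemma thin_domain_subset_closed: "thin_domain T d \<gamma> \<subseteq> thin_closed T d \<gamma>"
  using closure_subset by (fastforce simp: thin_domain_def thin_closed_def)

lemma at_within_thin_closed: "z \<in> thin_domain T d \<gamma> \<Longrightarrow> at z within thin_closed T d \<gamma> = at z within slab T"
  by (rule at_within_thin[OF _ thin_domain_subset_closed thin_closed_subset_slab])

text \<open>Every point off the surface lies on the lateral boundary of the thin domain of width \<open>|d|\<close>, since \<open>|d|\<close>
  decreases strictly on the segment towards the foot. So a condition on all lateral boundaries is a
  condition at all these points.\<close>

lemma lateral_point: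
  assumes z: "z \<in> W" and "d z \<noteq> 0"
  shows "z \<in> thin_lateral T d \<bar>d z\<bar>" "z \<in> thin_closed T d \<bar>d z\<bar>"
proof -
  obtain x t where xt: "z = (x, t)" "t \<in> {0..T}" using z by (auto simp: thin_domain_def)
  let ?A = "thin d \<bar>d z\<bar> t"
  have "x \<in> closure ?A" unfolding closure_approachable
  proof (intro allI impI)
    fix e :: real assume e: "0 < e"
    define \<sigma> where "\<sigma> = max 0 (1 - e / (2 * \<bar>d z\<bar>))"
    have "0 < e / (2 * \<bar>d z\<bar>)" using e assms by simp
    then have \<sigma>: "0 \<le> \<sigma>" "\<sigma> < 1" by (auto simp: \<sigma>_def)
    define w where "w = fst (foot z) + \<sigma> *\<^sub>R (fst z - fst (foot z))"
    have "\<bar>d (w, t)\<bar> = \<sigma> * \<bar>d z\<bar>" using normal_segment(3)[OF z, of \<sigma>] \<sigma> xt by (simp add: w_def)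
    also have "\<dots> < 1 * \<bar>d z\<bar>" using \<sigma> assms by (intro mult_strict_right_mono) auto
    finally have wA: "w \<in> ?A" by (simp add: thin_def)
    have "w - x = (\<sigma> - 1) *\<^sub>R (fst z - fst (foot z))" by (simp add: w_def xt algebra_simps)
    then have "dist w x = (1 - \<sigma>) * \<bar>d z\<bar>"
      using \<sigma> dist_foot[of z] xt by (simp add: dist_norm)
    also have "\<dots> \<le> (e / (2 * \<bar>d z\<bar>)) * \<bar>d z\<bar>" by (intro mult_right_mono) (auto simp: \<sigma>_def)
    also have "\<dots> < e" using e assms by simp
    finally show "\<exists>y\<in>?A. dist y x < e" using wA by blast
  qed
  moreover have "x \<notin> interior ?A" using interior_subset[of ?A] xt by (auto simp: thin_def)
  ultimately show "z \<in> thin_lateral T d \<bar>d z\<bar>" "z \<in> thin_closed T d \<bar>d z\<bar>"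
    using xt by (simp_all add: thin_lateral_def thin_closed_def frontier_def)
qed

lemma ray_has_derivative:
  fixes f :: "spacetime \<Rightarrow> real"
  assumes f: "f differentiable (at z within W)"
    and ray: "\<And>s. 0 < s \<Longrightarrow> s < s0 \<Longrightarrow> z + s *\<^sub>R h \<in> W"
  shows "((\<lambda>s. f (z + s *\<^sub>R h)) has_real_derivative dderiv W h f z) (at 0 within {0<..<s0})"
proof -
  have c: "((\<lambda>s::real. z + s *\<^sub>R h) has_derivative (\<lambda>s. s *\<^sub>R h)) (at 0 within {0<..<s0})"
    by (auto intro!: derivative_eq_intros)
  have "(\<lambda>s::real. z + s *\<^sub>R h) ` {0<..<s0} \<subseteq> W" using ray by auto
  then have "(f has_derivative (\<lambda>h. dderiv W h f z)) (at (z + 0 *\<^sub>R h) within (\<lambda>s. z + s *\<^sub>R h) ` {0<..<s0})"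
    using has_derivative_dderiv[OF f] has_derivative_subset by force
  from has_derivative_in_compose[OF c this]
  show ?thesis using linear_scale[OF linear_dderiv[OF f]]
    by (simp add: has_field_derivative_def mult.commute[of _ "dderiv W h f z"])
qed

text \<open>Directions close to \<open>-sgn d n\<close> in space, with a small time component that points into \<open>[0,T]\<close>, make
  \<open>|d|\<close> decrease at first order.\<close>

lemma fat_lateral:
  assumes z: "z \<in> W" and dz: "d z \<noteq> 0"
  shows "fat_at (thin_closed T d \<bar>d z\<bar>) z"
proof -
  \<comment> \<open>Inward speed at least \<open>1 - \<delta>\<close> beats the motion of the boundary, which contributes at most \<open>2\<delta>|v|\<close>.\<close>
  define \<delta> where "\<delta> = 1 / (2 + 4 * \<bar>v z\<bar>)"
  have \<delta>: "0 < \<delta>" "\<delta> * (1 + 2 * \<bar>v z\<bar>) = 1 / 2" by (simp_all add: \<delta>_def field_simps add_pos_nonneg)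
  define \<sigma> :: real where "\<sigma> = (if snd z < T then \<delta> else - \<delta>)"
  define \<alpha> where "\<alpha> = sgn (d z)"
  have \<alpha>: "\<bar>\<alpha>\<bar> = 1" "\<alpha> * \<alpha> = 1" "\<alpha> * d z = \<bar>d z\<bar>" using dz by (auto simp: \<alpha>_def sgn_if abs_if)
  have "\<exists>s0>0. \<forall>s. 0 < s \<and> s < s0 \<longrightarrow> z + s *\<^sub>R h \<in> thin_closed T d \<bar>d z\<bar>"
    if h: "h \<in> ball (- \<alpha> *\<^sub>R n z, \<sigma>) \<delta>" for h
  proof -
    obtain a \<tau> where at: "h = (a, \<tau>)" by (cases h)
    have a: "norm (a + \<alpha> *\<^sub>R n z) < \<delta>"
      using h dist_fst_le[of "(- \<alpha> *\<^sub>R n z, \<sigma>)" h] by (simp add: at dist_norm norm_minus_commute)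
    have t: "\<bar>\<tau> - \<sigma>\<bar> < \<delta>"
      using h dist_snd_le[of "(- \<alpha> *\<^sub>R n z, \<sigma>)" h] by (simp add: at dist_real_def)
    have slab: "\<exists>s0>0. \<forall>s. 0 < s \<and> s < s0 \<longrightarrow> z + s *\<^sub>R h \<in> slab T"
    proof (rule ray_in_slab[OF W_slab[OF z]])
      show "snd h = 0 \<or> snd z < T \<and> 0 < snd h \<or> 0 < snd z \<and> snd h < 0"
        using t \<delta> T_pos W_slab[OF z] by (auto simp: at \<sigma>_def slab_def split: if_splits)
    qed
    obtain s1 where s1: "s1 > 0" "\<And>s. 0 < s \<Longrightarrow> s < s1 \<Longrightarrow> z + s *\<^sub>R h \<in> W"
      using ray_in_thin[OF z slab] by blast
    have "\<bar>(a + \<alpha> *\<^sub>R n z) \<bullet> n z\<bar> \<le> norm (a + \<alpha> *\<^sub>R n z) * norm (n z)" by (rule Cauchy_Schwarz_ineq2)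
    then have 1: "\<bar>a \<bullet> n z + \<alpha>\<bar> < \<delta>"
      using a norm_n[OF z] by (simp add: inner_add norm_eq_1)
    have "\<bar>\<tau>\<bar> < 2 * \<delta>" using t \<delta> by (auto simp: \<sigma>_def split: if_splits)
    then have 2: "\<bar>\<tau> * v z\<bar> \<le> 2 * \<delta> * \<bar>v z\<bar>" unfolding abs_mult by (intro mult_right_mono) auto
    have "\<bar>\<alpha> * (a \<bullet> n z + \<alpha> - \<tau> * v z)\<bar> < \<delta> + 2 * \<delta> * \<bar>v z\<bar>"
      unfolding abs_mult \<alpha>(1)
      using 1 2 abs_triangle_ineq4[of "a \<bullet> n z + \<alpha>" "\<tau> * v z"] by simp
    then have "\<alpha> * (a \<bullet> n z - \<tau> * v z) + 1 < 1 / 2"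
      using \<delta>(2) \<alpha>(2) by (simp add: algebra_simps)
    then have neg: "\<alpha> * (a \<bullet> n z - \<tau> * v z) < 0" by simp
    let ?f = "\<lambda>s. \<alpha> * d (z + s *\<^sub>R h)"
    have D: "(?f has_real_derivative \<alpha> * (a \<bullet> n z - \<tau> * v z)) (at 0 within {0<..<s1})"
      using DERIV_cmult[OF ray_has_derivative[OF d_differentiable[OF z], of s1 h, OF s1(2)], of \<alpha>]
      by (simp add: at dderiv_d[OF z])
    obtain e1 where e1: "e1 > 0" "\<forall>s>0. 0 + s \<in> {0<..<s1} \<longrightarrow> s < e1 \<longrightarrow> ?f 0 > ?f (0 + s)"
      using has_real_derivative_neg_dec_right[OF D neg] by blast
    have "(?f \<longlongrightarrow> ?f 0) (at 0 within {0<..<s1})"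
      using DERIV_continuous[OF D] by (simp add: continuous_within)
    moreover have "?f 0 > 0" using \<alpha> dz by simp
    ultimately have "eventually (\<lambda>s. ?f s > 0) (at 0 within {0<..<s1})" by (rule order_tendstoD(1))
    then obtain e2 where e2: "e2 > 0" "\<forall>s\<in>{0<..<s1}. s \<noteq> 0 \<and> dist s 0 < e2 \<longrightarrow> ?f s > 0"
      by (auto simp: eventually_at)
    have "z + s *\<^sub>R h \<in> thin_closed T d \<bar>d z\<bar>" if s: "0 < s" "s < min s1 (min e1 e2)" for s
    proof -
      have "?f s < ?f 0" "?f s > 0" using e1 e2 s by auto
      moreover have "\<bar>?f s\<bar> = \<bar>d (z + s *\<^sub>R h)\<bar>" using \<alpha> by (simp add: abs_mult)
      ultimately have "\<bar>d (z + s *\<^sub>R h)\<bar> < \<bar>d z\<bar>" using \<alpha>(3) by simp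
      moreover have "z + s *\<^sub>R h \<in> slab T" using s1 s W_slab by simp
      ultimately have "z + s *\<^sub>R h \<in> thin_domain T d \<bar>d z\<bar>"
        by (cases "z + s *\<^sub>R h") (auto simp: thin_domain_def thin_def slab_def)
      then show ?thesis using thin_domain_subset_closed by blast
    qed
    moreover have "min s1 (min e1 e2) > 0" using s1 e1 e2 by simp
    ultimately show ?thesis by blast
  qed
  then show ?thesis unfolding fat_at_def
    by - (rule exI[of _ "(- \<alpha> *\<^sub>R n z, \<sigma>)"], rule exI[of _ \<delta>], use \<delta>(1) in blast)
qed

lemma fat_thin_closed:
  assumes "\<gamma> < \<gamma>\<^sub>0" "z \<in> thin_closed T d \<gamma>"
  shows "fat_at (thin_closed T d \<gamma>) z"
proof (cases "\<bar>d z\<bar> < \<gamma>")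
  case True
  then have "z \<in> thin_domain T d \<gamma>"
    using thin_closed_bound[OF assms(2)] by (cases z) (auto simp: thin_domain_def thin_def slab_def)
  then show ?thesis using fat_at_mono[OF fat_thin thin_domain_subset_closed] by blast
next
  case False
  then have g: "\<gamma> = \<bar>d z\<bar>" using thin_closed_bound[OF assms(2)] by simp
  have z: "z \<in> W" using assms thin_closed_subset_W by blast
  show ?thesis
  proof (cases "d z = 0")
    case True
    then have "thin d \<gamma> t = {}" for t using g by (simp add: thin_def)
    then show ?thesis using assms(2) by (simp add: thin_closed_def)
  next
    case False
    then show ?thesis using fat_lateral[OF z] g by simp
  qed
qed

text \<open>The signed distance has slope one along the normal, hence is nonzero on a short normal ray; this
  approaches a surface point through points that lie on lateral boundaries.\<close>

lemma normal_ray: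
  assumes z: "z \<in> \<Sigma>"
  shows "\<exists>s0>0. \<forall>s. 0 < s \<and> s < s0 \<longrightarrow>
    z + s *\<^sub>R (\<nu> z, 0) \<in> W \<and> d (z + s *\<^sub>R (\<nu> z, 0)) \<noteq> 0 \<and> \<bar>d (z + s *\<^sub>R (\<nu> z, 0))\<bar> \<le> s"
proof -
  have zW: "z \<in> W" by (rule \<Sigma>_W[OF z])
  let ?h = "(\<nu> z, 0::real)"
  have slab: "\<exists>s0>0. \<forall>s. 0 < s \<and> s < s0 \<longrightarrow> z + s *\<^sub>R ?h \<in> slab T"
    by (rule ray_in_slab[OF W_slab[OF zW]]) simp
  obtain s1 where s1: "s1 > 0" "\<And>s. 0 < s \<Longrightarrow> s < s1 \<Longrightarrow> z + s *\<^sub>R ?h \<in> W"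
    using ray_in_thin[OF zW slab] by blast
  have D: "((\<lambda>s. d (z + s *\<^sub>R ?h)) has_real_derivative 1) (at 0 within {0<..<s1})"
    using ray_has_derivative[OF d_differentiable[OF zW] s1(2)] norm_\<nu>[OF z]
    by (simp add: dderiv_d[OF zW] lift_on_surface[OF z] norm_eq_1)
  obtain e1 where e1: "e1 > 0" "\<forall>s>0. 0 + s \<in> {0<..<s1} \<longrightarrow> s < e1 \<longrightarrow> d (z + 0 *\<^sub>R ?h) < d (z + (0 + s) *\<^sub>R ?h)"
    using has_real_derivative_pos_inc_right[OF D] by auto
  have "z + s *\<^sub>R ?h \<in> W \<and> d (z + s *\<^sub>R ?h) \<noteq> 0 \<and> \<bar>d (z + s *\<^sub>R ?h)\<bar> \<le> s" if s: "0 < s" "s < min s1 e1" for s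
  proof (intro conjI)
    show "z + s *\<^sub>R ?h \<in> W" using s1 s by simp
    have "d (z + 0 *\<^sub>R ?h) < d (z + (0 + s) *\<^sub>R ?h)" using e1(2) s by simp
    then show "d (z + s *\<^sub>R ?h) \<noteq> 0" using on_surface(2)[OF z] by (simp add: zero_prod_def[symmetric])
    obtain x t where xt: "z = (x, t)" "t \<in> {0..T}" "x \<in> \<Gamma> t" using z by (auto simp: st_surface_def)
    have "infdist (x + s *\<^sub>R \<nu> z) (\<Gamma> t) \<le> dist (x + s *\<^sub>R \<nu> z) x" by (rule infdist_le[OF xt(3)])
    then show "\<bar>d (z + s *\<^sub>R ?h)\<bar> \<le> s"
      using abs_d[OF xt(2)] norm_\<nu>[OF z] s by (simp add: xt dist_norm)
  qed
  moreover have "min s1 e1 > 0" using s1 e1 by simp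
  ultimately show ?thesis by blast
qed

text \<open>The limit passage \<open>\<gamma> \<rightarrow> 0\<close>: along the normal ray the bound tends to zero and \<open>f\<close> to \<open>f z\<close>.\<close>

lemma vanishes_on_surface:
  fixes f g :: "spacetime \<Rightarrow> real"
  assumes z: "z \<in> \<Sigma>" and f: "continuous (at z within W) f" and g: "continuous (at z within W) g"
    and bound: "\<And>w. w \<in> W \<Longrightarrow> d w \<noteq> 0 \<Longrightarrow> \<bar>f w\<bar> \<le> \<bar>d w\<bar> * g w"
  shows "f z = 0"
proof -
  let ?w = "\<lambda>s. z + s *\<^sub>R (\<nu> z, 0::real)"
  obtain s0 where s0: "s0 > 0" "\<And>s. 0 < s \<Longrightarrow> s < s0 \<Longrightarrow> ?w s \<in> W \<and> d (?w s) \<noteq> 0 \<and> \<bar>d (?w s)\<bar> \<le> s"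
    using normal_ray[OF z] by blast
  have ev: "eventually (\<lambda>s. 0 < s \<and> s < s0) (at_right 0)"
    using s0(1) by (auto simp: eventually_at_right_field)
  have "((\<lambda>s. ?w s) \<longlongrightarrow> ?w 0) (at_right 0)" by (intro tendsto_intros)
  moreover have "eventually (\<lambda>s. ?w s \<in> W \<and> ?w s \<noteq> z) (at_right 0)"
    using ev by eventually_elim (use s0(2) on_surface(2)[OF z] in force)
  ultimately have w: "filterlim ?w (at z within W) (at_right 0)" by (simp add: filterlim_at zero_prod_def[symmetric])
  have fl: "((\<lambda>s. f (?w s)) \<longlongrightarrow> f z) (at_right 0)" and gl: "((\<lambda>s. g (?w s)) \<longlongrightarrow> g z) (at_right 0)"
    using f g filterlim_compose[OF _ w] by (auto simp: continuous_within)
  have "((\<lambda>s. s * \<bar>g (?w s)\<bar>) \<longlongrightarrow> 0 * \<bar>g z\<bar>) (at_right 0)" by (intro tendsto_intros gl)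
  then have gl: "((\<lambda>s. s * \<bar>g (?w s)\<bar>) \<longlongrightarrow> 0) (at_right 0)" by simp
  have "eventually (\<lambda>s. norm (f (?w s)) \<le> s * \<bar>g (?w s)\<bar>) (at_right 0)"
    using ev
  proof eventually_elim
    case (elim s)
    have "\<bar>f (?w s)\<bar> \<le> \<bar>d (?w s)\<bar> * g (?w s)" using bound s0(2) elim by blast
    also have "\<dots> \<le> \<bar>d (?w s)\<bar> * \<bar>g (?w s)\<bar>" by (intro mult_left_mono) auto
    also have "\<dots> \<le> s * \<bar>g (?w s)\<bar>" using s0(2)[of s] elim by (intro mult_right_mono) auto
    finally show ?case by simp
  qed
  from Lim_null_comparison[OF this gl] show ?thesis
    using fl tendsto_unique trivial_limit_at_right_real by blast
qed

text \<open>On the normal ray \<open>f\<close> is \<open>O(s\<^sup>2)\<close>, so its difference quotient at \<open>z\<close> tends to zero.\<close>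

lemma normal_derivative_vanishes:
  fixes f :: "spacetime \<Rightarrow> real"
  assumes z: "z \<in> \<Sigma>" and f: "f differentiable (at z within W)"
    and bound: "\<And>w. w \<in> W \<Longrightarrow> d w \<noteq> 0 \<Longrightarrow> \<bar>f w\<bar> \<le> K * (d w)\<^sup>2"
  shows "f z = 0" "dderiv W (\<nu> z, 0) f z = 0"
proof -
  have zW: "z \<in> W" by (rule \<Sigma>_W[OF z])
  have dc: "continuous (at z within W) d"
    by (rule differentiable_imp_continuous_within[OF d_differentiable[OF zW]])
  show fz: "f z = 0"
  proof (rule vanishes_on_surface[OF z])
    show "continuous (at z within W) f" by (rule differentiable_imp_continuous_within[OF f])
    show "continuous (at z within W) (\<lambda>w. K * \<bar>d w\<bar>)" by (intro continuous_intros dc)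
    show "\<bar>f w\<bar> \<le> \<bar>d w\<bar> * (K * \<bar>d w\<bar>)" if "w \<in> W" "d w \<noteq> 0" for w
      using bound[OF that] by (simp add: power2_eq_square algebra_simps)
  qed
  let ?w = "\<lambda>s. z + s *\<^sub>R (\<nu> z, 0::real)"
  obtain s0 where s0: "s0 > 0" "\<And>s. 0 < s \<Longrightarrow> s < s0 \<Longrightarrow> ?w s \<in> W \<and> d (?w s) \<noteq> 0 \<and> \<bar>d (?w s)\<bar> \<le> s"
    using normal_ray[OF z] by blast
  have eq: "at 0 within {0<..<s0} = at_right 0"
    by (rule at_within_nhd[of _ "{..<s0}"]) (use s0(1) in auto)
  have "((\<lambda>s. f (?w s)) has_real_derivative dderiv W (\<nu> z, 0) f z) (at_right 0)"
    using ray_has_derivative[OF f, of s0 "(\<nu> z, 0)"] s0(2) eq by simp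
  then have l: "((\<lambda>s. f (?w s) / s) \<longlongrightarrow> dderiv W (\<nu> z, 0) f z) (at_right 0)"
    by (simp add: has_field_derivative_iff fz zero_prod_def[symmetric])
  have "((\<lambda>s. \<bar>K\<bar> * s) \<longlongrightarrow> \<bar>K\<bar> * 0) (at_right 0)" by (intro tendsto_intros)
  then have r: "((\<lambda>s. \<bar>K\<bar> * s) \<longlongrightarrow> 0) (at_right 0)" by simp
  have "eventually (\<lambda>s. 0 < s \<and> s < s0) (at_right 0)"
    using s0(1) by (auto simp: eventually_at_right_field)
  then have "eventually (\<lambda>s. norm (f (?w s) / s) \<le> \<bar>K\<bar> * s) (at_right 0)"
  proof eventually_elim
    case (elim s)
    have "\<bar>f (?w s)\<bar> \<le> K * (d (?w s))\<^sup>2" using bound s0(2) elim by blast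
    also have "\<dots> \<le> \<bar>K\<bar> * (d (?w s))\<^sup>2" by (intro mult_right_mono) auto
    also have "(d (?w s))\<^sup>2 \<le> s\<^sup>2" using s0(2)[of s] elim by (metis abs_le_square_iff abs_of_pos)
    finally have "\<bar>f (?w s)\<bar> \<le> \<bar>K\<bar> * s\<^sup>2" by (simp add: mult_left_mono)
    then show ?case using elim by (simp add: power2_eq_square divide_le_eq mult.assoc)
  qed
  from Lim_null_comparison[OF this r] show "dderiv W (\<nu> z, 0) f z = 0"
    using l tendsto_unique trivial_limit_at_right_real by blast
qed

section \<open>Expansions in the signed distance\<close>

definition expand :: "(spacetime \<Rightarrow> 'b::real_normed_vector) \<Rightarrow> (spacetime \<Rightarrow> 'b) \<Rightarrow> (spacetime \<Rightarrow> 'b)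
    \<Rightarrow> spacetime \<Rightarrow> 'b" where
  "expand g0 g1 g2 z = lift \<Gamma> g0 z + d z *\<^sub>R lift \<Gamma> g1 z + (d z)\<^sup>2 *\<^sub>R lift \<Gamma> g2 z"

lemma expand_twice:
  assumes "Ck_ext 2 T g0 \<Sigma>" "Ck_ext 2 T g1 \<Sigma>" "Ck_ext 2 T g2 \<Sigma>"
  shows "expand g0 g1 g2 twice_differentiable_on W"
proof -
  have *: "(\<lambda>z. lift \<Gamma> g0 z + (d z *\<^sub>R lift \<Gamma> g1 z + d z *\<^sub>R d z *\<^sub>R lift \<Gamma> g2 z)) twice_differentiable_on W"
    by (intro twice_differentiable_add[OF fat_W] twice_differentiable_scaleR[OF fat_W] d_twice
        lift_twice assms)
  show ?thesis
    by (rule twice_differentiable_cong[OF fat_W *]) (auto simp: expand_def power2_eq_square)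
qed

text \<open>Lifts have no normal derivative and \<open>\<partial>\<^sub>nd = 1\<close>, so \<open>\<partial>\<^sub>n\<close> acts as the formal derivative with respect
  to \<open>d\<close>.\<close>

lemma expand_normal:
  assumes g: "Ck_ext 2 T g0 \<Sigma>" "Ck_ext 2 T g1 \<Sigma>" "Ck_ext 2 T g2 \<Sigma>" and z: "z \<in> W"
  shows "dderiv W (n z, 0) (expand g0 g1 g2) z = lift \<Gamma> g1 z + (2 * d z) *\<^sub>R lift \<Gamma> g2 z"
proof -
  note fat = fat_W[OF z] and dd = d_differentiable[OF z]
  have l: "lift \<Gamma> f differentiable (at z within W)" "dderiv W (n z, 0) (lift \<Gamma> f) z = 0"
    if "Ck_ext 2 T f \<Sigma>" for f :: "spacetime \<Rightarrow> 'a"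
  proof -
    show "lift \<Gamma> f differentiable (at z within W)"
      by (rule twice_differentiableD(1)[OF lift_twice[OF that] z])
    then show "dderiv W (n z, 0) (lift \<Gamma> f) z = 0" by (rule normal_derivative_lift[OF z])
  qed
  have dn: "dderiv W (n z, 0) d z = 1" using dderiv_d[OF z] norm_n[OF z] by (simp add: norm_eq_1)
  have 1: "(\<lambda>w. d w *\<^sub>R lift \<Gamma> f w) differentiable (at z within W)" if "Ck_ext 2 T f \<Sigma>" for f :: "spacetime \<Rightarrow> 'a"
    by (intro differentiable_scaleR dd l that)
  have 2: "(\<lambda>w. d w *\<^sub>R d w *\<^sub>R lift \<Gamma> g2 w) differentiable (at z within W)"
    by (intro differentiable_scaleR dd l g)
  have "expand g0 g1 g2 = (\<lambda>z. lift \<Gamma> g0 z + (d z *\<^sub>R lift \<Gamma> g1 z + d z *\<^sub>R d z *\<^sub>R lift \<Gamma> g2 z))"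
    by (auto simp: expand_def power2_eq_square)
  then show ?thesis
    using dderiv_add[OF fat l(1)[OF g(1)] differentiable_add[OF 1[OF g(2)] 2], of "(n z, 0)"]
      dderiv_add[OF fat 1[OF g(2)] 2, of "(n z, 0)"] dderiv_scaleR[OF fat dd l(1)[OF g(2)], of "(n z, 0)"]
      dderiv_scaleR[OF fat dd 1[OF g(3)], of "(n z, 0)"] dderiv_scaleR[OF fat dd l(1)[OF g(3)], of "(n z, 0)"]
    by (simp add: l(2) g dn scaleR_add_left[symmetric])
qed

lemma expand_extends:
  assumes "Ck_ext 2 T g0 \<Sigma>" "Ck_ext 2 T g1 \<Sigma>" "Ck_ext 2 T g2 \<Sigma>"
  shows "extends (expand g0 g1 g2) g0"
  using twice_differentiableD(1)[OF expand_twice[OF assms]] \<Sigma>_W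
  by (auto simp: extends_def expand_def lift_on_surface on_surface)

text \<open>Contact of first order at \<open>z\<close>. A second-order operator is a derivative of an expression in first
  derivatives, so contact of the fields and of their first derivatives lets a field of width \<open>\<gamma>\<close> be
  replaced by its expansion.\<close>

definition agree :: "spacetime \<Rightarrow> (spacetime \<Rightarrow> 'b::real_normed_vector) \<Rightarrow> (spacetime \<Rightarrow> 'b) \<Rightarrow> bool" where
  "agree z f F \<longleftrightarrow> f z = F z \<and>
     (\<exists>D. (f has_derivative D) (at z within slab T) \<and> (F has_derivative D) (at z within slab T))"

lemma agree_dderiv:
  assumes "agree z f F" "z \<in> thin_domain T d \<gamma>" "z \<in> W"
  shows "dderiv (thin_closed T d \<gamma>) h f z = dderiv W h F z"
proof -
  obtain D where D: "(f has_derivative D) (at z within slab T)" "(F has_derivative D) (at z within slab T)"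
    using assms(1) agree_def by blast
  have "fat_at (slab T) z" using W_slab assms(3) T_pos fat_at_slab by blast
  from fat_at_frechet[OF this D(1)] fat_at_frechet[OF this D(2)] show ?thesis
    by (simp add: dderiv_def at_within_thin_closed[OF assms(2)] at_within_W[OF assms(3)])
qed

lemma agree_value: "agree z f F \<Longrightarrow> f z = F z" by (simp add: agree_def)

lemma agree_scaleR:
  fixes a :: "spacetime \<Rightarrow> real"
  assumes "agree z a A" "agree z f F"
  shows "agree z (\<lambda>w. a w *\<^sub>R f w) (\<lambda>w. A w *\<^sub>R F w)"
proof -
  obtain D where D: "(a has_derivative D) (at z within slab T)" "(A has_derivative D) (at z within slab T)"
    using assms(1) agree_def by blast
  obtain E where E: "(f has_derivative E) (at z within slab T)" "(F has_derivative E) (at z within slab T)"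
    using assms(2) agree_def by blast
  show ?thesis
    using has_derivative_scaleR[OF D(1) E(1)] has_derivative_scaleR[OF D(2) E(2)] assms
    unfolding agree_def by auto
qed

lemma agree_mult:
  fixes a f :: "spacetime \<Rightarrow> real"
  assumes "agree z a A" "agree z f F"
  shows "agree z (\<lambda>w. a w * f w) (\<lambda>w. A w * F w)"
  using agree_scaleR[OF assms] by simp

lemma agree_add:
  assumes "agree z a A" "agree z f F"
  shows "agree z (\<lambda>w. a w + f w) (\<lambda>w. A w + F w)"
proof -
  obtain D where D: "(a has_derivative D) (at z within slab T)" "(A has_derivative D) (at z within slab T)"
    using assms(1) agree_def by blast
  obtain E where E: "(f has_derivative E) (at z within slab T)" "(F has_derivative E) (at z within slab T)"
    using assms(2) agree_def by blast
  show ?thesis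
    using has_derivative_add[OF D(1) E(1)] has_derivative_add[OF D(2) E(2)] assms
    unfolding agree_def by auto
qed

lemma agree_compose:
  fixes f F :: "spacetime \<Rightarrow> real" and \<eta> :: "real \<Rightarrow> real"
  assumes "agree z f F" "\<eta> differentiable (at (F z))"
  shows "agree z (\<lambda>w. \<eta> (f w)) (\<lambda>w. \<eta> (F w))"
proof -
  obtain D where D: "(f has_derivative D) (at z within slab T)" "(F has_derivative D) (at z within slab T)"
    using assms(1) agree_def by blast
  obtain E where E: "(\<eta> has_derivative E) (at (F z))" using assms(2) differentiable_def by blast
  have e: "f z = F z" using assms(1) agree_def by blast
  show ?thesis
    using has_derivative_compose[OF D(1), of \<eta> E] has_derivative_compose[OF D(2) E] E e
    unfolding agree_def by auto
qed

lemma agree_const: "agree z (\<lambda>_. c) (\<lambda>_. c)"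
  unfolding agree_def using has_derivative_const by blast

lemma agree_linear:
  assumes "bounded_linear L" "agree z f F"
  shows "agree z (\<lambda>w. L (f w)) (\<lambda>w. L (F w))"
proof -
  obtain D where D: "(f has_derivative D) (at z within slab T)" "(F has_derivative D) (at z within slab T)"
    using assms(2) agree_def by blast
  then show ?thesis
    using bounded_linear.has_derivative[OF assms(1) D(1)] bounded_linear.has_derivative[OF assms(1) D(2)]
      assms(2) unfolding agree_def by auto
qed

lemma agree_cong:
  assumes "agree z f F" "z \<in> thin_domain T d \<gamma>" "z \<in> W"
    and f: "\<And>w. w \<in> thin_closed T d \<gamma> \<Longrightarrow> f w = f' w" and F: "\<And>w. w \<in> W \<Longrightarrow> F w = F' w"
  shows "agree z f' F'"
proof -
  obtain D where D: "(f has_derivative D) (at z within slab T)" "(F has_derivative D) (at z within slab T)"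
    using assms(1) agree_def by blast
  have zS: "z \<in> thin_closed T d \<gamma>" using assms(2) thin_domain_subset_closed by blast
  have "(f' has_derivative D) (at z within thin_closed T d \<gamma>)"
    by (rule has_derivative_transform[OF zS _ D(1)[folded at_within_thin_closed[OF assms(2)]]])
       (simp add: f)
  moreover have "(F' has_derivative D) (at z within W)"
    by (rule has_derivative_transform[OF assms(3) _ D(2)[folded at_within_W[OF assms(3)]]])
       (simp add: F)
  ultimately show ?thesis
    using assms(1) f[OF zS] F[OF assms(3)] unfolding agree_def
    by (auto simp: at_within_thin_closed[OF assms(2)] at_within_W[OF assms(3)])
qed

text \<open>The form in which the remainder disappears: it has neither a value nor a first derivative at \<open>z\<close>.\<close>

lemma agree_plus_flat:
  assumes z: "z \<in> thin_domain T d \<gamma>" and zW: "z \<in> W"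
    and G: "G differentiable (at z within W)"
    and r: "r differentiable (at z within thin_closed T d \<gamma>)"
    and r0: "r z = 0" and r1: "\<And>b. b \<in> Basis \<Longrightarrow> dderiv (thin_closed T d \<gamma>) b r z = 0"
    and f: "\<And>w. w \<in> thin_closed T d \<gamma> \<Longrightarrow> f w = G w + r w"
  shows "agree z f G"
proof -
  have zS: "z \<in> thin_closed T d \<gamma>" using z thin_domain_subset_closed by blast
  have "dderiv (thin_closed T d \<gamma>) h r z = 0" for h
    unfolding dderiv_basis_sum[OF r, of h] by (simp add: r1)
  then have R: "(r has_derivative (\<lambda>h. 0)) (at z within slab T)"
    using has_derivative_dderiv[OF r] by (simp add: at_within_thin_closed[OF z])
  have Gd: "(G has_derivative (\<lambda>h. dderiv W h G z)) (at z within slab T)"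
    using has_derivative_dderiv[OF G] by (simp add: at_within_W[OF zW])
  have "((\<lambda>w. G w + r w) has_derivative (\<lambda>h. dderiv W h G z)) (at z within thin_closed T d \<gamma>)"
    using has_derivative_add[OF Gd R] by (simp add: at_within_thin_closed[OF z])
  then have "(f has_derivative (\<lambda>h. dderiv W h G z)) (at z within thin_closed T d \<gamma>)"
    by (rule has_derivative_transform[OF zS, rotated]) (simp add: f)
  then show ?thesis
    unfolding agree_def using Gd f[OF zS] r0 by (auto simp: at_within_thin_closed[OF z])
qed

text \<open>Off the surface the expansion is used at width \<open>|d|\<close>, where the point is a lateral one, with a
  constant that does not depend on the point. On the surface the bounds \<open>C|d|\<^sup>3\<close>, \<open>C|d|\<^sup>2\<close>, \<open>C|d|\<close>
  make the remainder and its first and second derivatives zero.\<close>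

lemma expansion:
  fixes g :: "real \<Rightarrow> spacetime \<Rightarrow> 'b::real_normed_vector"
  assumes "distance_expansion T \<Gamma> d \<gamma>\<^sub>0 g g0 g1 g2"
  defines "G \<equiv> expand g0 g1 g2"
  shows "\<exists>K\<ge>0. \<forall>z\<in>W. d z \<noteq> 0 \<longrightarrow> norm (g \<bar>d z\<bar> z - G z) \<le> K * \<bar>d z\<bar> ^ 3 \<and>
      (\<forall>b\<in>Basis. norm (dderiv (thin_closed T d \<bar>d z\<bar>) b (g \<bar>d z\<bar>) z - dderiv W b G z) \<le> K * (d z)\<^sup>2)"
    and "\<And>\<gamma> z. 0 < \<gamma> \<Longrightarrow> \<gamma> < \<gamma>\<^sub>0 \<Longrightarrow> z \<in> thin_closed T d \<gamma> \<Longrightarrow>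
        g \<gamma> differentiable (at z within thin_closed T d \<gamma>)"
    and "\<And>\<gamma> z. 0 < \<gamma> \<Longrightarrow> \<gamma> < \<gamma>\<^sub>0 \<Longrightarrow> z \<in> \<Sigma> \<Longrightarrow> agree z (g \<gamma>) G"
    and "\<And>\<gamma> z b. 0 < \<gamma> \<Longrightarrow> \<gamma> < \<gamma>\<^sub>0 \<Longrightarrow> z \<in> \<Sigma> \<Longrightarrow> b \<in> Basis \<Longrightarrow>
        agree z (dderiv (thin_closed T d \<gamma>) b (g \<gamma>)) (dderiv W b G)"
proof -
  define R where "R C \<gamma> r \<longleftrightarrow> (\<forall>z\<in>thin_closed T d \<gamma>. g \<gamma> z = G z + r z) \<and>
     Ck_on 2 r (thin_closed T d \<gamma>) \<and>
     (\<forall>hs z. set hs \<subseteq> Basis \<and> length hs \<le> 2 \<and> z \<in> thin_closed T d \<gamma> \<longrightarrow>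
        norm (iter_dderiv (thin_closed T d \<gamma>) hs r z) \<le> C * \<bar>d z\<bar> ^ (3 - length hs))" for C \<gamma> r
  have g: "Ck_ext 2 T g0 \<Sigma>" "Ck_ext 2 T g1 \<Sigma>" "Ck_ext 2 T g2 \<Sigma>" and
    "\<exists>C. \<forall>\<gamma>. 0 < \<gamma> \<and> \<gamma> < \<gamma>\<^sub>0 \<longrightarrow> (\<exists>r. R C \<gamma> r)"
    using assms(1) unfolding distance_expansion_def R_def G_def expand_def by blast+
  then obtain C where C: "\<And>\<gamma>. 0 < \<gamma> \<Longrightarrow> \<gamma> < \<gamma>\<^sub>0 \<Longrightarrow> \<exists>r. R C \<gamma> r" by blast
  have G2: "G twice_differentiable_on W" unfolding G_def by (rule expand_twice[OF g])
  have key: "\<exists>r. r twice_differentiable_on thin_closed T d \<gamma> \<and>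
      (\<forall>w\<in>thin_closed T d \<gamma>. g \<gamma> w = G w + r w \<and> g \<gamma> differentiable (at w within thin_closed T d \<gamma>) \<and>
        (\<forall>h. dderiv (thin_closed T d \<gamma>) h (g \<gamma>) w = dderiv W h G w + dderiv (thin_closed T d \<gamma>) h r w) \<and>
        norm (r w) \<le> \<bar>C\<bar> * \<bar>d w\<bar> ^ 3 \<and>
        (\<forall>b\<in>Basis. norm (dderiv (thin_closed T d \<gamma>) b r w) \<le> \<bar>C\<bar> * (d w)\<^sup>2) \<and>
        (\<forall>b\<in>Basis. \<forall>c\<in>Basis. norm (dderiv (thin_closed T d \<gamma>) c (dderiv (thin_closed T d \<gamma>) b r) w) \<le> \<bar>C\<bar> * \<bar>d w\<bar>))"
    if \<gamma>: "0 < \<gamma>" "\<gamma> < \<gamma>\<^sub>0" for \<gamma>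
  proof -
    let ?S = "thin_closed T d \<gamma>"
    obtain r where r: "R C \<gamma> r" using C[OF \<gamma>] by blast
    have r2: "r twice_differentiable_on ?S"
      using r Ck_on_2_twice_differentiable unfolding R_def by blast
    have bd: "norm (iter_dderiv ?S hs r w) \<le> \<bar>C\<bar> * \<bar>d w\<bar> ^ (3 - length hs)"
      if "set hs \<subseteq> Basis" "length hs \<le> 2" "w \<in> ?S" for hs w
    proof -
      have "norm (iter_dderiv ?S hs r w) \<le> C * \<bar>d w\<bar> ^ (3 - length hs)"
        using r that unfolding R_def by blast
      also have "\<dots> \<le> \<bar>C\<bar> * \<bar>d w\<bar> ^ (3 - length hs)" by (intro mult_right_mono) auto
      finally show ?thesis .
    qed
    have eq: "g \<gamma> w = G w + r w" if "w \<in> ?S" for w using r that unfolding R_def by blast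
    have "g \<gamma> w = G w + r w \<and> g \<gamma> differentiable (at w within ?S) \<and>
        (\<forall>h. dderiv ?S h (g \<gamma>) w = dderiv W h G w + dderiv ?S h r w) \<and>
        norm (r w) \<le> \<bar>C\<bar> * \<bar>d w\<bar> ^ 3 \<and>
        (\<forall>b\<in>Basis. norm (dderiv ?S b r w) \<le> \<bar>C\<bar> * (d w)\<^sup>2) \<and>
        (\<forall>b\<in>Basis. \<forall>c\<in>Basis. norm (dderiv ?S c (dderiv ?S b r) w) \<le> \<bar>C\<bar> * \<bar>d w\<bar>)"
      if w: "w \<in> ?S" for w
    proof (intro conjI allI ballI)
      have wW: "w \<in> W" using w thin_closed_subset_W[OF \<gamma>(2)] by blast
      note fat = fat_thin_closed[OF \<gamma>(2) w]
      have Gh: "(G has_derivative (\<lambda>h. dderiv W h G w)) (at w within ?S)"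
        by (rule has_derivative_subset[OF has_derivative_dderiv[OF twice_differentiableD(1)[OF G2 wW]]
              thin_closed_subset_W[OF \<gamma>(2)]])
      note rd = twice_differentiableD(1)[OF r2 w]
      have h: "(g \<gamma> has_derivative (\<lambda>h. dderiv W h G w + dderiv ?S h r w)) (at w within ?S)"
        by (rule has_derivative_transform[OF w eq has_derivative_add[OF Gh has_derivative_dderiv[OF rd]]])
      show "g \<gamma> differentiable (at w within ?S)" using h differentiable_def by blast
      show "dderiv ?S h (g \<gamma>) w = dderiv W h G w + dderiv ?S h r w" for h
        by (rule dderiv_eqI[OF fat h])
      show "norm (r w) \<le> \<bar>C\<bar> * \<bar>d w\<bar> ^ 3" using bd[of "[]" w] w by simp
      show "norm (dderiv ?S b r w) \<le> \<bar>C\<bar> * (d w)\<^sup>2" if "b \<in> Basis" for b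
        using bd[of "[b]" w] w that by simp
      show "norm (dderiv ?S c (dderiv ?S b r) w) \<le> \<bar>C\<bar> * \<bar>d w\<bar>" if "b \<in> Basis" "c \<in> Basis" for b c
        using bd[of "[b, c]" w] w that by simp
    qed (rule eq[OF that])
    then show ?thesis using r2 by blast
  qed
  show "\<exists>K\<ge>0. \<forall>z\<in>W. d z \<noteq> 0 \<longrightarrow> norm (g \<bar>d z\<bar> z - G z) \<le> K * \<bar>d z\<bar> ^ 3 \<and>
      (\<forall>b\<in>Basis. norm (dderiv (thin_closed T d \<bar>d z\<bar>) b (g \<bar>d z\<bar>) z - dderiv W b G z) \<le> K * (d z)\<^sup>2)"
  proof (intro exI[of _ "\<bar>C\<bar>"] conjI ballI impI)
    fix z assume z: "z \<in> W" "d z \<noteq> 0"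
    have \<gamma>: "0 < \<bar>d z\<bar>" "\<bar>d z\<bar> < \<gamma>\<^sub>0" using z by (auto simp: thin_domain_def thin_def)
    note zS = lateral_point(2)[OF z]
    obtain r where r: "g \<bar>d z\<bar> z = G z + r z" "norm (r z) \<le> \<bar>C\<bar> * \<bar>d z\<bar> ^ 3"
      "\<And>b. dderiv (thin_closed T d \<bar>d z\<bar>) b (g \<bar>d z\<bar>) z
         = dderiv W b G z + dderiv (thin_closed T d \<bar>d z\<bar>) b r z"
      "\<And>b. b \<in> Basis \<Longrightarrow> norm (dderiv (thin_closed T d \<bar>d z\<bar>) b r z) \<le> \<bar>C\<bar> * (d z)\<^sup>2"
      using key[OF \<gamma>] zS by blast
    show "norm (g \<bar>d z\<bar> z - G z) \<le> \<bar>C\<bar> * \<bar>d z\<bar> ^ 3" using r(1,2) by simp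
    show "norm (dderiv (thin_closed T d \<bar>d z\<bar>) b (g \<bar>d z\<bar>) z - dderiv W b G z) \<le> \<bar>C\<bar> * (d z)\<^sup>2"
      if "b \<in> Basis" for b
      unfolding r(3) using r(4)[OF that] by simp
  qed simp
  fix \<gamma> z assume \<gamma>: "0 < \<gamma>" "\<gamma> < \<gamma>\<^sub>0"
  let ?S = "thin_closed T d \<gamma>"
  obtain r where r2: "r twice_differentiable_on ?S" and r: "\<And>w. w \<in> ?S \<Longrightarrow> g \<gamma> w = G w + r w"
    "\<And>w. w \<in> ?S \<Longrightarrow> g \<gamma> differentiable (at w within ?S)"
    "\<And>w h. w \<in> ?S \<Longrightarrow> dderiv ?S h (g \<gamma>) w = dderiv W h G w + dderiv ?S h r w"
    "\<And>w. w \<in> ?S \<Longrightarrow> norm (r w) \<le> \<bar>C\<bar> * \<bar>d w\<bar> ^ 3"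
    "\<And>w b. w \<in> ?S \<Longrightarrow> b \<in> Basis \<Longrightarrow> norm (dderiv ?S b r w) \<le> \<bar>C\<bar> * (d w)\<^sup>2"
    "\<And>w b c. w \<in> ?S \<Longrightarrow> b \<in> Basis \<Longrightarrow> c \<in> Basis \<Longrightarrow> norm (dderiv ?S c (dderiv ?S b r) w) \<le> \<bar>C\<bar> * \<bar>d w\<bar>"
    using key[OF \<gamma>] by blast
  show "z \<in> ?S \<Longrightarrow> g \<gamma> differentiable (at z within ?S)" by (rule r(2))
  assume z: "z \<in> \<Sigma>"
  have zW: "z \<in> W" by (rule \<Sigma>_W[OF z])
  have zt: "z \<in> thin_domain T d \<gamma>" by (rule on_surface(4)[OF z \<gamma>(1)])
  have zS: "z \<in> ?S" using zt thin_domain_subset_closed by blast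
  have d0: "d z = 0" by (rule on_surface(2)[OF z])
  have r0: "r z = 0" "\<And>b. b \<in> Basis \<Longrightarrow> dderiv ?S b r z = 0"
    "\<And>b c. b \<in> Basis \<Longrightarrow> c \<in> Basis \<Longrightarrow> dderiv ?S c (dderiv ?S b r) z = 0"
    using r(4-6)[OF zS] by (simp_all add: d0)
  show "agree z (g \<gamma>) G"
    by (rule agree_plus_flat[OF zt zW twice_differentiableD(1)[OF G2 zW]
          twice_differentiableD(1)[OF r2 zS] r0(1,2) r(1)])
  show "agree z (dderiv ?S b (g \<gamma>)) (dderiv W b G)" if b: "b \<in> Basis" for b
    by (rule agree_plus_flat[OF zt zW twice_differentiableD(2)[OF G2 zW b]
          twice_differentiableD(2)[OF r2 zS b] r0(2)[OF b] r0(3)[OF b] r(3)])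
qed

lemma expansion_coefficients:
  assumes "distance_expansion T \<Gamma> d \<gamma>\<^sub>0 g g0 g1 g2"
  shows "Ck_ext 2 T g0 \<Sigma>" "Ck_ext 2 T g1 \<Sigma>" "Ck_ext 2 T g2 \<Sigma>"
  using assms unfolding distance_expansion_def by blast+

lemma expansion_twice:
  "distance_expansion T \<Gamma> d \<gamma>\<^sub>0 g g0 g1 g2 \<Longrightarrow> expand g0 g1 g2 twice_differentiable_on W"
  by (intro expand_twice expansion_coefficients)

lemma expansion_extends:
  "distance_expansion T \<Gamma> d \<gamma>\<^sub>0 g g0 g1 g2 \<Longrightarrow> extends (expand g0 g1 g2) g0"
  by (intro expand_extends expansion_coefficients)

lemma agree_dx:
  assumes "agree z f F" "0 < \<gamma>" "z \<in> \<Sigma>"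
  shows "dx (thin_closed T d \<gamma>) j f z = dx W j F z"
  unfolding dx_def by (rule agree_dderiv[OF assms(1) on_surface(4)[OF assms(3,2)] \<Sigma>_W[OF assms(3)]])

lemma agree_dt:
  assumes "agree z f F" "0 < \<gamma>" "z \<in> \<Sigma>"
  shows "dt (thin_closed T d \<gamma>) f z = dt W F z"
  unfolding dt_def by (rule agree_dderiv[OF assms(1) on_surface(4)[OF assms(3,2)] \<Sigma>_W[OF assms(3)]])

lemma agree_dx_expansion:
  fixes f :: "real \<Rightarrow> spacetime \<Rightarrow> real"
  assumes "distance_expansion T \<Gamma> d \<gamma>\<^sub>0 f f0 f1 f2" "0 < \<gamma>" "\<gamma> < \<gamma>\<^sub>0" "z \<in> \<Sigma>"
  shows "agree z (dx (thin_closed T d \<gamma>) j (f \<gamma>)) (dx W j (expand f0 f1 f2))"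
  unfolding dx_def by (rule expansion(4)[OF assms axis_Basis_spacetime])

lemma agree_dx_nth_expansion:
  fixes u :: "real \<Rightarrow> spacetime \<Rightarrow> real^3"
  assumes exp: "distance_expansion T \<Gamma> d \<gamma>\<^sub>0 u u0 u1 u2" and \<gamma>: "0 < \<gamma>" "\<gamma> < \<gamma>\<^sub>0" and z: "z \<in> \<Sigma>"
  shows "agree z (dx (thin_closed T d \<gamma>) j (\<lambda>w. u \<gamma> w $ i)) (dx W j (\<lambda>w. expand u0 u1 u2 w $ i))"
proof (rule agree_cong[OF agree_linear[OF bounded_linear_vec_nth
        expansion(4)[OF exp \<gamma> z axis_Basis_spacetime]] on_surface(4)[OF z \<gamma>(1)] \<Sigma>_W[OF z]])
  show "dderiv (thin_closed T d \<gamma>) (axis j 1, 0) (u \<gamma>) w $ i = dx (thin_closed T d \<gamma>) j (\<lambda>w. u \<gamma> w $ i) w"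
    if "w \<in> thin_closed T d \<gamma>" for w
    unfolding dx_def by (rule dderiv_nth[OF fat_thin_closed[OF \<gamma>(2) that] expansion(2)[OF exp \<gamma> that], symmetric])
  show "dderiv W (axis j 1, 0) (expand u0 u1 u2) w $ i = dx W j (\<lambda>w. expand u0 u1 u2 w $ i) w"
    if "w \<in> W" for w
    unfolding dx_def
    by (rule dderiv_nth[OF fat_W[OF that] twice_differentiableD(1)[OF expansion_twice[OF exp] that], symmetric])
qed

lemma agree_strain:
  fixes u :: "real \<Rightarrow> spacetime \<Rightarrow> real^3"
  assumes "distance_expansion T \<Gamma> d \<gamma>\<^sub>0 u u0 u1 u2" "0 < \<gamma>" "\<gamma> < \<gamma>\<^sub>0" "z \<in> \<Sigma>"
  shows "agree z (\<lambda>w. strain (thin_closed T d \<gamma>) (u \<gamma>) w $ i $ j) (\<lambda>w. strain W (expand u0 u1 u2) w $ i $ j)"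
  unfolding strain_nth by (intro agree_mult agree_const agree_add agree_dx_nth_expansion assms)

lemma agree_grad:
  assumes "agree z f F" "0 < \<gamma>" "z \<in> \<Sigma>"
  shows "grad (thin_closed T d \<gamma>) f z = grad W F z"
  by (simp add: grad_def agree_dx[OF assms])

lemma agree_divg:
  assumes "\<And>j. agree z (\<lambda>w. y w $ j) (\<lambda>w. Y w $ j)" "0 < \<gamma>" "z \<in> \<Sigma>"
  shows "divg (thin_closed T d \<gamma>) y z = divg W Y z"
  by (simp add: divg_def agree_dx[OF assms])

lemma agree_mdivg:
  assumes "\<And>i j. agree z (\<lambda>w. a w $ i $ j) (\<lambda>w. A w $ i $ j)" "0 < \<gamma>" "z \<in> \<Sigma>"
  shows "mdivg (thin_closed T d \<gamma>) a z = mdivg W A z"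
  by (simp add: mdivg_def agree_dx[OF assms])

lemma expand_on_surface: "z \<in> \<Sigma> \<Longrightarrow> expand g0 g1 g2 z = g0 z"
  by (simp add: expand_def lift_on_surface on_surface)

section \<open>What the boundary conditions say in the tube\<close>

lemma lift_continuous: "Ck_ext 2 T g \<Sigma> \<Longrightarrow> z \<in> W \<Longrightarrow> continuous (at z within W) (lift \<Gamma> g)"
  by (rule differentiable_imp_continuous_within[OF twice_differentiableD(1)[OF lift_twice]])

lemma d_continuous: "z \<in> W \<Longrightarrow> continuous (at z within W) d"
  by (rule differentiable_imp_continuous_within[OF d_differentiable])

lemma n_continuous: "z \<in> W \<Longrightarrow> continuous (at z within W) n"
  by (rule differentiable_imp_continuous_within[OF twice_differentiableD(1)[OF n_twice]])

lemma v_continuous: "z \<in> W \<Longrightarrow> continuous (at z within W) v"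
  by (rule differentiable_imp_continuous_within[OF twice_differentiableD(1)[OF v_twice]])

lemma lateral_range: "z \<in> W \<Longrightarrow> d z \<noteq> 0 \<Longrightarrow> 0 < \<bar>d z\<bar> \<and> \<bar>d z\<bar> < \<gamma>\<^sub>0"
  by (auto simp: thin_domain_def thin_def)

lemma lift_zero: "(\<And>z. z \<in> \<Sigma> \<Longrightarrow> g z = 0) \<Longrightarrow> w \<in> W \<Longrightarrow> lift \<Gamma> g w = 0"
  by (simp add: lift_eq_foot foot_in_surface W_slab)

text \<open>The normal derivative of the expansion is \<open>f\<^sup>1 + 2 d f\<^sup>2\<close> and must be \<open>O(d\<^sup>2)\<close>. Letting \<open>d \<rightarrow> 0\<close>
  gives \<open>f\<^sup>1 = 0\<close>, and dividing by \<open>d\<close> and letting \<open>d \<rightarrow> 0\<close> again gives \<open>f\<^sup>2 = 0\<close>.\<close>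

lemma no_flux_expansion:
  fixes f :: "real \<Rightarrow> spacetime \<Rightarrow> real"
  assumes exp: "distance_expansion T \<Gamma> d \<gamma>\<^sub>0 f f0 f1 f2"
    and bc: "\<And>\<gamma> z. 0 < \<gamma> \<Longrightarrow> \<gamma> < \<gamma>\<^sub>0 \<Longrightarrow> z \<in> thin_lateral T d \<gamma> \<Longrightarrow>
      grad (thin_closed T d \<gamma>) (f \<gamma>) z \<bullet> n z = 0"
    and w: "w \<in> W"
  shows "grad W (expand f0 f1 f2) w \<bullet> n w = 0"
proof -
  let ?F = "expand f0 f1 f2"
  note c = expansion_coefficients[OF exp]
  have flux: "grad W ?F w \<bullet> n w = lift \<Gamma> f1 w + 2 * d w * lift \<Gamma> f2 w" if "w \<in> W" for w
    using grad_inner[OF twice_differentiableD(1)[OF expansion_twice[OF exp] that]] expand_normal[OF c that]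
    by simp
  obtain K where K: "K \<ge> 0" "\<And>z b. z \<in> W \<Longrightarrow> d z \<noteq> 0 \<Longrightarrow> b \<in> Basis \<Longrightarrow>
      norm (dderiv (thin_closed T d \<bar>d z\<bar>) b (f \<bar>d z\<bar>) z - dderiv W b ?F z) \<le> K * (d z)\<^sup>2"
    using expansion(1)[OF exp] by blast
  have bound: "\<bar>grad W ?F w \<bullet> n w\<bar> \<le> 3 * K * (d w)\<^sup>2" if w: "w \<in> W" "d w \<noteq> 0" for w
  proof -
    define \<delta> where "\<delta> = grad W ?F w - grad (thin_closed T d \<bar>d w\<bar>) (f \<bar>d w\<bar>) w"
    have "\<bar>\<delta> $ j\<bar> \<le> K * (d w)\<^sup>2" for j
      using K(2)[OF w axis_Basis_spacetime, of j] by (simp add: \<delta>_def grad_def dx_def abs_minus_commute)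
    then have "(\<Sum>j\<in>UNIV. \<bar>\<delta> $ j\<bar>) \<le> (\<Sum>j\<in>(UNIV::3 set). K * (d w)\<^sup>2)" by (intro sum_mono) auto
    then have "norm \<delta> \<le> 3 * K * (d w)\<^sup>2" using norm_le_l1_cart[of \<delta>] by simp
    moreover have "\<bar>\<delta> \<bullet> n w\<bar> \<le> norm \<delta>" using Cauchy_Schwarz_ineq2[of \<delta> "n w"] norm_n[OF w(1)] by simp
    moreover have "grad W ?F w \<bullet> n w = \<delta> \<bullet> n w"
      using bc[OF _ _ lateral_point(1)[OF w]] lateral_range[OF w] by (simp add: \<delta>_def inner_diff)
    ultimately show ?thesis by simp
  qed
  have f1: "f1 z = 0" if z: "z \<in> \<Sigma>" for z
  proof -
    have zW: "z \<in> W" by (rule \<Sigma>_W[OF z])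
    have "lift \<Gamma> f1 z = 0"
    proof (rule vanishes_on_surface[OF z lift_continuous[OF c(2) zW]])
      show "continuous (at z within W) (\<lambda>w. 2 * \<bar>lift \<Gamma> f2 w\<bar> + 3 * K * \<bar>d w\<bar>)"
        by (intro continuous_intros lift_continuous[OF c(3) zW] d_continuous zW)
      fix w assume w: "w \<in> W" "d w \<noteq> 0"
      have "\<bar>lift \<Gamma> f1 w\<bar> \<le> \<bar>2 * d w * lift \<Gamma> f2 w\<bar> + 3 * K * (d w)\<^sup>2"
        using bound[OF w] unfolding flux[OF w(1)] by linarith
      also have "\<dots> = \<bar>d w\<bar> * (2 * \<bar>lift \<Gamma> f2 w\<bar> + 3 * K * \<bar>d w\<bar>)"
        by (simp add: abs_mult algebra_simps power2_eq_square)
      finally show "\<bar>lift \<Gamma> f1 w\<bar> \<le> \<bar>d w\<bar> * (2 * \<bar>lift \<Gamma> f2 w\<bar> + 3 * K * \<bar>d w\<bar>)" .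
    qed
    then show ?thesis by (simp add: lift_on_surface[OF z])
  qed
  have l1: "lift \<Gamma> f1 w = 0" if "w \<in> W" for w using lift_zero[of f1] f1 that by blast
  have f2: "f2 z = 0" if z: "z \<in> \<Sigma>" for z
  proof -
    have zW: "z \<in> W" by (rule \<Sigma>_W[OF z])
    have "lift \<Gamma> f2 z = 0"
    proof (rule vanishes_on_surface[OF z lift_continuous[OF c(3) zW]])
      show "continuous (at z within W) (\<lambda>w. 3 * K)" by simp
      fix w assume w: "w \<in> W" "d w \<noteq> 0"
      have "\<bar>d w\<bar> * (2 * \<bar>lift \<Gamma> f2 w\<bar>) \<le> \<bar>d w\<bar> * (\<bar>d w\<bar> * (3 * K))"
        using bound[OF w] unfolding flux[OF w(1)] l1[OF w(1)]
        by (simp add: abs_mult algebra_simps power2_eq_square)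
      then have "2 * \<bar>lift \<Gamma> f2 w\<bar> \<le> \<bar>d w\<bar> * (3 * K)" using w by simp
      then show "\<bar>lift \<Gamma> f2 w\<bar> \<le> \<bar>d w\<bar> * (3 * K)" by simp
    qed
    then show ?thesis by (simp add: lift_on_surface[OF z])
  qed
  show ?thesis by (simp add: flux[OF w] l1[OF w] lift_zero[OF f2 w])
qed

text \<open>\<open>U \<cdot> n - v\<close> is a quadratic polynomial in \<open>d\<close> whose coefficients \<open>b\<^sub>0, b\<^sub>1, b\<^sub>2\<close> are lifts. It is
  \<open>O(d\<^sup>3)\<close>, so the coefficients vanish one after the other.\<close>

lemma normal_trace_expansion:
  fixes u :: "real \<Rightarrow> spacetime \<Rightarrow> real^3"
  assumes exp: "distance_expansion T \<Gamma> d \<gamma>\<^sub>0 u u0 u1 u2"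
    and bc: "\<And>\<gamma> z. 0 < \<gamma> \<Longrightarrow> \<gamma> < \<gamma>\<^sub>0 \<Longrightarrow> z \<in> thin_lateral T d \<gamma> \<Longrightarrow> u \<gamma> z \<bullet> n z = v z"
    and w: "w \<in> W"
  shows "expand u0 u1 u2 w \<bullet> n w = v w"
proof -
  let ?U = "expand u0 u1 u2"
  note c = expansion_coefficients[OF exp]
  define b0 where "b0 w = u0 w \<bullet> \<nu> w - V w" for w
  define b1 where "b1 w = u1 w \<bullet> \<nu> w" for w
  define b2 where "b2 w = u2 w \<bullet> \<nu> w" for w
  have lb: "lift \<Gamma> b0 = (\<lambda>w. lift \<Gamma> u0 w \<bullet> n w - v w)" "lift \<Gamma> b1 = (\<lambda>w. lift \<Gamma> u1 w \<bullet> n w)"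
    "lift \<Gamma> b2 = (\<lambda>w. lift \<Gamma> u2 w \<bullet> n w)"
    by (simp_all add: fun_eq_iff lift_eq_foot b0_def b1_def b2_def)
  have cont: "continuous (at z within W) (lift \<Gamma> b0)" "continuous (at z within W) (lift \<Gamma> b1)"
    "continuous (at z within W) (lift \<Gamma> b2)" if "z \<in> W" for z
    unfolding lb by (intro continuous_intros lift_continuous c that n_continuous v_continuous)+
  have split: "?U w \<bullet> n w - v w = lift \<Gamma> b0 w + d w * lift \<Gamma> b1 w + (d w)\<^sup>2 * lift \<Gamma> b2 w" for w
    by (simp add: lb expand_def inner_add)
  obtain K where K: "K \<ge> 0" "\<And>z. z \<in> W \<Longrightarrow> d z \<noteq> 0 \<Longrightarrow> norm (u \<bar>d z\<bar> z - ?U z) \<le> K * \<bar>d z\<bar> ^ 3"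
    using expansion(1)[OF exp] by blast
  have bound: "\<bar>lift \<Gamma> b0 w + d w * lift \<Gamma> b1 w + (d w)\<^sup>2 * lift \<Gamma> b2 w\<bar> \<le> K * \<bar>d w\<bar> ^ 3"
    if w: "w \<in> W" "d w \<noteq> 0" for w
  proof -
    have "u \<bar>d w\<bar> w \<bullet> n w = v w" using bc[OF _ _ lateral_point(1)[OF w]] lateral_range[OF w] by simp
    then have "?U w \<bullet> n w - v w = - ((u \<bar>d w\<bar> w - ?U w) \<bullet> n w)" by (simp add: inner_diff)
    moreover have "\<bar>(u \<bar>d w\<bar> w - ?U w) \<bullet> n w\<bar> \<le> norm (u \<bar>d w\<bar> w - ?U w)"
      using Cauchy_Schwarz_ineq2[of "u \<bar>d w\<bar> w - ?U w" "n w"] norm_n[OF w(1)] by simp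
    ultimately show ?thesis using K(2)[OF w] by (simp add: split[symmetric])
  qed
  have b0: "b0 z = 0" if z: "z \<in> \<Sigma>" for z
  proof -
    have zW: "z \<in> W" by (rule \<Sigma>_W[OF z])
    have "lift \<Gamma> b0 z = 0"
    proof (rule vanishes_on_surface[OF z cont(1)[OF zW]])
      show "continuous (at z within W) (\<lambda>w. \<bar>lift \<Gamma> b1 w\<bar> + \<bar>d w\<bar> * \<bar>lift \<Gamma> b2 w\<bar> + K * (d w)\<^sup>2)"
        by (intro continuous_intros cont zW d_continuous)
      fix w assume w: "w \<in> W" "d w \<noteq> 0"
      have "\<bar>lift \<Gamma> b0 w\<bar> \<le> \<bar>d w * lift \<Gamma> b1 w\<bar> + \<bar>(d w)\<^sup>2 * lift \<Gamma> b2 w\<bar> + K * \<bar>d w\<bar> ^ 3"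
        using bound[OF w] by linarith
      also have "\<dots> = \<bar>d w\<bar> * (\<bar>lift \<Gamma> b1 w\<bar> + \<bar>d w\<bar> * \<bar>lift \<Gamma> b2 w\<bar> + K * (d w)\<^sup>2)"
        by (simp add: abs_mult algebra_simps power2_eq_square power3_eq_cube)
      finally show "\<bar>lift \<Gamma> b0 w\<bar> \<le> \<bar>d w\<bar> * (\<bar>lift \<Gamma> b1 w\<bar> + \<bar>d w\<bar> * \<bar>lift \<Gamma> b2 w\<bar> + K * (d w)\<^sup>2)" .
    qed
    then show ?thesis by (simp add: lift_on_surface[OF z])
  qed
  have l0: "lift \<Gamma> b0 w = 0" if "w \<in> W" for w using lift_zero[of b0] b0 that by blast
  have b1: "b1 z = 0" if z: "z \<in> \<Sigma>" for z
  proof -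
    have zW: "z \<in> W" by (rule \<Sigma>_W[OF z])
    have "lift \<Gamma> b1 z = 0"
    proof (rule vanishes_on_surface[OF z cont(2)[OF zW]])
      show "continuous (at z within W) (\<lambda>w. \<bar>lift \<Gamma> b2 w\<bar> + K * \<bar>d w\<bar>)"
        by (intro continuous_intros cont zW d_continuous)
      fix w assume w: "w \<in> W" "d w \<noteq> 0"
      have "\<bar>d w * lift \<Gamma> b1 w\<bar> \<le> \<bar>(d w)\<^sup>2 * lift \<Gamma> b2 w\<bar> + K * \<bar>d w\<bar> ^ 3"
        using bound[OF w] unfolding l0[OF w(1)] by linarith
      then have "\<bar>d w\<bar> * \<bar>lift \<Gamma> b1 w\<bar> \<le> \<bar>d w\<bar> * (\<bar>d w\<bar> * (\<bar>lift \<Gamma> b2 w\<bar> + K * \<bar>d w\<bar>))"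
        by (simp add: abs_mult algebra_simps power2_eq_square power3_eq_cube)
      then show "\<bar>lift \<Gamma> b1 w\<bar> \<le> \<bar>d w\<bar> * (\<bar>lift \<Gamma> b2 w\<bar> + K * \<bar>d w\<bar>)" using w by simp
    qed
    then show ?thesis by (simp add: lift_on_surface[OF z])
  qed
  have l1: "lift \<Gamma> b1 w = 0" if "w \<in> W" for w using lift_zero[of b1] b1 that by blast
  have b2: "b2 z = 0" if z: "z \<in> \<Sigma>" for z
  proof -
    have zW: "z \<in> W" by (rule \<Sigma>_W[OF z])
    have "lift \<Gamma> b2 z = 0"
    proof (rule vanishes_on_surface[OF z cont(3)[OF zW]])
      show "continuous (at z within W) (\<lambda>w. K)" by simp
      fix w assume w: "w \<in> W" "d w \<noteq> 0"
      have "\<bar>(d w)\<^sup>2 * lift \<Gamma> b2 w\<bar> \<le> K * \<bar>d w\<bar> ^ 3"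
        using bound[OF w] unfolding l0[OF w(1)] l1[OF w(1)] by simp
      then have "(d w)\<^sup>2 * \<bar>lift \<Gamma> b2 w\<bar> \<le> (d w)\<^sup>2 * (\<bar>d w\<bar> * K)"
        by (simp add: abs_mult algebra_simps power2_eq_square power3_eq_cube)
      then show "\<bar>lift \<Gamma> b2 w\<bar> \<le> \<bar>d w\<bar> * K" using w by simp
    qed
    then show ?thesis by (simp add: lift_on_surface[OF z])
  qed
  show ?thesis
    using split[of w] by (simp add: l0[OF w] l1[OF w] lift_zero[OF b2 w])
qed

lemma dderiv_of_zero:
  assumes "z \<in> W" "\<And>w. w \<in> W \<Longrightarrow> f w = 0"
  shows "dderiv W h f z = 0"
proof -
  have "dderiv W h f z = dderiv W h (\<lambda>_. 0) z"
    by (rule dderiv_cong_on[OF fat_W[OF assms(1)] differentiable_const assms(1)]) (simp add: assms(2))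
  then show ?thesis by (simp add: dderiv_const[OF fat_W[OF assms(1)]])
qed

lemma n_differentiable: "z \<in> W \<Longrightarrow> (\<lambda>w. n w $ j) differentiable (at z within W)"
  by (rule twice_differentiableD(1)[OF n_nth_twice])

lemma dot_n_differentiable:
  fixes Y :: "spacetime \<Rightarrow> real^3"
  assumes "z \<in> W" "\<And>j. (\<lambda>w. Y w $ j) differentiable (at z within W)"
  shows "(\<lambda>w. Y w \<bullet> n w) differentiable (at z within W)"
  unfolding inner_vec_def inner_real_def
  by (intro differentiable_sum differentiable_mult ballI assms n_differentiable) simp

text \<open>The normal field is constant in the normal direction, so \<open>n \<cdot> \<partial>\<^sub>nY = \<partial>\<^sub>n(Y \<cdot> n)\<close>.\<close>

lemma normal_derivative_dot:
  fixes Y :: "spacetime \<Rightarrow> real^3"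
  assumes z: "z \<in> W" and Y: "\<And>j. (\<lambda>w. Y w $ j) differentiable (at z within W)"
  shows "(\<Sum>j\<in>UNIV. n z $ j * (grad W (\<lambda>w. Y w $ j) z \<bullet> n z)) = grad W (\<lambda>w. Y w \<bullet> n w) z \<bullet> n z"
proof -
  note fat = fat_W[OF z] and nd = n_differentiable[OF z]
  have n0: "dderiv W (n z, 0) (\<lambda>w. n w $ j) z = 0" for j
  proof -
    have d: "n differentiable (at z within W)" by (rule twice_differentiableD(1)[OF n_twice z])
    show ?thesis using normal_derivative_lift[OF z d] by (simp add: dderiv_nth[OF fat d])
  qed
  have "grad W (\<lambda>w. Y w \<bullet> n w) z \<bullet> n z = dderiv W (n z, 0) (\<lambda>w. Y w \<bullet> n w) z"
    by (rule grad_inner[OF dot_n_differentiable[OF z Y]])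
  also have "\<dots> = dderiv W (n z, 0) (\<lambda>w. \<Sum>j\<in>UNIV. Y w $ j * n w $ j) z" by (simp add: inner_vec_def)
  also have "\<dots> = (\<Sum>j\<in>UNIV. dderiv W (n z, 0) (\<lambda>w. Y w $ j * n w $ j) z)"
    by (rule dderiv_sum[OF fat]) (intro differentiable_mult Y nd)
  also have "\<dots> = (\<Sum>j\<in>UNIV. n z $ j * (grad W (\<lambda>w. Y w $ j) z \<bullet> n z))"
    by (simp add: dderiv_mult[OF fat Y nd] n0 grad_inner[OF Y] mult.commute)
  finally show ?thesis by simp
qed

lemma dx_differentiable:
  "f twice_differentiable_on W \<Longrightarrow> z \<in> W \<Longrightarrow> dx W j f differentiable (at z within W)"
  unfolding dx_def by (rule twice_differentiableD(2)[OF _ _ axis_Basis_spacetime])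

lemma twice_nth: "f twice_differentiable_on W \<Longrightarrow> (\<lambda>w. f w $ i) twice_differentiable_on W"
  by (rule twice_differentiable_linear[OF fat_W bounded_linear_vec_nth])

lemma strain_differentiable:
  assumes "U twice_differentiable_on W" "z \<in> W"
  shows "(\<lambda>w. strain W U w $ i $ j) differentiable (at z within W)"
  unfolding strain_nth
  by (intro differentiable_mult differentiable_add differentiable_const dx_differentiable twice_nth assms)

text \<open>\<open>n \<cdot> E(U) n = n \<cdot> \<partial>\<^sub>nU = \<partial>\<^sub>n(U \<cdot> n) = \<partial>\<^sub>nv = 0\<close>.\<close>

lemma strain_normal_normal:
  assumes U: "U twice_differentiable_on W" and tr: "\<And>w. w \<in> W \<Longrightarrow> U w \<bullet> n w = v w" and w: "w \<in> W"
  shows "(strain W U w *v n w) \<bullet> n w = 0"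
proof -
  have Ud: "(\<lambda>w. U w $ j) differentiable (at w within W)" for j
    by (rule twice_differentiableD(1)[OF twice_nth[OF U] w])
  have vd: "v differentiable (at w within W)" by (rule twice_differentiableD(1)[OF v_twice w])
  have "(strain W U w *v n w) \<bullet> n w = (\<Sum>i\<in>UNIV. n w $ i * (grad W (\<lambda>w. U w $ i) w \<bullet> n w))"
    by (simp add: matrix_vector_mult_def inner_vec_def strain_nth grad_def sum_3 algebra_simps)
  also have "\<dots> = dderiv W (n w, 0) (\<lambda>w. U w \<bullet> n w) w"
    using normal_derivative_dot[OF w Ud] grad_inner[OF dot_n_differentiable[OF w Ud]] by simp
  also have "\<dots> = dderiv W (n w, 0) v w"
    by (rule dderiv_cong_on[OF fat_W[OF w] vd w]) (simp add: tr)
  also have "\<dots> = 0" by (rule normal_derivative_lift[OF w vd])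
  finally show ?thesis .
qed

text \<open>Since \<open>E(U) n\<close> has no normal component, it equals its tangential part. The tangential part of the
  corresponding vector for \<open>u\<close> vanishes by the boundary condition, and the two strains differ by
  first derivatives of the remainder, which are \<open>O(d\<^sup>2)\<close>.\<close>

lemma normal_strain_small:
  fixes u :: "real \<Rightarrow> spacetime \<Rightarrow> real^3"
  assumes exp: "distance_expansion T \<Gamma> d \<gamma>\<^sub>0 u u0 u1 u2"
    and bc: "\<And>\<gamma> z. 0 < \<gamma> \<Longrightarrow> \<gamma> < \<gamma>\<^sub>0 \<Longrightarrow> z \<in> thin_lateral T d \<gamma> \<Longrightarrow> u \<gamma> z \<bullet> n z = v z"
    and bt: "\<And>\<gamma> z. 0 < \<gamma> \<Longrightarrow> \<gamma> < \<gamma>\<^sub>0 \<Longrightarrow> z \<in> thin_lateral T d \<gamma> \<Longrightarrow>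
      tan_part (n z) (strain (thin_closed T d \<gamma>) (u \<gamma>) z *v n z) = 0"
  shows "\<exists>K. \<forall>w\<in>W. d w \<noteq> 0 \<longrightarrow> norm (strain W (expand u0 u1 u2) w *v n w) \<le> K * (d w)\<^sup>2"
proof -
  let ?U = "expand u0 u1 u2"
  have U2: "?U twice_differentiable_on W" by (rule expansion_twice[OF exp])
  obtain K where K: "K \<ge> 0" "\<And>z b. z \<in> W \<Longrightarrow> d z \<noteq> 0 \<Longrightarrow> b \<in> Basis \<Longrightarrow>
      norm (dderiv (thin_closed T d \<bar>d z\<bar>) b (u \<bar>d z\<bar>) z - dderiv W b ?U z) \<le> K * (d z)\<^sup>2"
    using expansion(1)[OF exp] by blast
  \<comment> \<open>\<open>18 = 2 \<cdot> 9\<close>: three entries in each of three rows, and the tangential part at most doubles the norm\<close>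
  have "norm (strain W ?U w *v n w) \<le> 18 * K * (d w)\<^sup>2" if w: "w \<in> W" "d w \<noteq> 0" for w
  proof -
    let ?S = "thin_closed T d \<bar>d w\<bar>" and ?u = "u \<bar>d w\<bar>"
    have r: "0 < \<bar>d w\<bar>" "\<bar>d w\<bar> < \<gamma>\<^sub>0" using lateral_range[OF w] by auto
    have wS: "w \<in> ?S" by (rule lateral_point(2)[OF w])
    have ud: "?u differentiable (at w within ?S)" by (rule expansion(2)[OF exp r wS])
    have Ud: "?U differentiable (at w within W)" by (rule twice_differentiableD(1)[OF U2 w(1)])
    have e: "\<bar>dx W j (\<lambda>w. ?U w $ i) w - dx ?S j (\<lambda>w. ?u w $ i) w\<bar> \<le> K * (d w)\<^sup>2" for i j
    proof -
      let ?b = "(axis j 1, 0) :: spacetime"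
      have "\<bar>dx W j (\<lambda>w. ?U w $ i) w - dx ?S j (\<lambda>w. ?u w $ i) w\<bar>
          = \<bar>(dderiv ?S ?b ?u w - dderiv W ?b ?U w) $ i\<bar>"
        by (simp add: dx_def dderiv_nth[OF fat_thin_closed[OF r(2) wS] ud] dderiv_nth[OF fat_W[OF w(1)] Ud]
            abs_minus_commute)
      also have "\<dots> \<le> norm (dderiv ?S ?b ?u w - dderiv W ?b ?U w)" by (rule component_le_norm_cart)
      also have "\<dots> \<le> K * (d w)\<^sup>2" by (rule K(2)[OF w axis_Basis_spacetime])
      finally show ?thesis .
    qed
    define \<delta> where "\<delta> = strain W ?U w *v n w - strain ?S ?u w *v n w"
    have E: "\<bar>strain W ?U w $ i $ j - strain ?S ?u w $ i $ j\<bar> \<le> K * (d w)\<^sup>2" for i j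
      unfolding strain_nth by (rule half_sum_close[OF e e])
    have "\<bar>\<delta> $ i\<bar> \<le> 3 * K * (d w)\<^sup>2" for i
    proof -
      have "\<bar>\<delta> $ i\<bar> = \<bar>\<Sum>j\<in>UNIV. (strain W ?U w $ i $ j - strain ?S ?u w $ i $ j) * n w $ j\<bar>"
        by (simp add: \<delta>_def matrix_vector_mult_def sum_subtractf left_diff_distrib)
      also have "\<dots> \<le> (\<Sum>j\<in>UNIV. \<bar>(strain W ?U w $ i $ j - strain ?S ?u w $ i $ j) * n w $ j\<bar>)"
        by (rule sum_abs)
      also have "\<dots> \<le> (\<Sum>j\<in>(UNIV::3 set). K * (d w)\<^sup>2 * 1)" unfolding abs_mult
        using component_le_norm_cart[of "n w"] norm_n[OF w(1)] K(1)
        by (intro sum_mono mult_mono E) auto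
      finally show ?thesis by simp
    qed
    then have "(\<Sum>j\<in>UNIV. \<bar>\<delta> $ j\<bar>) \<le> (\<Sum>j\<in>(UNIV::3 set). 3 * K * (d w)\<^sup>2)" by (intro sum_mono) auto
    then have nd: "norm \<delta> \<le> 9 * K * (d w)\<^sup>2" using norm_le_l1_cart[of \<delta>] by simp
    have "(strain W ?U w *v n w) \<bullet> n w = 0"
      by (rule strain_normal_normal[OF U2 normal_trace_expansion[OF exp bc] w(1)])
    then have "strain W ?U w *v n w = tan_part (n w) (strain W ?U w *v n w)" by (simp add: tan_part_def)
    also have "\<dots> = tan_part (n w) (strain W ?U w *v n w) - tan_part (n w) (strain ?S ?u w *v n w)"
      using bt[OF r lateral_point(1)[OF w]] by simp
    also have "\<dots> = \<delta> - (\<delta> \<bullet> n w) *\<^sub>R n w"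
      by (simp add: tan_part_def \<delta>_def inner_diff scaleR_diff_left)
    finally have "norm (strain W ?U w *v n w) \<le> norm \<delta> + \<bar>\<delta> \<bullet> n w\<bar>"
      using norm_triangle_ineq4[of \<delta> "(\<delta> \<bullet> n w) *\<^sub>R n w"] norm_n[OF w(1)] by simp
    moreover have "\<bar>\<delta> \<bullet> n w\<bar> \<le> norm \<delta>" using Cauchy_Schwarz_ineq2[of \<delta> "n w"] norm_n[OF w(1)] by simp
    ultimately show ?thesis using nd by simp
  qed
  then show ?thesis by blast
qed

lemma normal_strain_flat:
  fixes u :: "real \<Rightarrow> spacetime \<Rightarrow> real^3"
  assumes exp: "distance_expansion T \<Gamma> d \<gamma>\<^sub>0 u u0 u1 u2"
    and bc: "\<And>\<gamma> z. 0 < \<gamma> \<Longrightarrow> \<gamma> < \<gamma>\<^sub>0 \<Longrightarrow> z \<in> thin_lateral T d \<gamma> \<Longrightarrow> u \<gamma> z \<bullet> n z = v z"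
    and bt: "\<And>\<gamma> z. 0 < \<gamma> \<Longrightarrow> \<gamma> < \<gamma>\<^sub>0 \<Longrightarrow> z \<in> thin_lateral T d \<gamma> \<Longrightarrow>
      tan_part (n z) (strain (thin_closed T d \<gamma>) (u \<gamma>) z *v n z) = 0"
    and z: "z \<in> \<Sigma>"
  shows "(\<lambda>w. strain W (expand u0 u1 u2) w $ i \<bullet> n w) differentiable (at z within W)"
    "strain W (expand u0 u1 u2) z $ i \<bullet> n z = 0"
    "dderiv W (\<nu> z, 0) (\<lambda>w. strain W (expand u0 u1 u2) w $ i \<bullet> n w) z = 0"
proof -
  let ?U = "expand u0 u1 u2"
  have zW: "z \<in> W" by (rule \<Sigma>_W[OF z])
  obtain K where K: "\<And>w. w \<in> W \<Longrightarrow> d w \<noteq> 0 \<Longrightarrow> norm (strain W ?U w *v n w) \<le> K * (d w)\<^sup>2"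
    using normal_strain_small[OF exp bc bt] by blast
  show D: "(\<lambda>w. strain W ?U w $ i \<bullet> n w) differentiable (at z within W)"
    by (rule dot_n_differentiable[OF zW strain_differentiable[OF expansion_twice[OF exp] zW]])
  have bound: "\<bar>strain W ?U w $ i \<bullet> n w\<bar> \<le> K * (d w)\<^sup>2" if "w \<in> W" "d w \<noteq> 0" for w
  proof -
    have "strain W ?U w $ i \<bullet> n w = (strain W ?U w *v n w) $ i"
      by (simp add: matrix_vector_mult_def inner_vec_def)
    then show ?thesis using component_le_norm_cart[of "strain W ?U w *v n w" i] K[OF that] by simp
  qed
  show "strain W ?U z $ i \<bullet> n z = 0" "dderiv W (\<nu> z, 0) (\<lambda>w. strain W ?U w $ i \<bullet> n w) z = 0"
    by (rule normal_derivative_vanishes[OF z D bound]; assumption)+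
qed

section \<open>Fluxes through the surface\<close>

text \<open>The difference of the two divergences is \<open>\<nu> \<cdot> \<partial>\<^sub>\<nu>Y = \<partial>\<^sub>\<nu>(Y \<cdot> n)\<close>.\<close>

lemma sdiv_eq_divg:
  assumes F: "extends Y f" and z: "z \<in> \<Sigma>" and "dderiv W (\<nu> z, 0) (\<lambda>w. Y w \<bullet> n w) z = 0"
  shows "sdiv T \<Gamma> \<nu> f z = divg W Y z"
proof -
  have zW: "z \<in> W" by (rule \<Sigma>_W[OF z])
  have Y: "(\<lambda>w. Y w $ j) differentiable (at z within W)" for j
    using F z by (auto simp: extends_def intro: differentiable_nth)
  show ?thesis
    using sdiv_eq[OF F z] normal_derivative_dot[OF zW Y] assms(3) grad_inner[OF dot_n_differentiable[OF zW Y]]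
    by (simp add: lift_on_surface[OF z])
qed

lemma smdiv_eq_mdivg:
  assumes F: "\<And>i j. extends (\<lambda>w. B w $ i $ j) (\<lambda>w. A w $ i $ j)" and z: "z \<in> \<Sigma>"
    and "\<And>i. dderiv W (\<nu> z, 0) (\<lambda>w. B w $ i \<bullet> n w) z = 0"
  shows "smdiv T \<Gamma> \<nu> A z = mdivg W B z"
proof -
  have zW: "z \<in> W" by (rule \<Sigma>_W[OF z])
  have Y: "(\<lambda>w. B w $ i $ j) differentiable (at z within W)" for i j
    using F z by (auto simp: extends_def)
  have "smdiv T \<Gamma> \<nu> A z $ i = mdivg W B z $ i" for i
    using smdiv_eq[OF F z] normal_derivative_dot[OF zW Y] assms(3)[of i]
      grad_inner[OF dot_n_differentiable[OF zW Y]]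
    by (simp add: lift_on_surface[OF z])
  then show ?thesis by (simp add: vec_eq_iff)
qed

lemma grad_nth_differentiable:
  "f twice_differentiable_on W \<Longrightarrow> z \<in> W \<Longrightarrow> (\<lambda>w. grad W f w $ j) differentiable (at z within W)"
  by (simp add: grad_def dx_differentiable)

lemma sgrad_no_flux:
  assumes F: "extends F f" and z: "z \<in> \<Sigma>" and "grad W F z \<bullet> n z = 0"
  shows "sgrad T \<Gamma> \<nu> f z = grad W F z"
  using assms(3) by (simp add: sgrad_eq[OF F z] proj_mult lift_on_surface[OF z])

text \<open>A field without normal derivative has the same gradient as its restriction to the surface, and
  \<open>c \<nabla>F\<close> has no normal component in the tube. The diffusive flux is the case \<open>c = M(\<Phi>)\<close>, the
  Laplacian the case \<open>c = 1\<close>.\<close>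

lemma surface_flux_divergence:
  assumes F2: "F twice_differentiable_on W" and F: "extends F f"
    and flux: "\<And>w. w \<in> W \<Longrightarrow> grad W F w \<bullet> n w = 0" and c: "extends c c0" and z: "z \<in> \<Sigma>"
  shows "sdiv T \<Gamma> \<nu> (\<lambda>w. c0 w *\<^sub>R sgrad T \<Gamma> \<nu> f w) z = divg W (\<lambda>w. c w *\<^sub>R grad W F w) z"
proof (rule sdiv_eq_divg[OF _ z])
  show "extends (\<lambda>w. c w *\<^sub>R grad W F w) (\<lambda>w. c0 w *\<^sub>R sgrad T \<Gamma> \<nu> f w)"
    unfolding extends_def
  proof (intro ballI conjI)
    fix y assume y: "y \<in> \<Sigma>"
    have yW: "y \<in> W" by (rule \<Sigma>_W[OF y])
    show "c y *\<^sub>R grad W F y = c0 y *\<^sub>R sgrad T \<Gamma> \<nu> f y"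
      using c y by (simp add: sgrad_no_flux[OF F y flux[OF yW]] extends_def)
    show "(\<lambda>w. c w *\<^sub>R grad W F w) differentiable (at y within W)"
      using c y by (intro differentiable_scaleR differentiable_cart grad_nth_differentiable F2 yW)
        (simp add: extends_def)
  qed
  show "dderiv W (\<nu> z, 0) (\<lambda>w. (c w *\<^sub>R grad W F w) \<bullet> n w) z = 0"
    by (rule dderiv_of_zero[OF \<Sigma>_W[OF z]]) (simp add: flux)
qed

lemma extends_compose:
  assumes "extends F f" "\<And>x. h differentiable (at (x::real))"
  shows "extends (\<lambda>w. h (F w)) (\<lambda>w. h (f w))"
  using assms differentiable_compose[of h] unfolding extends_def by fastforce

text \<open>The normal component of the stress is \<open>(\<nabla>F \<cdot> n) \<nabla>F = 0\<close> in the tube.\<close>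

lemma surface_capillary_stress:
  assumes F2: "F twice_differentiable_on W" and F: "extends F f"
    and flux: "\<And>w. w \<in> W \<Longrightarrow> grad W F w \<bullet> n w = 0" and z: "z \<in> \<Sigma>"
  shows "smdiv T \<Gamma> \<nu> (\<lambda>w. sgrad T \<Gamma> \<nu> f w \<otimes>\<^sub>o sgrad T \<Gamma> \<nu> f w) z
    = mdivg W (\<lambda>w. grad W F w \<otimes>\<^sub>o grad W F w) z"
proof (rule smdiv_eq_mdivg[OF _ z])
  fix i j
  show "extends (\<lambda>w. (grad W F w \<otimes>\<^sub>o grad W F w) $ i $ j)
      (\<lambda>w. (sgrad T \<Gamma> \<nu> f w \<otimes>\<^sub>o sgrad T \<Gamma> \<nu> f w) $ i $ j)"
    unfolding extends_def outer_prod_def vec_lambda_beta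
    by (auto simp: sgrad_no_flux[OF F] flux \<Sigma>_W intro!: differentiable_mult grad_nth_differentiable F2)
  have "(grad W F w \<otimes>\<^sub>o grad W F w) $ i \<bullet> n w = grad W F w $ i * (grad W F w \<bullet> n w)" for w
    by (simp add: outer_prod_def inner_vec_def sum_distrib_left mult.assoc)
  then show "dderiv W (\<nu> z, 0) (\<lambda>w. (grad W F w \<otimes>\<^sub>o grad W F w) $ i \<bullet> n w) z = 0"
    by (intro dderiv_of_zero[OF \<Sigma>_W[OF z]]) (simp add: flux)
qed

text \<open>The surface strain is \<open>P E P\<close> with the full strain \<open>E\<close>. As \<open>E\<close> is symmetric with \<open>E n = 0\<close>, both
  projections act trivially.\<close>

lemma sstrain_eq_strain:
  assumes F: "extends U f" and z: "z \<in> \<Sigma>" and E0: "\<And>i. strain W U z $ i \<bullet> n z = 0"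
  shows "sstrain T \<Gamma> \<nu> f z = strain W U z"
proof -
  let ?P = "proj (\<nu> z)" and ?E = "strain W U z"
  have tE: "transpose ?E = ?E"
    by (simp add: strain_def sym_part_def transpose_def vec_eq_iff add.commute)
  have "?E ** ?P = ?E"
    by (simp add: vec_eq_iff[of "_ ** _"] mult_proj proj_mult E0[unfolded lift_on_surface[OF z]])
  moreover from this have "transpose (?P ** ?E) = ?E"
    by (simp add: matrix_transpose_mul tE transpose_proj)
  then have "?P ** ?E = ?E" by (metis tE transpose_transpose)
  ultimately have "?P ** ?E ** ?P = ?E" by simp
  then show ?thesis
    by (simp add: sstrain_def svgrad_eq[OF F z] sym_part_sandwich[OF transpose_proj] strain_def)
qed

text \<open>On the surface \<open>E(U) n\<close> and \<open>\<partial>\<^sub>n(E(U) n)\<close> vanish, so \<open>\<partial>\<^sub>n(c E(U) n)\<close> vanishes as well.\<close>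

lemma surface_viscous_stress:
  fixes u :: "real \<Rightarrow> spacetime \<Rightarrow> real^3"
  assumes exp: "distance_expansion T \<Gamma> d \<gamma>\<^sub>0 u u0 u1 u2"
    and bc: "\<And>\<gamma> z. 0 < \<gamma> \<Longrightarrow> \<gamma> < \<gamma>\<^sub>0 \<Longrightarrow> z \<in> thin_lateral T d \<gamma> \<Longrightarrow> u \<gamma> z \<bullet> n z = v z"
    and bt: "\<And>\<gamma> z. 0 < \<gamma> \<Longrightarrow> \<gamma> < \<gamma>\<^sub>0 \<Longrightarrow> z \<in> thin_lateral T d \<gamma> \<Longrightarrow>
      tan_part (n z) (strain (thin_closed T d \<gamma>) (u \<gamma>) z *v n z) = 0"
    and c: "extends c c0" and z: "z \<in> \<Sigma>"
  shows "smdiv T \<Gamma> \<nu> (\<lambda>w. c0 w *\<^sub>R sstrain T \<Gamma> \<nu> u0 w) z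
    = mdivg W (\<lambda>w. c w *\<^sub>R strain W (expand u0 u1 u2) w) z"
proof (rule smdiv_eq_mdivg[OF _ z])
  let ?U = "expand u0 u1 u2"
  note flat = normal_strain_flat[OF exp bc bt]
  fix i j
  show "extends (\<lambda>w. (c w *\<^sub>R strain W ?U w) $ i $ j) (\<lambda>w. (c0 w *\<^sub>R sstrain T \<Gamma> \<nu> u0 w) $ i $ j)"
    unfolding extends_def
  proof (intro ballI conjI)
    fix y assume y: "y \<in> \<Sigma>"
    have "sstrain T \<Gamma> \<nu> u0 y = strain W ?U y"
      by (rule sstrain_eq_strain[OF expansion_extends[OF exp] y flat(2)[OF _ _ _ _ _ _ y]])
    then show "(c y *\<^sub>R strain W ?U y) $ i $ j = (c0 y *\<^sub>R sstrain T \<Gamma> \<nu> u0 y) $ i $ j"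
      using c y by (simp add: extends_def)
    have "(\<lambda>w. c w * strain W ?U w $ i $ j) differentiable (at y within W)"
      using c y by (intro differentiable_mult strain_differentiable expansion_twice[OF exp] \<Sigma>_W)
        (auto simp: extends_def)
    then show "(\<lambda>w. (c w *\<^sub>R strain W ?U w) $ i $ j) differentiable (at y within W)" by simp
  qed
  have cd: "c differentiable (at z within W)" using c z by (simp add: extends_def)
  have "dderiv W (\<nu> z, 0) (\<lambda>w. (c w *\<^sub>R strain W ?U w) $ i \<bullet> n w) z
      = dderiv W (\<nu> z, 0) (\<lambda>w. c w * (strain W ?U w $ i \<bullet> n w)) z"
    by simp
  also have "\<dots> = 0"
    using flat[OF _ _ _ _ _ _ z] by (subst dderiv_mult[OF fat_W[OF \<Sigma>_W[OF z]] cd]) auto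
  finally show "dderiv W (\<nu> z, 0) (\<lambda>w. (c w *\<^sub>R strain W ?U w) $ i \<bullet> n w) z = 0" .
qed

end

section \<open>The limit equations\<close>

theorem theorem2p4:
  fixes T \<rho> \<epsilon> \<gamma>\<^sub>0 :: real
    and \<Gamma> :: "real \<Rightarrow> (real^3) set"
    and \<nu> :: "spacetime \<Rightarrow> real^3" and V d :: "spacetime \<Rightarrow> real"
    and \<eta> M F :: "real \<Rightarrow> real"
    and \<phi> \<mu> p :: "real \<Rightarrow> spacetime \<Rightarrow> real" and u :: "real \<Rightarrow> spacetime \<Rightarrow> real^3"
    and \<phi>0 \<phi>1 \<phi>2 \<mu>0 \<mu>1 \<mu>2 p0 p1 p2 :: "spacetime \<Rightarrow> real"
    and u0 u1 u2 :: "spacetime \<Rightarrow> real^3"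
  assumes "0 < T" and "0 < \<rho>" and "0 < \<epsilon>" and "0 < \<gamma>\<^sub>0"
    and "Ck_on 1 \<eta> UNIV" and "Ck_on 1 M UNIV" and "Ck_on 2 F UNIV"
    and "evolving_surface 3 T \<Gamma>"
    and "unit_normal T \<Gamma> \<nu>"
    and "normal_velocity T \<Gamma> \<nu> V"
    and "\<And>t. t \<in> {0..T} \<Longrightarrow> signed_distance (\<Gamma> t) (\<lambda>y. \<nu> (y, t)) (\<lambda>x. d (x, t))"
    and "tubular_nbhd T \<Gamma> \<nu> V d \<gamma>\<^sub>0"
    and momentum: "\<And>\<gamma> S z. 0 < \<gamma> \<Longrightarrow> \<gamma> < \<gamma>\<^sub>0 \<Longrightarrow> S = thin_closed T d \<gamma> \<Longrightarrow> z \<in> thin_domain T d \<gamma> \<Longrightarrow>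
          \<rho> *\<^sub>R (dt S (u \<gamma>) z + convect S (u \<gamma>) (u \<gamma>) z)
            = - grad S (p \<gamma>) z + mdivg S (\<lambda>w. (2 * \<eta> (\<phi> \<gamma> w)) *\<^sub>R strain S (u \<gamma>) w) z
              - \<epsilon> *\<^sub>R mdivg S (\<lambda>w. grad S (\<phi> \<gamma>) w \<otimes>\<^sub>o grad S (\<phi> \<gamma>) w) z"
    and incompressible: "\<And>\<gamma> S z. 0 < \<gamma> \<Longrightarrow> \<gamma> < \<gamma>\<^sub>0 \<Longrightarrow> S = thin_closed T d \<gamma> \<Longrightarrow> z \<in> thin_domain T d \<gamma> \<Longrightarrow>
          divg S (u \<gamma>) z = 0"
    and phase: "\<And>\<gamma> S z. 0 < \<gamma> \<Longrightarrow> \<gamma> < \<gamma>\<^sub>0 \<Longrightarrow> S = thin_closed T d \<gamma> \<Longrightarrow> z \<in> thin_domain T d \<gamma> \<Longrightarrow>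
          dt S (\<phi> \<gamma>) z - divg S (\<lambda>w. M (\<phi> \<gamma> w) *\<^sub>R grad S (\<mu> \<gamma>) w) z + u \<gamma> z \<bullet> grad S (\<phi> \<gamma>) z = 0"
    and potential: "\<And>\<gamma> S z. 0 < \<gamma> \<Longrightarrow> \<gamma> < \<gamma>\<^sub>0 \<Longrightarrow> S = thin_closed T d \<gamma> \<Longrightarrow> z \<in> thin_domain T d \<gamma> \<Longrightarrow>
          \<mu> \<gamma> z = - \<epsilon> * laplace S (\<phi> \<gamma>) z + 1 / \<epsilon> * deriv F (\<phi> \<gamma> z)"
    and boundary: "\<And>\<gamma> S z. 0 < \<gamma> \<Longrightarrow> \<gamma> < \<gamma>\<^sub>0 \<Longrightarrow> S = thin_closed T d \<gamma> \<Longrightarrow> z \<in> thin_lateral T d \<gamma> \<Longrightarrow>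
          u \<gamma> z \<bullet> lift \<Gamma> \<nu> z = lift \<Gamma> V z \<and>
          tan_part (lift \<Gamma> \<nu> z) (strain S (u \<gamma>) z *v lift \<Gamma> \<nu> z) = 0 \<and>
          grad S (\<phi> \<gamma>) z \<bullet> lift \<Gamma> \<nu> z = 0 \<and>
          grad S (\<mu> \<gamma>) z \<bullet> lift \<Gamma> \<nu> z = 0"
    and "distance_expansion T \<Gamma> d \<gamma>\<^sub>0 \<phi> \<phi>0 \<phi>1 \<phi>2"
    and "distance_expansion T \<Gamma> d \<gamma>\<^sub>0 \<mu> \<mu>0 \<mu>1 \<mu>2"
    and "distance_expansion T \<Gamma> d \<gamma>\<^sub>0 u u0 u1 u2"
    and "distance_expansion T \<Gamma> d \<gamma>\<^sub>0 p p0 p1 p2"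
  shows "\<forall>z\<in>st_surface T \<Gamma>.
      \<rho> *\<^sub>R vmaterial_dt T \<Gamma> \<nu> V u0 u0 z
        = - sgrad T \<Gamma> \<nu> p0 z - p1 z *\<^sub>R \<nu> z
          + smdiv T \<Gamma> \<nu> (\<lambda>w. (2 * \<eta> (\<phi>0 w)) *\<^sub>R sstrain T \<Gamma> \<nu> u0 w) z
          - \<epsilon> *\<^sub>R smdiv T \<Gamma> \<nu> (\<lambda>w. sgrad T \<Gamma> \<nu> \<phi>0 w \<otimes>\<^sub>o sgrad T \<Gamma> \<nu> \<phi>0 w) z \<and>
      sdiv T \<Gamma> \<nu> u0 z = 0 \<and>
      material_dt T \<Gamma> \<nu> V u0 \<phi>0 z = sdiv T \<Gamma> \<nu> (\<lambda>w. M (\<phi>0 w) *\<^sub>R sgrad T \<Gamma> \<nu> \<mu>0 w) z \<and>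
      \<mu>0 z = - \<epsilon> * slaplace T \<Gamma> \<nu> \<phi>0 z + 1 / \<epsilon> * deriv F (\<phi>0 z) \<and>
      u0 z \<bullet> \<nu> z = V z"
proof -
  interpret thin_tube T \<Gamma> \<nu> V d \<gamma>\<^sub>0
    by unfold_locales (fact assms)+
  let ?\<Phi> = "expand \<phi>0 \<phi>1 \<phi>2" and ?\<mu> = "expand \<mu>0 \<mu>1 \<mu>2" and ?U = "expand u0 u1 u2"
    and ?p = "expand p0 p1 p2"
  note e\<phi> = \<open>distance_expansion T \<Gamma> d \<gamma>\<^sub>0 \<phi> \<phi>0 \<phi>1 \<phi>2\<close>
    and e\<mu> = \<open>distance_expansion T \<Gamma> d \<gamma>\<^sub>0 \<mu> \<mu>0 \<mu>1 \<mu>2\<close>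
    and eu = \<open>distance_expansion T \<Gamma> d \<gamma>\<^sub>0 u u0 u1 u2\<close>
    and ep = \<open>distance_expansion T \<Gamma> d \<gamma>\<^sub>0 p p0 p1 p2\<close>
  have \<eta>: "\<eta> differentiable (at x)" and M: "M differentiable (at x)" for x
    using \<open>Ck_on 1 \<eta> UNIV\<close> \<open>Ck_on 1 M UNIV\<close> by (simp_all add: Ck_on_1_differentiable)
  have bu: "u \<gamma> z \<bullet> n z = v z"
    and bE: "tan_part (n z) (strain (thin_closed T d \<gamma>) (u \<gamma>) z *v n z) = 0"
    and b\<phi>: "grad (thin_closed T d \<gamma>) (\<phi> \<gamma>) z \<bullet> n z = 0"
    and b\<mu>: "grad (thin_closed T d \<gamma>) (\<mu> \<gamma>) z \<bullet> n z = 0"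
    if "0 < \<gamma>" "\<gamma> < \<gamma>\<^sub>0" "z \<in> thin_lateral T d \<gamma>" for \<gamma> z
    using boundary[OF that(1,2) refl that(3)] by simp_all
  have flux\<phi>: "grad W ?\<Phi> w \<bullet> n w = 0" if "w \<in> W" for w by (rule no_flux_expansion[OF e\<phi> b\<phi> that])
  have flux\<mu>: "grad W ?\<mu> w \<bullet> n w = 0" if "w \<in> W" for w by (rule no_flux_expansion[OF e\<mu> b\<mu> that])
  have trace: "?U w \<bullet> n w = v w" if "w \<in> W" for w by (rule normal_trace_expansion[OF eu bu that])
  note x\<phi> = expansion_extends[OF e\<phi>] and x\<mu> = expansion_extends[OF e\<mu>]
    and xu = expansion_extends[OF eu] and xp = expansion_extends[OF ep]
  \<comment> \<open>On the surface the choice of the width is immaterial.\<close>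
  define \<gamma> where "\<gamma> = \<gamma>\<^sub>0 / 2"
  have \<gamma>: "0 < \<gamma>" "\<gamma> < \<gamma>\<^sub>0" using \<gamma>\<^sub>0_pos by (simp_all add: \<gamma>_def)
  let ?S = "thin_closed T d \<gamma>"
  show ?thesis
  proof (intro ballI conjI)
    fix z assume z: "z \<in> \<Sigma>"
    have zW: "z \<in> W" by (rule \<Sigma>_W[OF z])
    have zt: "z \<in> thin_domain T d \<gamma>" by (rule on_surface(4)[OF z \<gamma>(1)])
    have nz: "n z = \<nu> z" by (rule lift_on_surface[OF z])
    note a\<phi> = expansion(3)[OF e\<phi> \<gamma> z] and a\<mu> = expansion(3)[OF e\<mu> \<gamma> z]
      and au = expansion(3)[OF eu \<gamma> z] and ap = expansion(3)[OF ep \<gamma> z]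
    have \<phi>z: "\<phi> \<gamma> z = \<phi>0 z" "?\<Phi> z = \<phi>0 z" and \<mu>z: "\<mu> \<gamma> z = \<mu>0 z" and uz: "u \<gamma> z = u0 z" "?U z = u0 z"
      using agree_value[OF a\<phi>] agree_value[OF a\<mu>] agree_value[OF au] by (simp_all add: expand_on_surface[OF z])
    show un: "u0 z \<bullet> \<nu> z = V z"
      using trace[OF zW] by (simp add: uz nz lift_on_surface[OF z])
    have aui: "agree z (\<lambda>w. u \<gamma> w $ i) (\<lambda>w. ?U w $ i)" for i
      by (rule agree_linear[OF bounded_linear_vec_nth au])
    have Ud: "?U differentiable (at z within W)" using xu z by (simp add: extends_def)

    show "sdiv T \<Gamma> \<nu> u0 z = 0"
    proof -
      have "dderiv W (\<nu> z, 0) (\<lambda>w. ?U w \<bullet> n w) z = dderiv W (\<nu> z, 0) v z"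
        by (rule dderiv_cong_on[OF fat_W[OF zW] twice_differentiableD(1)[OF v_twice zW] zW]) (simp add: trace)
      also have "\<dots> = 0"
        using normal_derivative_lift[OF zW twice_differentiableD(1)[OF v_twice zW]] nz by simp
      finally have "sdiv T \<Gamma> \<nu> u0 z = divg W ?U z" by (rule sdiv_eq_divg[OF xu z])
      also have "\<dots> = divg ?S (u \<gamma>) z" by (rule agree_divg[OF aui \<gamma>(1) z, symmetric])
      finally show ?thesis using incompressible[OF \<gamma> refl zt] by simp
    qed

    show "material_dt T \<Gamma> \<nu> V u0 \<phi>0 z = sdiv T \<Gamma> \<nu> (\<lambda>w. M (\<phi>0 w) *\<^sub>R sgrad T \<Gamma> \<nu> \<mu>0 w) z"
    proof -
      have "divg ?S (\<lambda>w. M (\<phi> \<gamma> w) *\<^sub>R grad ?S (\<mu> \<gamma>) w) z = divg W (\<lambda>w. M (?\<Phi> w) *\<^sub>R grad W ?\<mu> w) z"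
      proof (rule agree_divg[OF _ \<gamma>(1) z])
        fix j
        have "agree z (\<lambda>w. M (\<phi> \<gamma> w) * dx ?S j (\<mu> \<gamma>) w) (\<lambda>w. M (?\<Phi> w) * dx W j ?\<mu> w)"
          by (rule agree_mult[OF agree_compose[OF a\<phi> M] agree_dx_expansion[OF e\<mu> \<gamma> z]])
        then show "agree z (\<lambda>w. (M (\<phi> \<gamma> w) *\<^sub>R grad ?S (\<mu> \<gamma>) w) $ j) (\<lambda>w. (M (?\<Phi> w) *\<^sub>R grad W ?\<mu> w) $ j)"
          by (simp add: grad_def)
      qed
      also have "\<dots> = sdiv T \<Gamma> \<nu> (\<lambda>w. M (\<phi>0 w) *\<^sub>R sgrad T \<Gamma> \<nu> \<mu>0 w) z"
        by (rule surface_flux_divergence[OF expansion_twice[OF e\<mu>] x\<mu> flux\<mu> extends_compose[OF x\<phi> M] z, symmetric])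
      finally show ?thesis
        using phase[OF \<gamma> refl zt]
        by (simp add: material_dt_eq[where u = u0, OF x\<phi> z un] agree_dt[OF a\<phi> \<gamma>(1) z] agree_grad[OF a\<phi> \<gamma>(1) z] uz)
    qed

    show "\<mu>0 z = - \<epsilon> * slaplace T \<Gamma> \<nu> \<phi>0 z + 1 / \<epsilon> * deriv F (\<phi>0 z)"
    proof -
      have one: "extends (\<lambda>_. 1 :: real) (\<lambda>_. 1)" by (simp add: extends_def)
      have "laplace ?S (\<phi> \<gamma>) z = divg W (grad W ?\<Phi>) z" unfolding laplace_def
      proof (rule agree_divg[OF _ \<gamma>(1) z])
        show "agree z (\<lambda>w. grad ?S (\<phi> \<gamma>) w $ j) (\<lambda>w. grad W ?\<Phi> w $ j)" for j
          using agree_dx_expansion[OF e\<phi> \<gamma> z, of j] by (simp add: grad_def)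
      qed
      also have "\<dots> = slaplace T \<Gamma> \<nu> \<phi>0 z" unfolding slaplace_def
        using surface_flux_divergence[OF expansion_twice[OF e\<phi>] x\<phi> flux\<phi> one z] by simp
      finally show ?thesis using potential[OF \<gamma> refl zt] by (simp add: \<phi>z \<mu>z)
    qed

    show "\<rho> *\<^sub>R vmaterial_dt T \<Gamma> \<nu> V u0 u0 z
        = - sgrad T \<Gamma> \<nu> p0 z - p1 z *\<^sub>R \<nu> z
          + smdiv T \<Gamma> \<nu> (\<lambda>w. (2 * \<eta> (\<phi>0 w)) *\<^sub>R sstrain T \<Gamma> \<nu> u0 w) z
          - \<epsilon> *\<^sub>R smdiv T \<Gamma> \<nu> (\<lambda>w. sgrad T \<Gamma> \<nu> \<phi>0 w \<otimes>\<^sub>o sgrad T \<Gamma> \<nu> \<phi>0 w) z"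
    proof -
      have inertia: "vmaterial_dt T \<Gamma> \<nu> V u0 u0 z = dt ?S (u \<gamma>) z + convect ?S (u \<gamma>) (u \<gamma>) z"
      proof -
        have "vmaterial_dt T \<Gamma> \<nu> V u0 u0 z $ i = (dt ?S (u \<gamma>) z + convect ?S (u \<gamma>) (u \<gamma>) z) $ i" for i
        proof -
          have "dt ?S (u \<gamma>) z $ i = dt W (\<lambda>w. ?U w $ i) z"
            unfolding agree_dt[OF au \<gamma>(1) z] unfolding dt_def
            by (rule dderiv_nth[OF fat_W[OF zW] Ud, symmetric])
          moreover have "convect ?S (u \<gamma>) (u \<gamma>) z $ i = u0 z \<bullet> grad W (\<lambda>w. ?U w $ i) z"
            by (simp add: convect_def inner_vec_def grad_def agree_dx[OF aui \<gamma>(1) z] uz)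
          ultimately show ?thesis
            by (simp add: vmaterial_dt_def material_dt_eq[where u = u0, OF extends_nth[OF xu] z un])
        qed
        then show ?thesis by (simp add: vec_eq_iff)
      qed
      have pressure: "grad ?S (p \<gamma>) z = sgrad T \<Gamma> \<nu> p0 z + p1 z *\<^sub>R \<nu> z"
      proof -
        have "grad W ?p z \<bullet> \<nu> z = p1 z"
          using grad_inner[of ?p z W "\<nu> z"] xp z expand_normal[OF expansion_coefficients[OF ep] zW]
          by (simp add: extends_def nz on_surface(2)[OF z] lift_on_surface[OF z])
        then show ?thesis by (simp add: sgrad_eq[OF xp z] proj_mult agree_grad[OF ap \<gamma>(1) z])
      qed
      have viscous: "mdivg ?S (\<lambda>w. (2 * \<eta> (\<phi> \<gamma> w)) *\<^sub>R strain ?S (u \<gamma>) w) z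
          = smdiv T \<Gamma> \<nu> (\<lambda>w. (2 * \<eta> (\<phi>0 w)) *\<^sub>R sstrain T \<Gamma> \<nu> u0 w) z"
      proof -
        have "mdivg ?S (\<lambda>w. (2 * \<eta> (\<phi> \<gamma> w)) *\<^sub>R strain ?S (u \<gamma>) w) z
            = mdivg W (\<lambda>w. (2 * \<eta> (?\<Phi> w)) *\<^sub>R strain W ?U w) z"
        proof (rule agree_mdivg[OF _ \<gamma>(1) z])
          fix i j
          have "agree z (\<lambda>w. (2 * \<eta> (\<phi> \<gamma> w)) * strain ?S (u \<gamma>) w $ i $ j) (\<lambda>w. (2 * \<eta> (?\<Phi> w)) * strain W ?U w $ i $ j)"
            by (rule agree_mult[OF agree_mult[OF agree_const agree_compose[OF a\<phi> \<eta>]] agree_strain[OF eu \<gamma> z]])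
          then show "agree z (\<lambda>w. ((2 * \<eta> (\<phi> \<gamma> w)) *\<^sub>R strain ?S (u \<gamma>) w) $ i $ j)
              (\<lambda>w. ((2 * \<eta> (?\<Phi> w)) *\<^sub>R strain W ?U w) $ i $ j)" by simp
        qed
        moreover have "extends (\<lambda>w. 2 * \<eta> (?\<Phi> w)) (\<lambda>w. 2 * \<eta> (\<phi>0 w))"
          by (rule extends_compose[OF x\<phi>, of "\<lambda>x. 2 * \<eta> x"]) (intro differentiable_mult differentiable_const \<eta>)
        ultimately show ?thesis using surface_viscous_stress[OF eu bu bE _ z] by simp
      qed
      have capillary: "mdivg ?S (\<lambda>w. grad ?S (\<phi> \<gamma>) w \<otimes>\<^sub>o grad ?S (\<phi> \<gamma>) w) z
          = smdiv T \<Gamma> \<nu> (\<lambda>w. sgrad T \<Gamma> \<nu> \<phi>0 w \<otimes>\<^sub>o sgrad T \<Gamma> \<nu> \<phi>0 w) z"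
      proof -
        have "mdivg ?S (\<lambda>w. grad ?S (\<phi> \<gamma>) w \<otimes>\<^sub>o grad ?S (\<phi> \<gamma>) w) z = mdivg W (\<lambda>w. grad W ?\<Phi> w \<otimes>\<^sub>o grad W ?\<Phi> w) z"
        proof (rule agree_mdivg[OF _ \<gamma>(1) z])
          fix i j
          have "agree z (\<lambda>w. dx ?S i (\<phi> \<gamma>) w * dx ?S j (\<phi> \<gamma>) w) (\<lambda>w. dx W i ?\<Phi> w * dx W j ?\<Phi> w)"
            by (rule agree_mult[OF agree_dx_expansion[OF e\<phi> \<gamma> z] agree_dx_expansion[OF e\<phi> \<gamma> z]])
          then show "agree z (\<lambda>w. (grad ?S (\<phi> \<gamma>) w \<otimes>\<^sub>o grad ?S (\<phi> \<gamma>) w) $ i $ j)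
              (\<lambda>w. (grad W ?\<Phi> w \<otimes>\<^sub>o grad W ?\<Phi> w) $ i $ j)" by (simp add: outer_prod_def grad_def)
        qed
        then show ?thesis
          by (simp add: surface_capillary_stress[OF expansion_twice[OF e\<phi>] x\<phi> flux\<phi> z])
      qed
      show ?thesis
        using momentum[OF \<gamma> refl zt] unfolding inertia pressure viscous capillary by simp
    qed
  qed
qed

end
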